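(* Let $\mathcal M\models T_{c,D}^*$. Then $\mathcal M$ satisfies uniform finiteness $(UF)$ (i.e. eliminates the quantifier $\exists^\infty$): for all $m,n\in\mathbb N$ with $m,n\geq 1$ and every subset $S\subseteq M^m\times M^n$ definable in $\mathcal M$ (with parameters), there exists $N\in\mathbb N$ such that for every $\bar x\in M^m$ the fiber $\{\bar y\in M^n:(\bar x,\bar y)\in S\}$ is either infinite or finite of cardinality $\le N$.
   Context: Setting. $\mathcal L$ is an expansion of the language of rings by relation symbols $R_i$ ($i\in I$, $R_i$ of arity $n_i$) and constants only. A topological $\mathcal L$-field is an $\mathcal L\cup\{^{-1}\}$-structure which is a field $K$ of characteristic $0$ with a non-discrete Hausdorff field topology, such that each $R_i$ and its complement are each interpreted as the union of an open subset of $K^{n_i}$ and the zero set in $K^{n_i}$ of finitely many polynomials over $K$. $T$ is a universal $\mathcal L\cup\{^{-1}\}$-theory whose models are topological $\mathcal L$-fields with a uniformly definable basis of neighbourhoods of $0$ (there is a formula $\varrho(x,\bar y)$ such that the sets $\varrho(K,\bar a)$, $\bar a\subset K$, form a basis $\mathcal V$ of neighbourhoods of $0$). $T$ has a model-completion $T_c$. $\mathcal L_D=\mathcal L\cup\{^{-1},D\}$; $T_D$ (resp. $T_{c,D}$) is $T$ (resp. $T_c$) together with the axioms saying that $D$ is a derivation (no continuity assumed). $T_{c,D}^*$ is $T_{c,D}$ together with the scheme (DL): for each differential polynomial $f(X)=f^*(X,X^{(1)},\dots,X^{(n)})\in K\{X\}$, with $s_f=\partial f/\partial X^{(n)}$ and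 $s_f^*$ the corresponding ordinary polynomial, and each $W\in\mathcal V$: if there are $\alpha_0,\dots,\alpha_n\in K$ with $f^*(\alpha_0,\dots,\alpha_n)=0$ and $s_f^*(\alpha_0,\dots,\alpha_n)\ne0$, then there is $z\in K$ with $f(z)=0$, $s_f(z)\neq0$ and $D^i(z)-\alpha_i\in W$ for $0\le i\le n$. Standing assumptions on $T_c$: (a) its models satisfy Hypothesis (I) of Guzy–Point (a topological analogue of largeness of fields), which ensures that $T_{c,D}^*$ is the model-completion of $T_D$ and admits quantifier elimination; (b) finite Skolem functions: for each $\mathcal L$-formula $\varphi(\bar x,y)$ there is a definable function $F$ such that whenever $\varphi(\bar a,\cdot)$ has a finite nonempty solution set, $\varphi(\bar a,F(\bar a))$ holds; (c) local continuity property: for polynomials $p_1,\dots,p_k\in A[\bar X,Y]$ over a model $A$, closed under $\partial/\partial Y$, with $d$ the sum of their $Y$-degrees, $S_j$ ($1\le j\le d$) the set of $\bar a$ for which $\bigvee_i p_i(\bar a,y)=0$ has exactly $j$ solutions, and $F_{j,1},\dots,F_{j,j}$ definable functions enumerating these solutions on $S_j$, every point of $Int(S_j)$ has an open ball in $S_j$ on which all $F_{j,r}$ are continuous; (d) $acl^{\mathcal L}$ satisfies exchange. *)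

theory Defs
  imports
    "HOL-Algebra.Indexed_Polynomials"
    "HOL-Analysis.Function_Topology"
    "HOL-Analysis.Product_Topology"
    "HOL-Analysis.Locally"
    "HOL-Analysis.T1_Spaces"
begin

section \<open>Languages, structures, formulas\<close>

text \<open>
  A language \<open>L\<close> expands the language of rings \<open>{+, *, -, 0, 1}\<close> by a set of relation symbols
  with arities and a set of constants. The two further function symbols are collected in a set
  \<open>Ops\<close>: the languages \<open>L\<close>, \<open>L \<union> {inverse}\<close> and \<open>L \<union> {inverse, D}\<close> are given by
  \<open>Ops = {}\<close>, \<open>{Inverse}\<close> and \<open>{Inverse, Deriv}\<close>.
\<close>

record ('r, 'c) language =
  rsyms :: "'r set"
  arity :: "'r \<Rightarrow> nat"
  csyms :: "'c set"

datatype fun_op = Inverse | Deriv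

datatype 'c tm =
    TVar nat | TConst 'c | TZero | TOne | TOpp "'c tm"
  | TAdd "'c tm" "'c tm" | TMul "'c tm" "'c tm" | TInv "'c tm" | TDer "'c tm"

datatype ('r, 'c) fm =
    FEq "'c tm" "'c tm" | FRel 'r "'c tm list"
  | FNot "('r, 'c) fm" | FAnd "('r, 'c) fm" "('r, 'c) fm"
  | FEx nat "('r, 'c) fm" | FAll nat "('r, 'c) fm"

primrec tm_in :: "('r, 'c) language \<Rightarrow> fun_op set \<Rightarrow> 'c tm \<Rightarrow> bool" where
  "tm_in L Ops (TVar k) \<longleftrightarrow> True"
| "tm_in L Ops (TConst c) \<longleftrightarrow> c \<in> csyms L"
| "tm_in L Ops TZero \<longleftrightarrow> True"
| "tm_in L Ops TOne \<longleftrightarrow> True"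
| "tm_in L Ops (TOpp t) \<longleftrightarrow> tm_in L Ops t"
| "tm_in L Ops (TAdd s t) \<longleftrightarrow> tm_in L Ops s \<and> tm_in L Ops t"
| "tm_in L Ops (TMul s t) \<longleftrightarrow> tm_in L Ops s \<and> tm_in L Ops t"
| "tm_in L Ops (TInv t) \<longleftrightarrow> Inverse \<in> Ops \<and> tm_in L Ops t"
| "tm_in L Ops (TDer t) \<longleftrightarrow> Deriv \<in> Ops \<and> tm_in L Ops t"

primrec fm_in :: "('r, 'c) language \<Rightarrow> fun_op set \<Rightarrow> ('r, 'c) fm \<Rightarrow> bool" where
  "fm_in L Ops (FEq s t) \<longleftrightarrow> tm_in L Ops s \<and> tm_in L Ops t"
| "fm_in L Ops (FRel r ts) \<longleftrightarrow>
     r \<in> rsyms L \<and> length ts = arity L r \<and> (\<forall>t\<in>set ts. tm_in L Ops t)"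
| "fm_in L Ops (FNot \<phi>) \<longleftrightarrow> fm_in L Ops \<phi>"
| "fm_in L Ops (FAnd \<phi> \<psi>) \<longleftrightarrow> fm_in L Ops \<phi> \<and> fm_in L Ops \<psi>"
| "fm_in L Ops (FEx k \<phi>) \<longleftrightarrow> fm_in L Ops \<phi>"
| "fm_in L Ops (FAll k \<phi>) \<longleftrightarrow> fm_in L Ops \<phi>"

primrec tm_vars :: "'c tm \<Rightarrow> nat set" where
  "tm_vars (TVar k) = {k}"
| "tm_vars (TConst c) = {}"
| "tm_vars TZero = {}"
| "tm_vars TOne = {}"
| "tm_vars (TOpp t) = tm_vars t"
| "tm_vars (TAdd s t) = tm_vars s \<union> tm_vars t"
| "tm_vars (TMul s t) = tm_vars s \<union> tm_vars t"
| "tm_vars (TInv t) = tm_vars t"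
| "tm_vars (TDer t) = tm_vars t"

primrec free_vars :: "('r, 'c) fm \<Rightarrow> nat set" where
  "free_vars (FEq s t) = tm_vars s \<union> tm_vars t"
| "free_vars (FRel r ts) = (\<Union>t\<in>set ts. tm_vars t)"
| "free_vars (FNot \<phi>) = free_vars \<phi>"
| "free_vars (FAnd \<phi> \<psi>) = free_vars \<phi> \<union> free_vars \<psi>"
| "free_vars (FEx k \<phi>) = free_vars \<phi> - {k}"
| "free_vars (FAll k \<phi>) = free_vars \<phi> - {k}"

primrec qfree :: "('r, 'c) fm \<Rightarrow> bool" where
  "qfree (FEq s t) \<longleftrightarrow> True"
| "qfree (FRel r ts) \<longleftrightarrow> True"
| "qfree (FNot \<phi>) \<longleftrightarrow> qfree \<phi>"
| "qfree (FAnd \<phi> \<psi>) \<longleftrightarrow> qfree \<phi> \<and> qfree \<psi>"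
| "qfree (FEx k \<phi>) \<longleftrightarrow> False"
| "qfree (FAll k \<phi>) \<longleftrightarrow> False"

inductive universal_fm :: "('r, 'c) fm \<Rightarrow> bool" where
  "qfree \<phi> \<Longrightarrow> universal_fm \<phi>"
| "universal_fm \<phi> \<Longrightarrow> universal_fm (FAll k \<phi>)"

definition is_theory :: "('r, 'c) language \<Rightarrow> fun_op set \<Rightarrow> ('r, 'c) fm set \<Rightarrow> bool" where
  "is_theory L Ops T \<longleftrightarrow> (\<forall>\<phi>\<in>T. fm_in L Ops \<phi> \<and> free_vars \<phi> = {})"

definition is_universal_theory ::
    "('r, 'c) language \<Rightarrow> fun_op set \<Rightarrow> ('r, 'c) fm set \<Rightarrow> bool" where
  "is_universal_theory L Ops T \<longleftrightarrow> is_theory L Ops T \<and> (\<forall>\<phi>\<in>T. universal_fm \<phi>)"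

text \<open>
  Structures extend the ring records of HOL-Algebra, so that \<open>field A\<close> is the library predicate.
  The symbol \<open>-\<close> is interpreted by \<open>opp\<close>, the inverse symbol by \<open>recip\<close>, and \<open>D\<close> by \<open>der\<close>; the
  interpretations of symbols outside the language at hand play no role. A relation is a set of
  tuples, an \<open>n\<close>-tuple being an extensional function on \<open>{..<n}\<close>.
\<close>

record ('u, 'r, 'c) struct = "'u ring" +
  opp :: "'u \<Rightarrow> 'u"
  recip :: "'u \<Rightarrow> 'u"
  der :: "'u \<Rightarrow> 'u"
  cst :: "'c \<Rightarrow> 'u"
  rel :: "'r \<Rightarrow> (nat \<Rightarrow> 'u) set"

abbreviation tuples :: "('u, 'r, 'c) struct \<Rightarrow> nat \<Rightarrow> (nat \<Rightarrow> 'u) set" where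
  "tuples A n \<equiv> {..<n} \<rightarrow>\<^sub>E carrier A"

definition is_struct :: "('r, 'c) language \<Rightarrow> fun_op set \<Rightarrow> ('u, 'r, 'c) struct \<Rightarrow> bool" where
  "is_struct L Ops A \<longleftrightarrow>
     \<zero>\<^bsub>A\<^esub> \<in> carrier A \<and> \<one>\<^bsub>A\<^esub> \<in> carrier A \<and>
     (\<forall>x\<in>carrier A. \<forall>y\<in>carrier A. x \<oplus>\<^bsub>A\<^esub> y \<in> carrier A \<and> x \<otimes>\<^bsub>A\<^esub> y \<in> carrier A) \<and>
     (\<forall>x\<in>carrier A. opp A x \<in> carrier A) \<and>
     (Inverse \<in> Ops \<longrightarrow> (\<forall>x\<in>carrier A. recip A x \<in> carrier A)) \<and>
     (Deriv \<in> Ops \<longrightarrow> (\<forall>x\<in>carrier A. der A x \<in> carrier A)) \<and>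
     (\<forall>c\<in>csyms L. cst A c \<in> carrier A) \<and>
     (\<forall>r\<in>rsyms L. rel A r \<subseteq> tuples A (arity L r))"

primrec eval :: "('u, 'r, 'c) struct \<Rightarrow> (nat \<Rightarrow> 'u) \<Rightarrow> 'c tm \<Rightarrow> 'u" where
  "eval A e (TVar k) = e k"
| "eval A e (TConst c) = cst A c"
| "eval A e TZero = \<zero>\<^bsub>A\<^esub>"
| "eval A e TOne = \<one>\<^bsub>A\<^esub>"
| "eval A e (TOpp t) = opp A (eval A e t)"
| "eval A e (TAdd s t) = eval A e s \<oplus>\<^bsub>A\<^esub> eval A e t"
| "eval A e (TMul s t) = eval A e s \<otimes>\<^bsub>A\<^esub> eval A e t"
| "eval A e (TInv t) = recip A (eval A e t)"
| "eval A e (TDer t) = der A (eval A e t)"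

primrec sat :: "('u, 'r, 'c) struct \<Rightarrow> (nat \<Rightarrow> 'u) \<Rightarrow> ('r, 'c) fm \<Rightarrow> bool" where
  "sat A e (FEq s t) \<longleftrightarrow> eval A e s = eval A e t"
| "sat A e (FRel r ts) \<longleftrightarrow> (\<lambda>i\<in>{..<length ts}. eval A e (ts ! i)) \<in> rel A r"
| "sat A e (FNot \<phi>) \<longleftrightarrow> \<not> sat A e \<phi>"
| "sat A e (FAnd \<phi> \<psi>) \<longleftrightarrow> sat A e \<phi> \<and> sat A e \<psi>"
| "sat A e (FEx k \<phi>) \<longleftrightarrow> (\<exists>a\<in>carrier A. sat A (e(k := a)) \<phi>)"
| "sat A e (FAll k \<phi>) \<longleftrightarrow> (\<forall>a\<in>carrier A. sat A (e(k := a)) \<phi>)"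

abbreviation assignments :: "('u, 'r, 'c) struct \<Rightarrow> (nat \<Rightarrow> 'u) set" where
  "assignments A \<equiv> {e. range e \<subseteq> carrier A}"

definition Models ::
    "('r, 'c) language \<Rightarrow> fun_op set \<Rightarrow> ('r, 'c) fm set \<Rightarrow> ('u, 'r, 'c) struct set" where
  "Models L Ops T = {A. is_struct L Ops A \<and> (\<forall>\<phi>\<in>T. \<forall>e\<in>assignments A. sat A e \<phi>)}"

definition solutions ::
    "('u, 'r, 'c) struct \<Rightarrow> ('r, 'c) fm \<Rightarrow> nat \<Rightarrow> (nat \<Rightarrow> 'u) \<Rightarrow> 'u set" where
  "solutions A \<phi> k e = {b \<in> carrier A. sat A (e(k := b)) \<phi>}"

text \<open>Definability with parameters: the variables from \<open>n\<close> on carry the parameters.\<close>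

definition definable ::
    "('r, 'c) language \<Rightarrow> fun_op set \<Rightarrow> ('u, 'r, 'c) struct \<Rightarrow> nat \<Rightarrow> (nat \<Rightarrow> 'u) set \<Rightarrow> bool" where
  "definable L Ops A n S \<longleftrightarrow>
     (\<exists>\<phi>. \<exists>e\<in>assignments A. fm_in L Ops \<phi> \<and>
        S = {x \<in> tuples A n. sat A (\<lambda>k. if k < n then x k else e k) \<phi>})"

text \<open>The identification of \<open>A\<^sup>m \<times> A\<^sup>n\<close> with \<open>A\<^sup>m\<^sup>+\<^sup>n\<close>.\<close>

definition append_tuple :: "nat \<Rightarrow> nat \<Rightarrow> (nat \<Rightarrow> 'u) \<times> (nat \<Rightarrow> 'u) \<Rightarrow> nat \<Rightarrow> 'u" where
  "append_tuple m n = (\<lambda>(x, y). \<lambda>i\<in>{..<m + n}. if i < m then x i else y (i - m))"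

definition definable_fun_on ::
    "('r, 'c) language \<Rightarrow> fun_op set \<Rightarrow> ('u, 'r, 'c) struct \<Rightarrow> nat \<Rightarrow>
     (nat \<Rightarrow> 'u) set \<Rightarrow> ((nat \<Rightarrow> 'u) \<Rightarrow> 'u) \<Rightarrow> bool" where
  "definable_fun_on L Ops A m S F \<longleftrightarrow>
     S \<subseteq> tuples A m \<and> F \<in> S \<rightarrow> carrier A \<and>
     definable L Ops A (Suc m) {x(m := F x) | x. x \<in> S}"

section \<open>Model completions and quantifier elimination\<close>

definition embedding ::
    "('r, 'c) language \<Rightarrow> fun_op set \<Rightarrow> ('u \<Rightarrow> 'v) \<Rightarrow>
     ('u, 'r, 'c) struct \<Rightarrow> ('v, 'r, 'c) struct \<Rightarrow> bool" where
  "embedding L Ops f A B \<longleftrightarrow>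
     f \<in> carrier A \<rightarrow> carrier B \<and> inj_on f (carrier A) \<and>
     f \<zero>\<^bsub>A\<^esub> = \<zero>\<^bsub>B\<^esub> \<and> f \<one>\<^bsub>A\<^esub> = \<one>\<^bsub>B\<^esub> \<and>
     (\<forall>x\<in>carrier A. \<forall>y\<in>carrier A.
        f (x \<oplus>\<^bsub>A\<^esub> y) = f x \<oplus>\<^bsub>B\<^esub> f y \<and> f (x \<otimes>\<^bsub>A\<^esub> y) = f x \<otimes>\<^bsub>B\<^esub> f y) \<and>
     (\<forall>x\<in>carrier A. f (opp A x) = opp B (f x)) \<and>
     (Inverse \<in> Ops \<longrightarrow> (\<forall>x\<in>carrier A. f (recip A x) = recip B (f x))) \<and>
     (Deriv \<in> Ops \<longrightarrow> (\<forall>x\<in>carrier A. f (der A x) = der B (f x))) \<and>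
     (\<forall>c\<in>csyms L. f (cst A c) = cst B c) \<and>
     (\<forall>r\<in>rsyms L. \<forall>x\<in>tuples A (arity L r).
        x \<in> rel A r \<longleftrightarrow> (\<lambda>i\<in>{..<arity L r}. f (x i)) \<in> rel B r)"

text \<open>
  Theories enter through their classes of models (inside one type \<open>'u\<close>). \<open>\<K>'\<close> is the
  model completion of \<open>\<K>\<close> if it is contained in \<open>\<K>\<close>, every \<open>A \<in> \<K>\<close> embeds into a member of
  \<open>\<K>'\<close>, and the theory of \<open>\<K>'\<close> together with the diagram of any \<open>A \<in> \<K>\<close> is complete.
\<close>

definition model_completion ::
    "('r, 'c) language \<Rightarrow> fun_op set \<Rightarrow>
     ('u, 'r, 'c) struct set \<Rightarrow> ('u, 'r, 'c) struct set \<Rightarrow> bool" where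
  "model_completion L Ops \<K> \<K>' \<longleftrightarrow>
     \<K>' \<subseteq> \<K> \<and>
     (\<forall>A\<in>\<K>. \<exists>B\<in>\<K>'. \<exists>f. embedding L Ops f A B) \<and>
     (\<forall>A\<in>\<K>. \<forall>B\<in>\<K>'. \<forall>C\<in>\<K>'. \<forall>f g.
        embedding L Ops f A B \<and> embedding L Ops g A C \<longrightarrow>
        (\<forall>\<phi>. \<forall>e\<in>assignments A. fm_in L Ops \<phi> \<longrightarrow> (sat B (f \<circ> e) \<phi> \<longleftrightarrow> sat C (g \<circ> e) \<phi>)))"

definition quantifier_elimination ::
    "('r, 'c) language \<Rightarrow> fun_op set \<Rightarrow> ('u, 'r, 'c) struct set \<Rightarrow> bool" where
  "quantifier_elimination L Ops \<K> \<longleftrightarrow>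
     (\<forall>\<phi>. fm_in L Ops \<phi> \<longrightarrow>
        (\<exists>\<psi>. fm_in L Ops \<psi> \<and> qfree \<psi> \<and> free_vars \<psi> \<subseteq> free_vars \<phi> \<and>
          (\<forall>A\<in>\<K>. \<forall>e\<in>assignments A. sat A e \<phi> \<longleftrightarrow> sat A e \<psi>)))"

section \<open>Polynomials in several variables\<close>

text \<open>
  The library's indexed polynomials: \<open>p m\<close> is the coefficient of the monomial given by the
  multiset \<open>m\<close> of variables.
\<close>

abbreviation polys :: "('u, 'r, 'c) struct \<Rightarrow> nat \<Rightarrow> (nat multiset \<Rightarrow> 'u) set" where
  "polys A n \<equiv> ring.indexed_pset A {..<n} (carrier A)"

definition poly_eval ::
    "('u, 'r, 'c) struct \<Rightarrow> (nat multiset \<Rightarrow> 'u) \<Rightarrow> (nat \<Rightarrow> 'u) \<Rightarrow> 'u" where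
  "poly_eval A p x =
     (\<Oplus>\<^bsub>A\<^esub>m\<in>{m. p m \<noteq> \<zero>\<^bsub>A\<^esub>}. p m \<otimes>\<^bsub>A\<^esub> (\<Otimes>\<^bsub>A\<^esub>i\<in>set_mset m. x i [^]\<^bsub>A\<^esub> count m i))"

definition poly_deriv ::
    "('u, 'r, 'c) struct \<Rightarrow> nat \<Rightarrow> (nat multiset \<Rightarrow> 'u) \<Rightarrow> nat multiset \<Rightarrow> 'u" where
  "poly_deriv A i p = (\<lambda>m. [Suc (count m i)] \<cdot>\<^bsub>A\<^esub> p (add_mset i m))"

definition poly_degree_in ::
    "('u, 'r, 'c) struct \<Rightarrow> nat \<Rightarrow> (nat multiset \<Rightarrow> 'u) \<Rightarrow> nat" where
  "poly_degree_in A i p = Max (insert 0 ((\<lambda>m. count m i) ` {m. p m \<noteq> \<zero>\<^bsub>A\<^esub>}))"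

definition zero_set ::
    "('u, 'r, 'c) struct \<Rightarrow> nat \<Rightarrow> (nat multiset \<Rightarrow> 'u) set \<Rightarrow> (nat \<Rightarrow> 'u) set" where
  "zero_set A n P = {x \<in> tuples A n. \<forall>p\<in>P. poly_eval A p x = \<zero>\<^bsub>A\<^esub>}"

section \<open>Topological fields\<close>

abbreviation power_top :: "'u topology \<Rightarrow> nat \<Rightarrow> (nat \<Rightarrow> 'u) topology" where
  "power_top \<tau> n \<equiv> product_topology (\<lambda>_. \<tau>) {..<n}"

definition field_topology :: "('u, 'r, 'c) struct \<Rightarrow> 'u topology \<Rightarrow> bool" where
  "field_topology A \<tau> \<longleftrightarrow>
     topspace \<tau> = carrier A \<and> Hausdorff_space \<tau> \<and> \<tau> \<noteq> discrete_topology (carrier A) \<and>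
     continuous_map (prod_topology \<tau> \<tau>) \<tau> (\<lambda>(x, y). x \<oplus>\<^bsub>A\<^esub> y) \<and>
     continuous_map (prod_topology \<tau> \<tau>) \<tau> (\<lambda>(x, y). x \<otimes>\<^bsub>A\<^esub> y) \<and>
     continuous_map \<tau> \<tau> (\<lambda>x. \<ominus>\<^bsub>A\<^esub> x) \<and>
     continuous_map (subtopology \<tau> (carrier A - {\<zero>\<^bsub>A\<^esub>})) \<tau> (\<lambda>x. inv\<^bsub>A\<^esub> x)"

definition open_union_zero_set ::
    "('u, 'r, 'c) struct \<Rightarrow> 'u topology \<Rightarrow> nat \<Rightarrow> (nat \<Rightarrow> 'u) set \<Rightarrow> bool" where
  "open_union_zero_set A \<tau> n R \<longleftrightarrow>
     (\<exists>U P. openin (power_top \<tau> n) U \<and> finite P \<and> P \<subseteq> polys A n \<and> R = U \<union> zero_set A n P)"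

text \<open>The value of \<open>recip\<close> at \<open>0\<close> is left to the theory under consideration.\<close>

definition topological_field ::
    "('r, 'c) language \<Rightarrow> ('u, 'r, 'c) struct \<Rightarrow> 'u topology \<Rightarrow> bool" where
  "topological_field L A \<tau> \<longleftrightarrow>
     is_struct L {Inverse} A \<and> field A \<and>
     (\<forall>x\<in>carrier A. opp A x = \<ominus>\<^bsub>A\<^esub> x) \<and>
     (\<forall>x\<in>carrier A - {\<zero>\<^bsub>A\<^esub>}. recip A x = inv\<^bsub>A\<^esub> x) \<and>
     (\<forall>n::nat. n > 0 \<longrightarrow> [n] \<cdot>\<^bsub>A\<^esub> \<one>\<^bsub>A\<^esub> \<noteq> \<zero>\<^bsub>A\<^esub>) \<and>
     field_topology A \<tau> \<and>
     (\<forall>r\<in>rsyms L.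
        open_union_zero_set A \<tau> (arity L r) (rel A r) \<and>
        open_union_zero_set A \<tau> (arity L r) (tuples A (arity L r) - rel A r))"

text \<open>
  The sets \<open>\<rho>(A, a)\<close>, with variable \<open>0\<close> in the role of \<open>x\<close> and all other variables being
  parameters.
\<close>

definition basic_nbhds :: "('u, 'r, 'c) struct \<Rightarrow> ('r, 'c) fm \<Rightarrow> 'u set set" where
  "basic_nbhds A \<rho> = solutions A \<rho> 0 ` assignments A"

text \<open>For a topological field \<open>A\<close> at most one \<open>\<tau>\<close> satisfies the following.\<close>

definition topological_field_via ::
    "('r, 'c) language \<Rightarrow> ('r, 'c) fm \<Rightarrow> ('u, 'r, 'c) struct \<Rightarrow> 'u topology \<Rightarrow> bool" where
  "topological_field_via L \<rho> A \<tau> \<longleftrightarrow>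
     topological_field L A \<tau> \<and>
     (\<forall>V\<in>basic_nbhds A \<rho>. \<exists>U. openin \<tau> U \<and> \<zero>\<^bsub>A\<^esub> \<in> U \<and> U \<subseteq> V) \<and>
     neighbourhood_base_at \<zero>\<^bsub>A\<^esub> (\<lambda>V. V \<in> basic_nbhds A \<rho>) \<tau>"

section \<open>Derivations\<close>

definition is_derivation :: "('u, 'r, 'c) struct \<Rightarrow> bool" where
  "is_derivation A \<longleftrightarrow>
     der A \<in> carrier A \<rightarrow> carrier A \<and>
     (\<forall>x\<in>carrier A. \<forall>y\<in>carrier A.
        der A (x \<oplus>\<^bsub>A\<^esub> y) = der A x \<oplus>\<^bsub>A\<^esub> der A y \<and>
        der A (x \<otimes>\<^bsub>A\<^esub> y) = (der A x \<otimes>\<^bsub>A\<^esub> y) \<oplus>\<^bsub>A\<^esub> (x \<otimes>\<^bsub>A\<^esub> der A y))"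

definition jet :: "('u, 'r, 'c) struct \<Rightarrow> nat \<Rightarrow> 'u \<Rightarrow> nat \<Rightarrow> 'u" where
  "jet A n z = (\<lambda>i\<in>{..<Suc n}. (der A ^^ i) z)"

text \<open>
  A differential polynomial \<open>f(X)\<close> of order at most \<open>n\<close> is given by the polynomial \<open>f\<^sup>*\<close> in the
  variables \<open>0, \<dots>, n\<close>, where \<open>i\<close> stands for the \<open>i\<close>-th derivative of \<open>X\<close>; thus
  \<open>poly_deriv A n f\<close> is \<open>s\<^sub>f\<^sup>*\<close>, and \<open>f(z)\<close> is the value of \<open>f\<^sup>*\<close> at the jet of \<open>z\<close>.
\<close>

definition scheme_DL :: "('r, 'c) fm \<Rightarrow> ('u, 'r, 'c) struct \<Rightarrow> bool" where
  "scheme_DL \<rho> A \<longleftrightarrow>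
     (\<forall>n. \<forall>f\<in>polys A (Suc n). \<forall>W\<in>basic_nbhds A \<rho>. \<forall>\<alpha>\<in>tuples A (Suc n).
        poly_eval A f \<alpha> = \<zero>\<^bsub>A\<^esub> \<and> poly_eval A (poly_deriv A n f) \<alpha> \<noteq> \<zero>\<^bsub>A\<^esub> \<longrightarrow>
        (\<exists>z\<in>carrier A.
           poly_eval A f (jet A n z) = \<zero>\<^bsub>A\<^esub> \<and>
           poly_eval A (poly_deriv A n f) (jet A n z) \<noteq> \<zero>\<^bsub>A\<^esub> \<and>
           (\<forall>i\<le>n. (der A ^^ i) z \<ominus>\<^bsub>A\<^esub> \<alpha> i \<in> W)))"

text \<open>The models of \<open>T\<^sub>D\<close> and of \<open>T\<^sup>*\<^sub>D\<close>, for a theory \<open>T\<close> in the language \<open>L \<union> {inverse}\<close>.\<close>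

definition Models_D ::
    "('r, 'c) language \<Rightarrow> ('r, 'c) fm set \<Rightarrow> ('u, 'r, 'c) struct set" where
  "Models_D L T = {A \<in> Models L {Inverse} T. is_derivation A}"

definition Models_D_star ::
    "('r, 'c) language \<Rightarrow> ('r, 'c) fm \<Rightarrow> ('r, 'c) fm set \<Rightarrow> ('u, 'r, 'c) struct set" where
  "Models_D_star L \<rho> T = {A \<in> Models_D L T. scheme_DL \<rho> A}"

section \<open>Conditions on a class of topological fields\<close>

text \<open>
  Hypothesis (I) of Guzy and Point has no definition of its own here: it is represented by what it
  ensures, namely that \<open>Models_D_star\<close> of \<open>T\<^sub>c\<close> is the model completion of \<open>Models_D\<close> of \<open>T\<close>
  and admits quantifier elimination. As (I) implies these two properties, assuming only them
  gives a more general statement.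
\<close>

definition finite_skolem_functions ::
    "('r, 'c) language \<Rightarrow> ('u, 'r, 'c) struct set \<Rightarrow> bool" where
  "finite_skolem_functions L \<K> \<longleftrightarrow>
     (\<forall>\<phi> k. fm_in L {} \<phi> \<longrightarrow>
        (\<exists>\<psi>. fm_in L {Inverse} \<psi> \<and> free_vars \<psi> \<subseteq> insert k (free_vars \<phi>) \<and>
          (\<forall>A\<in>\<K>. \<forall>e\<in>assignments A.
             (\<exists>!b. b \<in> solutions A \<psi> k e) \<and>
             (finite (solutions A \<phi> k e) \<and> solutions A \<phi> k e \<noteq> {} \<longrightarrow>
                solutions A \<psi> k e \<subseteq> solutions A \<phi> k e))))"

text \<open>
  The variables are \<open>0, \<dots>, m - 1\<close> (for the tuple \<open>X\<close>) and \<open>m\<close> (for \<open>Y\<close>). The family \<open>P\<close> is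
  closed under \<open>\<partial>/\<partial>Y\<close> up to the zero polynomial, as a family containing \<open>0\<close> has all of the
  field as its set of solutions over every point. The functions \<open>F 1, \<dots>, F j\<close> are
  part of what is asserted to exist: an arbitrary definable enumeration may permute the solutions
  in a discontinuous way.
\<close>

definition root_set ::
    "('u, 'r, 'c) struct \<Rightarrow> nat \<Rightarrow> (nat multiset \<Rightarrow> 'u) set \<Rightarrow> (nat \<Rightarrow> 'u) \<Rightarrow> 'u set" where
  "root_set A m P a = {y \<in> carrier A. \<exists>p\<in>P. poly_eval A p (a(m := y)) = \<zero>\<^bsub>A\<^esub>}"

definition local_continuity ::
    "('r, 'c) language \<Rightarrow> ('r, 'c) fm \<Rightarrow> ('u, 'r, 'c) struct set \<Rightarrow> bool" where
  "local_continuity L \<rho> \<K> \<longleftrightarrow>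
     (\<forall>A\<in>\<K>. \<forall>\<tau> m P j.
        topological_field_via L \<rho> A \<tau> \<and> finite P \<and> P \<subseteq> polys A (Suc m) \<and>
        (\<forall>p\<in>P. poly_deriv A m p = (\<lambda>_. \<zero>\<^bsub>A\<^esub>) \<or> poly_deriv A m p \<in> P) \<and>
        j \<in> {1..(\<Sum>p\<in>P. poly_degree_in A m p)} \<longrightarrow>
        (let S = {a \<in> tuples A m. card (root_set A m P a) = j} in
         \<exists>F. (\<forall>r\<in>{1..j}. definable_fun_on L {Inverse} A m S (F r)) \<and>
             (\<forall>a\<in>S. bij_betw (\<lambda>r. F r a) {1..j} (root_set A m P a)) \<and>
             (\<forall>a\<in>power_top \<tau> m interior_of S. \<exists>U.
                openin (power_top \<tau> m) U \<and> a \<in> U \<and> U \<subseteq> S \<and>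
                (\<forall>r\<in>{1..j}. continuous_map (subtopology (power_top \<tau> m) U) \<tau> (F r)))))"

definition acl ::
    "('r, 'c) language \<Rightarrow> ('u, 'r, 'c) struct \<Rightarrow> 'u set \<Rightarrow> 'u set" where
  "acl L A B = {b. \<exists>\<phi> k. \<exists>e\<in>assignments A.
     fm_in L {} \<phi> \<and> e ` (free_vars \<phi> - {k}) \<subseteq> B \<and>
     finite (solutions A \<phi> k e) \<and> b \<in> solutions A \<phi> k e}"

definition acl_exchange ::
    "('r, 'c) language \<Rightarrow> ('u, 'r, 'c) struct set \<Rightarrow> bool" where
  "acl_exchange L \<K> \<longleftrightarrow>
     (\<forall>A\<in>\<K>. \<forall>B. B \<subseteq> carrier A \<longrightarrow>
        (\<forall>b\<in>carrier A. \<forall>c\<in>carrier A.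
           b \<in> acl L A (insert c B) - acl L A B \<longrightarrow> c \<in> acl L A (insert b B)))"

section \<open>Uniform finiteness\<close>

definition uniform_finiteness ::
    "('r, 'c) language \<Rightarrow> fun_op set \<Rightarrow> ('u, 'r, 'c) struct \<Rightarrow> bool" where
  "uniform_finiteness L Ops M \<longleftrightarrow>
     (\<forall>m n S. m \<ge> 1 \<and> n \<ge> 1 \<and> S \<subseteq> tuples M m \<times> tuples M n \<and>
        definable L Ops M (m + n) (append_tuple m n ` S) \<longrightarrow>
        (\<exists>N. \<forall>x\<in>tuples M m.
           infinite {y \<in> tuples M n. (x, y) \<in> S} \<or>
           (finite {y \<in> tuples M n. (x, y) \<in> S} \<and> card {y \<in> tuples M n. (x, y) \<in> S} \<le> N)))"

end

theory Submission
  imports Defs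
begin

text \<open>
  By quantifier elimination
  it suffices to bound the finite sets among the fibres, in one variable \<open>y\<close>, of a quantifier-free
  formula. Such a fibre is a finite union of sets given by differential polynomial equations in \<open>y\<close>
  and the condition that the sequence of derivatives of \<open>y\<close> lies in an open set; inverses and the
  polynomials describing the relations only cause finitely many case distinctions. So the claim
  is that a finite system \<open>F\<close> of differential polynomials, with coefficients depending on a parameter
  \<open>p\<close>, has a bound \<open>N\<close> such that for every \<open>p\<close> and every open set \<open>U\<close> the system has infinitely many
  or at most \<open>N\<close> solutions with derivatives in \<open>U\<close>.

  This goes by induction on the order. Pseudo-division in the highest derivative reduces to at
  most one equation of top order, with nonvanishing separant, and further equations of lower order.
  An equation \<open>g = 0\<close> of lower order with nonvanishing separant expresses all
  higher derivatives as rational functions of the lower ones, so the order drops. What remains is a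
  single equation \<open>f = 0\<close> with nonvanishing separant. If its order \<open>n\<close> is \<open>0\<close>, the degree bounds the
  number of roots. If \<open>n > 0\<close>, no solution \<open>y\<close> is isolated: with \<open>\<alpha>\<close> the sequence of derivatives of \<open>y\<close>
  and \<open>\<beta> = (0, 1, 0, \<dots>, 0)\<close>, apply (DL) to \<open>f(X + \<alpha> - \<beta>)\<close> at \<open>\<beta>\<close>. The solution \<open>z\<close> has \<open>z' \<noteq> 0\<close>, hence
  \<open>z \<noteq> 0\<close>, and yields an algebraic point of \<open>f = 0\<close> near \<open>\<alpha>\<close> whose coordinate \<open>0\<close> differs from \<open>y\<close>;
  a second use of (DL) gives a differential solution near that point.
\<close>

section \<open>Differential polynomials with parametric coefficients\<close>

text \<open>\<open>D\<close> need not be continuous, so open conditions are imposed on the whole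
  sequence of derivatives, whereas (DL) controls derivatives only up to the order of the equation.
  The remedy is to read the rational expressions for the higher derivatives as a continuous map on
  sequences, defined where the separant does not vanish: an open set is pulled back along this map
  and then restricts the low coordinates only.

  The numerical bound has a single source. An equation of order 0 contributes the length of its
  coefficient list; the other basic systems have no solution or infinitely many. Case distinctions
  are finite unions, for which bounds add up and an infinite piece makes the whole infinite. The
  number of cases is governed by the lengths of coefficient lists, and these are the same for all
  parameters even though leading coefficients may vanish at some of them.\<close>

text \<open>
  The coefficients are arbitrary functions of a parameter; this is what makes bounds obtained by
  induction on polynomials uniform in the parameter. \<open>Jv i\<close> stands for the \<open>i\<close>-th derivative.
\<close>

datatype ('p, 'u) dpol =
    Cst "'p \<Rightarrow> 'u" | Jv nat | Plus "('p, 'u) dpol" "('p, 'u) dpol"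
  | Times "('p, 'u) dpol" "('p, 'u) dpol"

primrec dev :: "('u, 'r, 'c) struct \<Rightarrow> 'p \<Rightarrow> (nat \<Rightarrow> 'u) \<Rightarrow> ('p, 'u) dpol \<Rightarrow> 'u" where
  "dev K p a (Cst c) = c p"
| "dev K p a (Jv i) = a i"
| "dev K p a (Plus f g) = dev K p a f \<oplus>\<^bsub>K\<^esub> dev K p a g"
| "dev K p a (Times f g) = dev K p a f \<otimes>\<^bsub>K\<^esub> dev K p a g"

text \<open>Terms are not identified by the ring laws, so identities between polynomials are stated
  for their values.\<close>

primrec pdiff :: "('u, 'r, 'c) struct \<Rightarrow> nat \<Rightarrow> ('p, 'u) dpol \<Rightarrow> ('p, 'u) dpol" where
  "pdiff K j (Cst c) = Cst (\<lambda>_. \<zero>\<^bsub>K\<^esub>)"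
| "pdiff K j (Jv i) = Cst (\<lambda>_. if i = j then \<one>\<^bsub>K\<^esub> else \<zero>\<^bsub>K\<^esub>)"
| "pdiff K j (Plus f g) = Plus (pdiff K j f) (pdiff K j g)"
| "pdiff K j (Times f g) = Plus (Times (pdiff K j f) g) (Times f (pdiff K j g))"

text \<open>The total derivative. Coefficients are differentiated too, since parameters need not be
  constants of the derivation. At jets it computes the derivation of the value
  (\<open>der_dev\<close>); at other sequences it is merely formal.\<close>

primrec tdiff :: "('u, 'r, 'c) struct \<Rightarrow> ('p, 'u) dpol \<Rightarrow> ('p, 'u) dpol" where
  "tdiff K (Cst c) = Cst (\<lambda>p. der K (c p))"
| "tdiff K (Jv i) = Jv (Suc i)"
| "tdiff K (Plus f g) = Plus (tdiff K f) (tdiff K g)"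
| "tdiff K (Times f g) = Plus (Times (tdiff K f) g) (Times f (tdiff K g))"

primrec Powr :: "('u, 'r, 'c) struct \<Rightarrow> ('p, 'u) dpol \<Rightarrow> nat \<Rightarrow> ('p, 'u) dpol" where
  "Powr K f 0 = Cst (\<lambda>_. \<one>\<^bsub>K\<^esub>)"
| "Powr K f (Suc n) = Times (Powr K f n) f"

inductive_set dpols :: "('u, 'r, 'c) struct \<Rightarrow> 'p set \<Rightarrow> nat \<Rightarrow> ('p, 'u) dpol set"
  for K P j where
  Cst: "c \<in> P \<rightarrow> carrier K \<Longrightarrow> Cst c \<in> dpols K P j"
| Jv: "i < j \<Longrightarrow> Jv i \<in> dpols K P j"
| Plus: "f \<in> dpols K P j \<Longrightarrow> g \<in> dpols K P j \<Longrightarrow> Plus f g \<in> dpols K P j"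
| Times: "f \<in> dpols K P j \<Longrightarrow> g \<in> dpols K P j \<Longrightarrow> Times f g \<in> dpols K P j"

definition dseq :: "('u, 'r, 'c) struct \<Rightarrow> 'u \<Rightarrow> nat \<Rightarrow> 'u" where
  "dseq K y i = (der K ^^ i) y"

lemma dpols_mono: "f \<in> dpols K P j \<Longrightarrow> j \<le> k \<Longrightarrow> f \<in> dpols K P k"
  by (induction rule: dpols.induct) (auto intro: dpols.intros)

lemma dev_cong:
  "f \<in> dpols K P j \<Longrightarrow> (\<And>i. i < j \<Longrightarrow> a i = b i) \<Longrightarrow> dev K p a f = dev K p b f"
  by (induction rule: dpols.induct) auto

locale diff_field = field K for K :: "('u, 'r, 'c) struct" (structure) +
  fixes P :: "'p set"
  assumes char_zero: "0 < (n::nat) \<Longrightarrow> [n] \<cdot> \<one> \<noteq> \<zero>"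
    and derivation: "is_derivation K"
begin

abbreviation "ev \<equiv> dev K"
abbreviation "Pol \<equiv> dpols K P"
abbreviation "jets \<equiv> dseq K"

lemma der_closed [simp, intro]: "x \<in> carrier K \<Longrightarrow> der K x \<in> carrier K"
  using derivation by (auto simp: is_derivation_def)

lemma der_add: "x \<in> carrier K \<Longrightarrow> y \<in> carrier K \<Longrightarrow> der K (x \<oplus> y) = der K x \<oplus> der K y"
  using derivation by (auto simp: is_derivation_def)

lemma der_mult:
  "x \<in> carrier K \<Longrightarrow> y \<in> carrier K \<Longrightarrow> der K (x \<otimes> y) = der K x \<otimes> y \<oplus> x \<otimes> der K y"
  using derivation by (auto simp: is_derivation_def)

lemma der_zero [simp]: "der K \<zero> = \<zero>"
  using der_add[of \<zero> \<zero>] by (metis der_closed local.add.r_cancel_one' r_zero zero_closed)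

lemma dseq_0 [simp]: "jets y 0 = y" and dseq_Suc: "jets y (Suc i) = der K (jets y i)"
  by (simp_all add: dseq_def)

lemma dseq_closed [simp]: "y \<in> carrier K \<Longrightarrow> jets y i \<in> carrier K"
  by (induction i) (auto simp: dseq_Suc)

lemma range_dseq [simp]: "y \<in> carrier K \<Longrightarrow> range (jets y) \<subseteq> carrier K"
  by auto

lemma range_in_carrier [simp]: "range a \<subseteq> carrier K \<Longrightarrow> a i \<in> carrier K"
  by auto

lemma dev_closed_le:
  "f \<in> Pol j \<Longrightarrow> p \<in> P \<Longrightarrow> (\<And>i. i < j \<Longrightarrow> a i \<in> carrier K) \<Longrightarrow> ev p a f \<in> carrier K"
  by (induction rule: dpols.induct) auto

lemma dev_closed [simp]:
  "f \<in> Pol j \<Longrightarrow> p \<in> P \<Longrightarrow> range a \<subseteq> carrier K \<Longrightarrow> ev p a f \<in> carrier K"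
  by (erule dev_closed_le) auto

lemma pdiff_Pol [simp]: "f \<in> Pol j \<Longrightarrow> pdiff K i f \<in> Pol j"
  by (induction rule: dpols.induct) (auto intro!: dpols.intros)

lemma tdiff_Pol: "f \<in> Pol j \<Longrightarrow> tdiff K f \<in> Pol (Suc j)"
proof (induction rule: dpols.induct)
  case (Times f g) then show ?case
    by (auto intro!: dpols.intros intro: dpols_mono[of _ K P j "Suc j"])
qed (auto intro!: dpols.intros)

lemma Powr_Pol: "f \<in> Pol j \<Longrightarrow> Powr K f n \<in> Pol j"
  by (induction n) (auto intro!: dpols.intros)

lemma dev_Powr:
  "f \<in> Pol j \<Longrightarrow> p \<in> P \<Longrightarrow> range a \<subseteq> carrier K \<Longrightarrow> ev p a (Powr K f n) = ev p a f [^] n"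
  by (induction n) (auto simp: m_comm)

lemma pdiff_out:
  "f \<in> Pol j \<Longrightarrow> j \<le> i \<Longrightarrow> p \<in> P \<Longrightarrow> range a \<subseteq> carrier K \<Longrightarrow> ev p a (pdiff K i f) = \<zero>"
proof (induction rule: dpols.induct)
  case (Times f g) then show ?case by (simp add: dev_closed[OF Times.hyps(1)] dev_closed[OF Times.hyps(2)])
qed auto

lemma der_dev:
  "f \<in> Pol j \<Longrightarrow> p \<in> P \<Longrightarrow> y \<in> carrier K \<Longrightarrow>
    der K (ev p (jets y) f) = ev p (jets y) (tdiff K f)"
proof (induction rule: dpols.induct)
  case (Plus f g) then show ?case
    by (simp add: der_add dev_closed[OF Plus.hyps(1)] dev_closed[OF Plus.hyps(2)])
next
  case (Times f g) then show ?case
    by (simp add: der_mult dev_closed[OF Times.hyps(1)] dev_closed[OF Times.hyps(2)])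
qed (auto simp: dseq_Suc)

text \<open>By the chain rule the derivative of order \<open>Suc j\<close> can only arise from
  \<open>Jv j\<close>, and its factor is the separant. Along \<open>f = 0\<close> the next
  derivative can therefore be solved for.\<close>

lemma tdiff_linear_in_top:
  assumes "f \<in> Pol (Suc j)"
  obtains h where "h \<in> Pol (Suc j)"
    "\<And>p a. p \<in> P \<Longrightarrow> range a \<subseteq> carrier K \<Longrightarrow>
       ev p a (tdiff K f) = ev p a (pdiff K j f) \<otimes> a (Suc j) \<oplus> ev p a h"
proof -
  have "\<exists>h\<in>Pol (Suc j). \<forall>p\<in>P. \<forall>a. range a \<subseteq> carrier K \<longrightarrow>
       ev p a (tdiff K f) = ev p a (pdiff K j f) \<otimes> a (Suc j) \<oplus> ev p a h"
    using assms
  proof (induction rule: dpols.induct)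
    case (Cst c)
    then show ?case
      by (intro bexI[of _ "Cst (\<lambda>p. der K (c p))"]) (auto intro!: dpols.intros simp: Pi_iff)
  next
    case (Jv i)
    show ?case
    proof (cases "i = j")
      case True
      then show ?thesis
        by (intro bexI[of _ "Cst (\<lambda>p. \<zero>)"]) (auto intro!: dpols.intros)
    next
      case False
      with Jv show ?thesis
        by (intro bexI[of _ "Jv (Suc i)"]) (auto intro!: dpols.intros)
    qed
  next
    case (Plus f g)
    then obtain h k where hk: "h \<in> Pol (Suc j)" "k \<in> Pol (Suc j)"
       "\<forall>p\<in>P. \<forall>a. range a \<subseteq> carrier K \<longrightarrow>
         ev p a (tdiff K f) = ev p a (pdiff K j f) \<otimes> a (Suc j) \<oplus> ev p a h"
       "\<forall>p\<in>P. \<forall>a. range a \<subseteq> carrier K \<longrightarrow>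
         ev p a (tdiff K g) = ev p a (pdiff K j g) \<otimes> a (Suc j) \<oplus> ev p a k"
      by auto
    show ?case
    proof (intro bexI[of _ "Plus h k"] ballI allI impI)
      fix p and a :: "nat \<Rightarrow> 'u" assume pa: "p \<in> P" "range a \<subseteq> carrier K"
      have "ev p a x \<in> carrier K" if "x \<in> {f, g, h, k, pdiff K j f, pdiff K j g}" for x
        using that pa hk(1,2) Plus.hyps by (auto intro!: dev_closed[of _ "Suc j"])
      then show "ev p a (tdiff K (Plus f g)) =
          ev p a (pdiff K j (Plus f g)) \<otimes> a (Suc j) \<oplus> ev p a (Plus h k)"
        using hk(3,4) pa by (simp add: l_distr a_ac)
    qed (use hk in \<open>auto intro: dpols.intros\<close>)
  next
    case (Times f g)
    then obtain h k where hk: "h \<in> Pol (Suc j)" "k \<in> Pol (Suc j)"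
       "\<forall>p\<in>P. \<forall>a. range a \<subseteq> carrier K \<longrightarrow>
         ev p a (tdiff K f) = ev p a (pdiff K j f) \<otimes> a (Suc j) \<oplus> ev p a h"
       "\<forall>p\<in>P. \<forall>a. range a \<subseteq> carrier K \<longrightarrow>
         ev p a (tdiff K g) = ev p a (pdiff K j g) \<otimes> a (Suc j) \<oplus> ev p a k"
      by auto
    show ?case
    proof (intro bexI[of _ "Plus (Times h g) (Times f k)"] ballI allI impI)
      fix p and a :: "nat \<Rightarrow> 'u" assume pa: "p \<in> P" "range a \<subseteq> carrier K"
      have "ev p a x \<in> carrier K" if "x \<in> {f, g, h, k, pdiff K j f, pdiff K j g}" for x
        using that pa hk(1,2) Times.hyps by (auto intro!: dev_closed[of _ "Suc j"])
      then show "ev p a (tdiff K (Times f g)) =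
          ev p a (pdiff K j (Times f g)) \<otimes> a (Suc j) \<oplus> ev p a (Plus (Times h g) (Times f k))"
        using hk(3,4) pa by (simp add: l_distr r_distr a_ac m_ac)
    qed (use hk Times.hyps in \<open>auto intro: dpols.intros\<close>)
  qed
  then show thesis using that by blast
qed

end

section \<open>Differential polynomials as polynomials in their highest derivative\<close>

text \<open>Leading coefficient first. It may vanish at some arguments, so the length of the list is
  only a formal degree plus one; in return it does not depend on the parameter.\<close>

primrec horner :: "('u, 'r, 'c) struct \<Rightarrow> nat \<Rightarrow> ('p, 'u) dpol list \<Rightarrow> ('p, 'u) dpol" where
  "horner K j [] = Cst (\<lambda>_. \<zero>\<^bsub>K\<^esub>)"
| "horner K j (c # cs) = Plus (Times c (Powr K (Jv j) (length cs))) (horner K j cs)"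

definition nscale :: "('u, 'r, 'c) struct \<Rightarrow> nat \<Rightarrow> ('p, 'u) dpol \<Rightarrow> ('p, 'u) dpol" where
  "nscale K n f = Times (Cst (\<lambda>_. [n] \<cdot>\<^bsub>K\<^esub> \<one>\<^bsub>K\<^esub>)) f"

text \<open>Coefficients of \<open>n f - x f'\<close>, where \<open>x\<close> is
  \<open>Jv j\<close>: the term of degree \<open>d\<close> is scaled by \<open>n - d\<close>, so a
  term of degree \<open>n\<close> disappears.\<close>

primrec euler_coeffs :: "('u, 'r, 'c) struct \<Rightarrow> nat \<Rightarrow> ('p, 'u) dpol list \<Rightarrow> ('p, 'u) dpol list" where
  "euler_coeffs K n [] = []"
| "euler_coeffs K n (c # cs) = nscale K (n - length cs) c # euler_coeffs K n cs"

primrec pdiff_coeffs :: "('u, 'r, 'c) struct \<Rightarrow> ('p, 'u) dpol list \<Rightarrow> ('p, 'u) dpol list" where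
  "pdiff_coeffs K [] = []"
| "pdiff_coeffs K (c # cs) =
     (if cs = [] then [] else nscale K (length cs) c # pdiff_coeffs K cs)"

text \<open>For \<open>f = c x^m + ...\<close> and \<open>g = d x^n + ...\<close> with
  \<open>m \<le> n\<close> these are the coefficients of \<open>c g - d x^(n-m) f\<close> once the
  terms in \<open>x^n\<close> have cancelled; the appended zeros are the factor
  \<open>x^(n-m)\<close>.\<close>

definition reduct_coeffs :: "('u, 'r, 'c) struct \<Rightarrow> ('p, 'u) dpol \<Rightarrow> ('p, 'u) dpol list \<Rightarrow>
    ('p, 'u) dpol \<Rightarrow> ('p, 'u) dpol list \<Rightarrow> ('p, 'u) dpol list" where
  "reduct_coeffs K c cs d ds =
     map2 (\<lambda>x y. Plus (Times c y) (Times (Cst (\<lambda>_. \<ominus>\<^bsub>K\<^esub> \<one>\<^bsub>K\<^esub>)) (Times d x)))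
       (cs @ replicate (length ds - length cs) (Cst (\<lambda>_. \<zero>\<^bsub>K\<^esub>))) ds"

lemma length_euler_coeffs [simp]: "length (euler_coeffs K n cs) = length cs"
  by (induction cs) auto

lemma length_pdiff_coeffs [simp]: "length (pdiff_coeffs K cs) = length cs - 1"
  by (induction cs) auto

lemma length_reduct_coeffs [simp]:
  "length cs \<le> length ds \<Longrightarrow> length (reduct_coeffs K c cs d ds) = length ds"
  by (simp add: reduct_coeffs_def)

lemma set_map2_subset:
  "(\<And>x y. x \<in> set xs \<Longrightarrow> y \<in> set ys \<Longrightarrow> f x y \<in> A) \<Longrightarrow> set (map2 f xs ys) \<subseteq> A"
  by (auto dest: set_zip_leftD set_zip_rightD)

context diff_field
begin

abbreviation "hr \<equiv> horner K"

lemma Cst_Pol [simp]: "(\<And>p. p \<in> P \<Longrightarrow> c p \<in> carrier K) \<Longrightarrow> Cst c \<in> Pol j"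
  by (rule dpols.Cst) auto

lemma Plus_Pol [simp]: "f \<in> Pol j \<Longrightarrow> g \<in> Pol j \<Longrightarrow> Plus f g \<in> Pol j"
  and Times_Pol [simp]: "f \<in> Pol j \<Longrightarrow> g \<in> Pol j \<Longrightarrow> Times f g \<in> Pol j"
  and Jv_Pol [simp]: "i < j \<Longrightarrow> Jv i \<in> Pol j"
  by (auto intro: dpols.intros)

lemma nscale_Pol [simp]: "f \<in> Pol j \<Longrightarrow> nscale K n f \<in> Pol j"
  by (simp add: nscale_def)

lemma dev_nscale:
  "f \<in> Pol j \<Longrightarrow> p \<in> P \<Longrightarrow> range a \<subseteq> carrier K \<Longrightarrow> ev p a (nscale K n f) = [n] \<cdot> ev p a f"
  by (simp add: nscale_def dev_closed[of f j] add_pow_ldistr)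

lemma horner_Pol: "set cs \<subseteq> Pol j \<Longrightarrow> hr j cs \<in> Pol (Suc j)"
  by (induction cs) (auto intro!: dpols.Plus dpols.Times intro: Powr_Pol dpols_mono[of _ K P j "Suc j"])

lemma dev_horner_Cons:
  assumes "p \<in> P" "range a \<subseteq> carrier K"
  shows "ev p a (hr j (c # cs)) = ev p a c \<otimes> a j [^] length cs \<oplus> ev p a (hr j cs)"
  using assms dev_Powr[of "Jv j" "Suc j" p a] by simp

lemma dev_horner_closed [simp]:
  "set cs \<subseteq> Pol j \<Longrightarrow> p \<in> P \<Longrightarrow> range a \<subseteq> carrier K \<Longrightarrow> ev p a (hr j cs) \<in> carrier K"
  by (rule dev_closed[OF horner_Pol])

section \<open>The formal derivative and Euler's relation\<close>

lemma dev_pdiff_Powr: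
  assumes "p \<in> P" "range a \<subseteq> carrier K"
  shows "ev p a (pdiff K j (Powr K (Jv j) (Suc n))) = [Suc n] \<cdot> (a j [^] n)"
proof (induction n)
  case 0 then show ?case using assms by simp
next
  case (Suc n)
  have a: "a j \<in> carrier K" using assms by simp
  have "ev p a (pdiff K j (Powr K (Jv j) (Suc (Suc n)))) =
      ([Suc n] \<cdot> (a j [^] n)) \<otimes> a j \<oplus> a j [^] Suc n"
    using Suc assms dev_Powr[of "Jv j" "Suc j" p a "Suc n"] by simp
  also have "\<dots> = [Suc n] \<cdot> (a j [^] Suc n) \<oplus> a j [^] Suc n"
    using a by (simp add: add_pow_ldistr l_distr)
  finally show ?case using a by simp
qed

lemma dev_pdiff_horner_Cons:
  assumes "c \<in> Pol j" "set cs \<subseteq> Pol j" "p \<in> P" "range a \<subseteq> carrier K"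
  shows "ev p a (pdiff K j (hr j (c # cs))) =
     ev p a c \<otimes> ev p a (pdiff K j (Powr K (Jv j) (length cs))) \<oplus> ev p a (pdiff K j (hr j cs))"
proof -
  have "ev p a (pdiff K j (Powr K (Jv j) (length cs))) \<in> carrier K"
    using assms by (intro dev_closed[of _ "Suc j"] pdiff_Pol Powr_Pol) auto
  moreover have "ev p a c \<in> carrier K" using assms by (intro dev_closed)
  ultimately show ?thesis using assms pdiff_out[of c j j p a] dev_Powr[of "Jv j" "Suc j" p a] by simp
qed

lemma pdiff_horner_closed [simp]:
  "set cs \<subseteq> Pol j \<Longrightarrow> p \<in> P \<Longrightarrow> range a \<subseteq> carrier K \<Longrightarrow> ev p a (pdiff K j (hr j cs)) \<in> carrier K"
  by (rule dev_closed[OF pdiff_Pol[OF horner_Pol]])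

lemma pdiff_coeffs_Pol [simp]: "set cs \<subseteq> Pol j \<Longrightarrow> set (pdiff_coeffs K cs) \<subseteq> Pol j"
  by (induction cs) auto

lemma euler_coeffs_Pol [simp]: "set cs \<subseteq> Pol j \<Longrightarrow> set (euler_coeffs K n cs) \<subseteq> Pol j"
  by (induction cs) auto

lemma dev_pdiff_horner:
  assumes "set cs \<subseteq> Pol j" "p \<in> P" "range a \<subseteq> carrier K"
  shows "ev p a (pdiff K j (hr j cs)) = ev p a (hr j (pdiff_coeffs K cs))"
  using assms(1)
proof (induction cs)
  case (Cons c cs)
  note IH = Cons.IH
  have c: "ev p a c \<in> carrier K" using Cons.prems assms by (intro dev_closed[of c j]) auto
  show ?case
  proof (cases cs)
    case Nil then show ?thesis
      using Cons.prems c assms dev_pdiff_horner_Cons[of c j "[]" p a] by simp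
  next
    case (Cons d ds)
    have "ev p a c \<otimes> ([length cs] \<cdot> (a j [^] length ds)) = ([length cs] \<cdot> ev p a c) \<otimes> a j [^] length ds"
      using c assms by (simp add: add_pow_ldistr add_pow_rdistr)
    then show ?thesis
      using Cons.prems IH assms(2,3) Cons dev_pdiff_horner_Cons[of c j cs p a]
        dev_pdiff_Powr[of p a j "length ds"]
        dev_horner_Cons[of p a j "nscale K (length cs) c" "pdiff_coeffs K cs"]
        dev_nscale[of c j p a "length cs"]
      by (simp del: horner.simps pdiff.simps Powr.simps)
  qed
qed simp

text \<open>Termwise, \<open>x\<close> times the derivative of \<open>c x^m\<close> is
  \<open>m c x^m\<close>, which completes \<open>(n - m) c x^m\<close> to \<open>n c x^m\<close>.
  The bound on the length makes the subtraction on naturals exact.\<close>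

lemma dev_euler:
  assumes "set cs \<subseteq> Pol j" "p \<in> P" "range a \<subseteq> carrier K" "length cs \<le> Suc n"
  shows "ev p a (hr j (euler_coeffs K n cs)) \<oplus> a j \<otimes> ev p a (pdiff K j (hr j cs)) =
    [n] \<cdot> ev p a (hr j cs)"
  using assms(1,4)
proof (induction cs)
  case (Cons c cs)
  let ?m = "length cs" and ?x = "a j" and ?h = "ev p a (hr j cs)" and ?c = "ev p a c"
  let ?E = "ev p a (hr j (euler_coeffs K n cs))" and ?d = "ev p a (pdiff K j (hr j cs))"
  let ?q = "ev p a (pdiff K j (Powr K (Jv j) ?m))"
  have cl: "?c \<in> carrier K" "?x \<in> carrier K" "?h \<in> carrier K" "?E \<in> carrier K" "?d \<in> carrier K"
    "?q \<in> carrier K"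
    using Cons.prems assms(2,3)
    by (auto intro!: dev_closed[of c j] dev_closed[OF pdiff_Pol[OF Powr_Pol[of _ "Suc j"]]])
  have q: "?x \<otimes> ?q = [?m] \<cdot> (?x [^] ?m)"
  proof (cases ?m)
    case (Suc k) then show ?thesis
      using dev_pdiff_Powr[OF assms(2,3), of j k] cl
      by (simp add: add_pow_rdistr r_distr m_comm del: Powr.simps)
  qed (use cl in simp)
  have IH: "?E \<oplus> ?x \<otimes> ?d = [n] \<cdot> ?h" using Cons by simp
  have "ev p a (hr j (euler_coeffs K n (c # cs))) = ([(n - ?m)] \<cdot> ?c) \<otimes> ?x [^] ?m \<oplus> ?E"
    using Cons.prems assms(2,3) dev_horner_Cons[of p a j "nscale K (n - ?m) c" "euler_coeffs K n cs"]
      dev_nscale[of c j p a "n - ?m"] by (simp del: horner.simps)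
  moreover have "ev p a (pdiff K j (hr j (c # cs))) = ?c \<otimes> ?q \<oplus> ?d"
    using Cons.prems assms(2,3) dev_pdiff_horner_Cons[of c j cs p a] by (simp del: horner.simps)
  ultimately have "ev p a (hr j (euler_coeffs K n (c # cs))) \<oplus> ?x \<otimes> ev p a (pdiff K j (hr j (c # cs)))
     = (([(n - ?m)] \<cdot> ?c) \<otimes> ?x [^] ?m \<oplus> ?E) \<oplus> ?x \<otimes> (?c \<otimes> ?q \<oplus> ?d)" by simp
  also have "\<dots> = (([(n - ?m)] \<cdot> ?c) \<otimes> ?x [^] ?m \<oplus> ?c \<otimes> (?x \<otimes> ?q)) \<oplus> (?E \<oplus> ?x \<otimes> ?d)"
    using cl by (simp add: r_distr a_ac m_ac)
  also have "([(n - ?m)] \<cdot> ?c) \<otimes> ?x [^] ?m \<oplus> ?c \<otimes> (?x \<otimes> ?q) =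
      [(n - ?m)] \<cdot> (?c \<otimes> ?x [^] ?m) \<oplus> [?m] \<cdot> (?c \<otimes> ?x [^] ?m)"
    unfolding q using cl by (simp add: add_pow_rdistr add_pow_ldistr)
  also have "\<dots> = [n] \<cdot> (?c \<otimes> ?x [^] ?m)"
    using cl Cons.prems by (subst add.nat_pow_mult) auto
  also note IH
  also have "[n] \<cdot> (?c \<otimes> ?x [^] ?m) \<oplus> [n] \<cdot> ?h = [n] \<cdot> ev p a (hr j (c # cs))"
    using cl dev_horner_Cons[OF assms(2,3), of j c cs]
    by (simp add: add.nat_pow_distrib del: horner.simps)
  finally show ?case .
qed (use assms in simp)

section \<open>Shifts and pseudo-remainders of coefficient lists\<close>

lemma dev_horner_shift:
  assumes "set cs \<subseteq> Pol j" "p \<in> P" "range a \<subseteq> carrier K"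
  shows "ev p a (hr j (cs @ replicate d (Cst (\<lambda>_. \<zero>)))) = a j [^] d \<otimes> ev p a (hr j cs)"
  using assms(1)
proof (induction cs)
  case Nil
  have "ev p a (hr j (replicate d (Cst (\<lambda>_. \<zero>)))) = \<zero>"
    using assms by (induction d) (auto simp: dev_horner_Cons simp del: horner.simps, simp)
  then show ?case using assms by simp
next
  case (Cons c cs)
  have "ev p a c \<in> carrier K" using Cons.prems assms by (intro dev_closed[of c j]) auto
  moreover have "a j [^] (length cs + d) = a j [^] d \<otimes> a j [^] length cs"
    using assms by (simp add: nat_pow_mult add.commute)
  ultimately show ?case
    using Cons assms(2,3) by (simp add: dev_horner_Cons r_distr m_ac del: horner.simps)
qed

lemma dev_horner_map2:
  assumes "set cs \<subseteq> Pol j" "set ds \<subseteq> Pol j" "p \<in> P" "range a \<subseteq> carrier K"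
    and "length cs = length ds" "c \<in> Pol j" "d \<in> Pol j"
  shows "ev p a (hr j (map2 (\<lambda>x y. Plus (Times c x) (Times d y)) cs ds)) =
    ev p a c \<otimes> ev p a (hr j cs) \<oplus> ev p a d \<otimes> ev p a (hr j ds)"
  using assms(5,1,2)
proof (induction cs ds rule: list_induct2)
  case Nil then show ?case using assms dev_closed[of c j] dev_closed[of d j] by simp
next
  case (Cons x xs y ys)
  have "ev p a x \<in> carrier K" "ev p a y \<in> carrier K" "ev p a c \<in> carrier K" "ev p a d \<in> carrier K"
    using Cons.prems assms by (auto intro!: dev_closed[of _ j])
  then show ?case
    using Cons assms(3,4)
    by (simp add: dev_horner_Cons l_distr r_distr m_ac a_ac del: horner.simps)
qed

lemma reduct_coeffs_Pol:
  "c \<in> Pol j \<Longrightarrow> d \<in> Pol j \<Longrightarrow> set cs \<subseteq> Pol j \<Longrightarrow> set ds \<subseteq> Pol j \<Longrightarrow>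
    set (reduct_coeffs K c cs d ds) \<subseteq> Pol j"
  unfolding reduct_coeffs_def by (rule set_map2_subset) (auto intro!: dpols.Plus dpols.Times)

text \<open>The list evaluates to \<open>c g - d x^(n-m) f\<close>, and \<open>f\<close> vanishes at
  the point. Hence, where also \<open>c\<close> is nonzero, the shorter list may replace
  \<open>d # ds\<close>.\<close>

lemma dev_reduct:
  assumes "c \<in> Pol j" "d \<in> Pol j" "set cs \<subseteq> Pol j" "set ds \<subseteq> Pol j" "p \<in> P" "range a \<subseteq> carrier K"
    and "length cs \<le> length ds" "ev p a (hr j (c # cs)) = \<zero>"
  shows "ev p a (hr j (reduct_coeffs K c cs d ds)) = ev p a c \<otimes> ev p a (hr j (d # ds))"
proof -
  let ?z = "replicate (length ds - length cs) (Cst (\<lambda>_. \<zero>))" and ?x = "a j"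
  let ?h = "ev p a (hr j cs)" and ?k = "ev p a (hr j ds)" and ?c = "ev p a c" and ?d = "ev p a d"
  let ?e = "length ds - length cs"
  have cl: "?x \<in> carrier K" "?h \<in> carrier K" "?k \<in> carrier K" "?c \<in> carrier K" "?d \<in> carrier K"
    using assms by (auto intro: dev_closed[of _ j])
  have gen: "ev p a (hr j (map2 (\<lambda>x y. Plus (Times c y) (Times (Cst (\<lambda>_. \<ominus> \<one>)) (Times d x))) as bs)) =
     ?c \<otimes> ev p a (hr j bs) \<oplus> (\<ominus> \<one>) \<otimes> (?d \<otimes> ev p a (hr j as))"
    if "set as \<subseteq> Pol j" "set bs \<subseteq> Pol j" "length as = length bs" for as bs
    using that(3,1,2)
  proof (induction as bs rule: list_induct2)
    case Nil then show ?case using cl by simp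
  next
    case (Cons x xs y ys)
    have "ev p a x \<in> carrier K" "ev p a y \<in> carrier K"
      using Cons.prems assms by (auto intro!: dev_closed[of _ j])
    then show ?case
      using Cons assms(5,6) cl
      by (simp add: dev_horner_Cons l_distr r_distr m_ac a_ac l_minus r_minus minus_add del: horner.simps)
  qed
  have 1: "ev p a (hr j (reduct_coeffs K c cs d ds)) = ?c \<otimes> ?k \<oplus> (\<ominus> \<one>) \<otimes> (?d \<otimes> (?x [^] ?e \<otimes> ?h))"
    unfolding reduct_coeffs_def using assms
    by (subst gen) (auto simp: dev_horner_shift)
  have "?h = \<ominus> (?c \<otimes> ?x [^] length cs)"
    using assms(5,6,8) cl dev_horner_Cons[of p a j c cs]
    by (metis a_comm add.inv_closed minus_equality m_closed nat_pow_closed)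
  then have "(\<ominus> \<one>) \<otimes> (?d \<otimes> (?x [^] ?e \<otimes> ?h)) = ?d \<otimes> (?x [^] ?e \<otimes> (?c \<otimes> ?x [^] length cs))"
    using cl by (simp add: l_minus r_minus)
  also have "\<dots> = ?c \<otimes> (?d \<otimes> (?x [^] ?e \<otimes> ?x [^] length cs))"
    using cl by (simp add: m_ac)
  also have "?x [^] ?e \<otimes> ?x [^] length cs = ?x [^] length ds"
    using cl assms(7) by (simp add: nat_pow_mult)
  finally show ?thesis
    unfolding 1 using cl assms(5,6) by (simp add: dev_horner_Cons r_distr a_ac del: horner.simps)
qed

section \<open>Every differential polynomial as a polynomial in its highest derivative\<close>

lemma dev_horner_pad:
  assumes "p \<in> P" "range a \<subseteq> carrier K" "set cs \<subseteq> Pol j"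
  shows "ev p a (hr j (replicate n (Cst (\<lambda>_. \<zero>)) @ cs)) = ev p a (hr j cs)"
  using assms by (induction n) (simp_all add: dev_horner_Cons del: horner.simps)

lemma horner_plus:
  assumes "set cs \<subseteq> Pol j" "set ds \<subseteq> Pol j"
  shows "\<exists>es. set es \<subseteq> Pol j \<and> (\<forall>p\<in>P. \<forall>a. range a \<subseteq> carrier K \<longrightarrow>
     ev p a (hr j es) = ev p a (hr j cs) \<oplus> ev p a (hr j ds))"
proof -
  let ?one = "Cst (\<lambda>_. \<one>)" and ?z = "\<lambda>n::nat. replicate n (Cst (\<lambda>_. \<zero>))"
  \<comment> \<open>Zeros at the leading end leave the values unchanged and give both lists the same
    length.\<close>
  let ?cs = "?z (length ds - length cs) @ cs" and ?ds = "?z (length cs - length ds) @ ds"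
  let ?es = "map2 (\<lambda>x y. Plus (Times ?one x) (Times ?one y)) ?cs ?ds"
  have s: "set ?cs \<subseteq> Pol j" "set ?ds \<subseteq> Pol j" "length ?cs = length ?ds" using assms by auto
  have "set ?es \<subseteq> Pol j"
    by (rule set_map2_subset) (use s in \<open>auto intro!: dpols.Plus dpols.Times\<close>)
  moreover have "ev p a (hr j ?es) = ev p a (hr j cs) \<oplus> ev p a (hr j ds)"
    if "p \<in> P" "range a \<subseteq> carrier K" for p a
    using dev_horner_map2[OF s(1,2) that s(3), of ?one ?one] that assms
    by (simp add: dev_horner_pad)
  ultimately show ?thesis by blast
qed

lemma horner_scale:
  fixes n :: nat
  assumes "set cs \<subseteq> Pol j" "c \<in> Pol j"
  shows "\<exists>es. set es \<subseteq> Pol j \<and> (\<forall>p\<in>P. \<forall>a. range a \<subseteq> carrier K \<longrightarrow>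
     ev p a (hr j es) = ev p a c \<otimes> a j [^] n \<otimes> ev p a (hr j cs))"
proof -
  \<comment> \<open>Zeros at the low end multiply by a power of \<open>Jv j\<close>.\<close>
  let ?ds = "cs @ replicate n (Cst (\<lambda>_. \<zero>))"
  let ?es = "map (Times c) ?ds"
  have ds: "set ?ds \<subseteq> Pol j" using assms by auto
  have "ev p a (hr j ?es) = ev p a c \<otimes> a j [^] n \<otimes> ev p a (hr j cs)"
    if pa: "p \<in> P" "range a \<subseteq> carrier K" for p a
  proof -
    have c: "ev p a c \<in> carrier K" using assms pa by (intro dev_closed)
    have "ev p a (hr j (map (Times c) es)) = ev p a c \<otimes> ev p a (hr j es)" if "set es \<subseteq> Pol j" for es
      using that
    proof (induction es)
      case (Cons e es)
      moreover from Cons.prems pa have "ev p a e \<in> carrier K" by (intro dev_closed[of e j]) auto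
      ultimately show ?case using pa c by (simp add: dev_horner_Cons r_distr m_ac del: horner.simps)
    qed (use c in simp)
    then show ?thesis using dev_horner_shift[OF assms(1) pa] ds c assms pa by (simp add: m_assoc del: map_append)
  qed
  moreover have "set ?es \<subseteq> Pol j" using ds assms by auto
  ultimately show ?thesis by blast
qed

lemma horner_times:
  assumes "set cs \<subseteq> Pol j" "set ds \<subseteq> Pol j"
  shows "\<exists>es. set es \<subseteq> Pol j \<and> (\<forall>p\<in>P. \<forall>a. range a \<subseteq> carrier K \<longrightarrow>
     ev p a (hr j es) = ev p a (hr j cs) \<otimes> ev p a (hr j ds))"
  using assms(1)
proof (induction cs)
  case Nil then show ?case using assms by (intro exI[of _ "[]"]) auto
next
  case (Cons c cs)
  then obtain es where es: "set es \<subseteq> Pol j" "\<forall>p\<in>P. \<forall>a. range a \<subseteq> carrier K \<longrightarrow>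
     ev p a (hr j es) = ev p a (hr j cs) \<otimes> ev p a (hr j ds)" by auto
  obtain fs where fs: "set fs \<subseteq> Pol j" "\<forall>p\<in>P. \<forall>a. range a \<subseteq> carrier K \<longrightarrow>
     ev p a (hr j fs) = ev p a c \<otimes> a j [^] length cs \<otimes> ev p a (hr j ds)"
    using horner_scale[OF assms(2), of c "length cs"] Cons.prems by auto
  obtain gs where gs: "set gs \<subseteq> Pol j" "\<forall>p\<in>P. \<forall>a. range a \<subseteq> carrier K \<longrightarrow>
     ev p a (hr j gs) = ev p a (hr j fs) \<oplus> ev p a (hr j es)"
    using horner_plus[OF fs(1) es(1)] by blast
  have "ev p a (hr j gs) = ev p a (hr j (c # cs)) \<otimes> ev p a (hr j ds)"
    if pa: "p \<in> P" "range a \<subseteq> carrier K" for p a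
  proof -
    have "ev p a c \<in> carrier K" using Cons.prems pa by (intro dev_closed[of c j]) auto
    then show ?thesis
      using gs(2) fs(2) es(2) pa Cons.prems assms(2) by (simp add: dev_horner_Cons l_distr del: horner.simps)
  qed
  then show ?case using gs by blast
qed

text \<open>A single list serves all parameters and all sequences, so its length is a degree bound
  uniform in \<open>p\<close>.\<close>

lemma ex_horner:
  assumes "f \<in> Pol (Suc j)"
  shows "\<exists>es. set es \<subseteq> Pol j \<and> (\<forall>p\<in>P. \<forall>a. range a \<subseteq> carrier K \<longrightarrow> ev p a (hr j es) = ev p a f)"
  using assms
proof (induction rule: dpols.induct)
  case (Cst c)
  then show ?case by (intro exI[of _ "[Cst c]"]) (auto simp: Pi_iff)
next
  case (Jv i)
  show ?case
  proof (cases "i = j")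
    case True then show ?thesis
      by (intro exI[of _ "[Cst (\<lambda>_. \<one>), Cst (\<lambda>_. \<zero>)]"]) auto
  next
    case False with Jv show ?thesis by (intro exI[of _ "[Jv i]"]) auto
  qed
next
  case (Plus f g)
  then obtain cs ds where cd: "set cs \<subseteq> Pol j" "set ds \<subseteq> Pol j"
    "\<forall>p\<in>P. \<forall>a. range a \<subseteq> carrier K \<longrightarrow> ev p a (hr j cs) = ev p a f"
    "\<forall>p\<in>P. \<forall>a. range a \<subseteq> carrier K \<longrightarrow> ev p a (hr j ds) = ev p a g" by blast
  show ?case using horner_plus[OF cd(1,2)] cd(3,4) by simp
next
  case (Times f g)
  then obtain cs ds where cd: "set cs \<subseteq> Pol j" "set ds \<subseteq> Pol j"
    "\<forall>p\<in>P. \<forall>a. range a \<subseteq> carrier K \<longrightarrow> ev p a (hr j cs) = ev p a f"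
    "\<forall>p\<in>P. \<forall>a. range a \<subseteq> carrier K \<longrightarrow> ev p a (hr j ds) = ev p a g" by blast
  show ?case using horner_times[OF cd(1,2)] cd(3,4) by simp
qed

end

section \<open>Uniformly bounded conditions and elimination\<close>

text \<open>\<open>DL\<close> is the axiom scheme in a convenient form: the point is an infinite
  sequence, of which the coordinates up to \<open>n\<close> matter, and each of these has its own
  open set. \<open>diff_top_fieldI\<close> derives it from \<open>scheme_DL\<close>.\<close>

locale diff_top_field = diff_field K P for K :: "('u, 'r, 'c) struct" (structure) and P :: "'p set" +
  fixes \<tau> :: "'u topology"
  assumes field_top: "field_topology K \<tau>"
    and DL: "p \<in> P \<Longrightarrow> f \<in> dpols K P (Suc n) \<Longrightarrow> range a \<subseteq> carrier K \<Longrightarrow>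
      dev K p a f = \<zero> \<Longrightarrow> dev K p a (pdiff K n f) \<noteq> \<zero> \<Longrightarrow>
      (\<And>i. i \<le> n \<Longrightarrow> openin \<tau> (V i) \<and> a i \<in> V i) \<Longrightarrow>
      \<exists>z\<in>carrier K. dev K p (dseq K z) f = \<zero> \<and> dev K p (dseq K z) (pdiff K n f) \<noteq> \<zero> \<and>
         (\<forall>i\<le>n. dseq K z i \<in> V i)"
begin

abbreviation "\<Omega> \<equiv> product_topology (\<lambda>_::nat. \<tau>) UNIV"

section \<open>Continuity of evaluation on the space of sequences\<close>

lemma topspace_\<tau> [simp]: "topspace \<tau> = carrier K"
  using field_top by (simp add: field_topology_def)

lemma topspace_\<Omega> [simp]: "topspace \<Omega> = {a. range a \<subseteq> carrier K}"
  by (auto simp: PiE_UNIV_domain)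

lemma openin_punctured: "openin \<tau> (carrier K - {x})"
proof (cases "x \<in> carrier K")
  case True
  then have "closedin \<tau> {x}"
    using field_top by (simp add: field_topology_def closedin_Hausdorff_sing_eq)
  then show ?thesis by (metis closedin_def topspace_\<tau>)
next
  case False
  then show ?thesis by (metis Diff_empty Diff_insert0 openin_topspace topspace_\<tau>)
qed

lemma continuous_add_mult:
  assumes "continuous_map Z \<tau> f" "continuous_map Z \<tau> g"
  shows "continuous_map Z \<tau> (\<lambda>x. f x \<oplus> g x)" "continuous_map Z \<tau> (\<lambda>x. f x \<otimes> g x)"
proof -
  have fg: "continuous_map Z (prod_topology \<tau> \<tau>) (\<lambda>x. (f x, g x))"
    using assms by (simp add: continuous_map_pairwise o_def)
  show "continuous_map Z \<tau> (\<lambda>x. f x \<oplus> g x)"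
    using continuous_map_compose[OF fg, of \<tau> "\<lambda>(x, y). x \<oplus> y"] field_top
    by (simp add: field_topology_def o_def)
  show "continuous_map Z \<tau> (\<lambda>x. f x \<otimes> g x)"
    using continuous_map_compose[OF fg, of \<tau> "\<lambda>(x, y). x \<otimes> y"] field_top
    by (simp add: field_topology_def o_def)
qed

lemma continuous_inv:
  assumes "continuous_map Z \<tau> f" "\<And>x. x \<in> topspace Z \<Longrightarrow> f x \<noteq> \<zero>"
  shows "continuous_map Z \<tau> (\<lambda>x. inv (f x))"
proof -
  have "continuous_map Z (subtopology \<tau> (carrier K - {\<zero>})) f"
    using assms continuous_map_funspace[OF assms(1)] by (intro continuous_map_into_subtopology) auto
  from continuous_map_compose[OF this, of \<tau> "\<lambda>x. inv x"] show ?thesis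
    using field_top by (simp add: field_topology_def o_def)
qed

lemma continuous_dev:
  assumes "f \<in> Pol j" "p \<in> P"
  shows "continuous_map \<Omega> \<tau> (\<lambda>a. ev p a f)"
  using assms
proof (induction rule: dpols.induct)
  case (Jv i) then show ?case using continuous_map_product_projection[of i UNIV "\<lambda>_. \<tau>"] by simp
qed (auto intro: continuous_add_mult)

lemma openin_nonzero:
  assumes "f \<in> Pol j" "p \<in> P"
  shows "openin \<Omega> {a. range a \<subseteq> carrier K \<and> ev p a f \<noteq> \<zero>}"
proof -
  have "{a. range a \<subseteq> carrier K \<and> ev p a f \<noteq> \<zero>} =
      {a \<in> topspace \<Omega>. ev p a f \<in> carrier K - {\<zero>}}"
    using assms by auto
  then show ?thesis
    by (metis openin_continuous_map_preimage[OF continuous_dev[OF assms] openin_punctured])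
qed

text \<open>
  Quantifying over all open sets lets every inequation \<open>f \<noteq> 0\<close> be absorbed; using all derivatives
  at once avoids fixing an order for the open sets.
\<close>

definition unif_bounded :: "('p \<Rightarrow> 'u \<Rightarrow> bool) \<Rightarrow> bool" where
  "unif_bounded C \<longleftrightarrow> (\<exists>N. \<forall>p\<in>P. \<forall>O'. openin \<Omega> O' \<longrightarrow>
     infinite {y \<in> carrier K. jets y \<in> O' \<and> C p y} \<or>
     card {y \<in> carrier K. jets y \<in> O' \<and> C p y} \<le> N)"

text \<open>Elimination keeps producing new equations of lower order, such as vanishing leading
  coefficients. Allowing arbitrary further equations of order below \<open>j\<close> lets the
  statement absorb them.\<close>

definition good :: "nat \<Rightarrow> ('p \<Rightarrow> 'u \<Rightarrow> bool) \<Rightarrow> bool" where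
  "good j C \<longleftrightarrow> (\<forall>F. finite F \<and> F \<subseteq> Pol j \<longrightarrow>
     unif_bounded (\<lambda>p y. C p y \<and> (\<forall>f\<in>F. ev p (jets y) f = \<zero>)))"

section \<open>Closure properties of bounded conditions\<close>

lemma unif_bounded_open:
  assumes "unif_bounded C"
    and "\<And>p. p \<in> P \<Longrightarrow> \<exists>U. openin \<Omega> U \<and> (\<forall>y\<in>carrier K. C' p y \<longleftrightarrow> C p y \<and> jets y \<in> U)"
  shows "unif_bounded C'"
proof -
  obtain N where N: "\<And>p O'. p \<in> P \<Longrightarrow> openin \<Omega> O' \<Longrightarrow>
     infinite {y \<in> carrier K. jets y \<in> O' \<and> C p y} \<or>
     card {y \<in> carrier K. jets y \<in> O' \<and> C p y} \<le> N"
    using assms(1) by (auto simp: unif_bounded_def)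
  show ?thesis
    unfolding unif_bounded_def
  proof (intro exI ballI allI impI)
    fix p O' assume p: "p \<in> P" and O': "openin \<Omega> O'"
    obtain U where U: "openin \<Omega> U" "\<forall>y\<in>carrier K. C' p y \<longleftrightarrow> C p y \<and> jets y \<in> U"
      using assms(2)[OF p] by blast
    have "{y \<in> carrier K. jets y \<in> O' \<and> C' p y} = {y \<in> carrier K. jets y \<in> O' \<inter> U \<and> C p y}"
      using U(2) by auto
    then show "infinite {y \<in> carrier K. jets y \<in> O' \<and> C' p y} \<or>
       card {y \<in> carrier K. jets y \<in> O' \<and> C' p y} \<le> N"
      using N[OF p openin_Int[OF O' U(1)]] by simp
  qed
qed

lemma unif_bounded_cong:
  assumes "unif_bounded C" "\<And>p y. p \<in> P \<Longrightarrow> y \<in> carrier K \<Longrightarrow> C' p y \<longleftrightarrow> C p y"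
  shows "unif_bounded C'"
  by (rule unif_bounded_open[OF assms(1)]) (use assms(2) in \<open>auto intro!: exI[of _ "topspace \<Omega>"]\<close>)

lemma unif_bounded_disj:
  assumes "unif_bounded C" "unif_bounded C'"
  shows "unif_bounded (\<lambda>p y. C p y \<or> C' p y)"
proof -
  obtain N where N: "\<And>p O'. p \<in> P \<Longrightarrow> openin \<Omega> O' \<Longrightarrow>
     infinite {y \<in> carrier K. jets y \<in> O' \<and> C p y} \<or>
     card {y \<in> carrier K. jets y \<in> O' \<and> C p y} \<le> N"
    using assms(1) by (auto simp: unif_bounded_def)
  obtain N' where N': "\<And>p O'. p \<in> P \<Longrightarrow> openin \<Omega> O' \<Longrightarrow>
     infinite {y \<in> carrier K. jets y \<in> O' \<and> C' p y} \<or>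
     card {y \<in> carrier K. jets y \<in> O' \<and> C' p y} \<le> N'"
    using assms(2) by (auto simp: unif_bounded_def)
  have "infinite {y \<in> carrier K. jets y \<in> O' \<and> (C p y \<or> C' p y)} \<or>
        card {y \<in> carrier K. jets y \<in> O' \<and> (C p y \<or> C' p y)} \<le> N + N'"
    if "p \<in> P" "openin \<Omega> O'" for p O'
  proof -
    let ?A = "{y \<in> carrier K. jets y \<in> O' \<and> C p y}" and ?B = "{y \<in> carrier K. jets y \<in> O' \<and> C' p y}"
    have "{y \<in> carrier K. jets y \<in> O' \<and> (C p y \<or> C' p y)} = ?A \<union> ?B" by auto
    moreover have "card (?A \<union> ?B) \<le> card ?A + card ?B" by (rule card_Un_le)
    ultimately show ?thesis using N[OF that] N'[OF that] by (auto simp: infinite_Un)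
  qed
  then show ?thesis unfolding unif_bounded_def by blast
qed

lemma good_cong:
  assumes "good j C" "\<And>p y. p \<in> P \<Longrightarrow> y \<in> carrier K \<Longrightarrow> C' p y \<longleftrightarrow> C p y"
  shows "good j C'"
  unfolding good_def
proof (intro allI impI)
  fix F assume "finite F \<and> F \<subseteq> Pol j"
  then have "unif_bounded (\<lambda>p y. C p y \<and> (\<forall>f\<in>F. ev p (jets y) f = \<zero>))"
    using assms(1) by (auto simp: good_def)
  then show "unif_bounded (\<lambda>p y. C' p y \<and> (\<forall>f\<in>F. ev p (jets y) f = \<zero>))"
    by (rule unif_bounded_cong) (simp add: assms(2))
qed

lemma good_open:
  assumes "good j C"
    and "\<And>p. p \<in> P \<Longrightarrow> openin \<Omega> (U p)"
  shows "good j (\<lambda>p y. C p y \<and> jets y \<in> U p)"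
  unfolding good_def
proof (intro allI impI)
  fix F assume "finite F \<and> F \<subseteq> Pol j"
  then have "unif_bounded (\<lambda>p y. C p y \<and> (\<forall>f\<in>F. ev p (jets y) f = \<zero>))"
    using assms(1) by (auto simp: good_def)
  then show "unif_bounded (\<lambda>p y. (C p y \<and> jets y \<in> U p) \<and> (\<forall>f\<in>F. ev p (jets y) f = \<zero>))"
    by (rule unif_bounded_open) (use assms(2) in auto)
qed

lemma good_nonzero:
  assumes "good j C" "f \<in> Pol i"
  shows "good j (\<lambda>p y. C p y \<and> ev p (jets y) f \<noteq> \<zero>)"
  by (rule good_cong[OF good_open[OF assms(1) openin_nonzero[OF assms(2)]]]) auto

lemma good_disj:
  assumes "good j C" "good j C'"
  shows "good j (\<lambda>p y. C p y \<or> C' p y)"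
  unfolding good_def
proof (intro allI impI)
  fix F assume "finite F \<and> F \<subseteq> Pol j"
  then have "unif_bounded (\<lambda>p y. C p y \<and> (\<forall>f\<in>F. ev p (jets y) f = \<zero>))"
    "unif_bounded (\<lambda>p y. C' p y \<and> (\<forall>f\<in>F. ev p (jets y) f = \<zero>))"
    using assms by (auto simp: good_def)
  from unif_bounded_disj[OF this]
  show "unif_bounded (\<lambda>p y. (C p y \<or> C' p y) \<and> (\<forall>f\<in>F. ev p (jets y) f = \<zero>))"
    by (rule unif_bounded_cong) auto
qed

lemma good_zeros:
  assumes "good j C" "finite G" "G \<subseteq> Pol j"
  shows "good j (\<lambda>p y. C p y \<and> (\<forall>f\<in>G. ev p (jets y) f = \<zero>))"
  unfolding good_def
proof (intro allI impI)
  fix F assume "finite F \<and> F \<subseteq> Pol j"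
  then have "unif_bounded (\<lambda>p y. C p y \<and> (\<forall>f\<in>F \<union> G. ev p (jets y) f = \<zero>))"
    using assms unfolding good_def by blast
  then show "unif_bounded (\<lambda>p y. (C p y \<and> (\<forall>f\<in>G. ev p (jets y) f = \<zero>)) \<and> (\<forall>f\<in>F. ev p (jets y) f = \<zero>))"
    by (rule unif_bounded_cong) auto
qed

lemma good_zero:
  assumes "good j C" "f \<in> Pol j"
  shows "good j (\<lambda>p y. C p y \<and> ev p (jets y) f = \<zero>)"
  using good_zeros[OF assms(1), of "{f}"] assms(2) by simp

lemma good_unif_bounded: "good j C \<Longrightarrow> unif_bounded C"
  unfolding good_def by (drule spec[of _ "{}"]) simp

lemma good_mono: "good k C \<Longrightarrow> j \<le> k \<Longrightarrow> good j C"
  unfolding good_def using dpols_mono[of _ K P j k] by blast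

lemma good_split:
  assumes "good j (\<lambda>p y. (C p y \<and> ev p (jets y) c = \<zero>) \<and> A p y)"
    and "good j (\<lambda>p y. (C p y \<and> ev p (jets y) c \<noteq> \<zero>) \<and> A p y)"
  shows "good j (\<lambda>p y. C p y \<and> A p y)"
  by (rule good_cong[OF good_disj[OF assms]]) auto

text \<open>The one case that elimination in \<open>Jv j\<close> cannot simplify further; it is the
  hypothesis under which \<open>elimination\<close> passes from \<open>j\<close> to
  \<open>Suc j\<close>.\<close>

definition good_sep :: "nat \<Rightarrow> ('p \<Rightarrow> 'u \<Rightarrow> bool) \<Rightarrow> bool" where
  "good_sep j C \<longleftrightarrow> (\<forall>cs. set cs \<subseteq> Pol j \<longrightarrow>
     good j (\<lambda>p y. C p y \<and> ev p (jets y) (hr j cs) = \<zero> \<and> ev p (jets y) (pdiff K j (hr j cs)) \<noteq> \<zero>))"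

lemma good_sep_zero:
  assumes "good_sep j C" "f \<in> Pol j"
  shows "good_sep j (\<lambda>p y. C p y \<and> ev p (jets y) f = \<zero>)"
  unfolding good_sep_def
proof (intro allI impI)
  fix cs assume "set cs \<subseteq> Pol j"
  then have "good j (\<lambda>p y. C p y \<and> ev p (jets y) (hr j cs) = \<zero> \<and> ev p (jets y) (pdiff K j (hr j cs)) \<noteq> \<zero>)"
    using assms by (auto simp: good_sep_def)
  from good_zero[OF this assms(2)]
  show "good j (\<lambda>p y. (C p y \<and> ev p (jets y) f = \<zero>) \<and> ev p (jets y) (hr j cs) = \<zero> \<and>
      ev p (jets y) (pdiff K j (hr j cs)) \<noteq> \<zero>)"
    by (rule good_cong) auto
qed

lemma good_sep_nonzero:
  assumes "good_sep j C" "f \<in> Pol i"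
  shows "good_sep j (\<lambda>p y. C p y \<and> ev p (jets y) f \<noteq> \<zero>)"
  unfolding good_sep_def
proof (intro allI impI)
  fix cs assume "set cs \<subseteq> Pol j"
  then have "good j (\<lambda>p y. C p y \<and> ev p (jets y) (hr j cs) = \<zero> \<and> ev p (jets y) (pdiff K j (hr j cs)) \<noteq> \<zero>)"
    using assms by (auto simp: good_sep_def)
  from good_nonzero[OF this assms(2)]
  show "good j (\<lambda>p y. (C p y \<and> ev p (jets y) f \<noteq> \<zero>) \<and> ev p (jets y) (hr j cs) = \<zero> \<and>
      ev p (jets y) (pdiff K j (hr j cs)) \<noteq> \<zero>)"
    by (rule good_cong) auto
qed

section \<open>Elimination in the highest derivative\<close>

abbreviation "zeros j css \<equiv> (\<lambda>p y. \<forall>cs\<in>set css. ev p (jets y) (hr j cs) = \<zero>)"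

text \<open>Euler's relation reads \<open>n f = e + x f'\<close>, and \<open>n\<close> is invertible
  since the characteristic is zero and \<open>cs\<close> is nonempty. Thus \<open>f = f' = 0\<close>
  amounts to \<open>e = f' = 0\<close>, two lists that are both shorter than that of
  \<open>f\<close>.\<close>

lemma horner_separant_zero:
  assumes "set (c # cs) \<subseteq> Pol j" "cs \<noteq> []" "p \<in> P" "range a \<subseteq> carrier K"
  shows "ev p a (hr j (c # cs)) = \<zero> \<and> ev p a (pdiff K j (hr j (c # cs))) = \<zero> \<longleftrightarrow>
    ev p a (hr j (euler_coeffs K (length cs) cs)) = \<zero> \<and>
    ev p a (hr j (pdiff_coeffs K (c # cs))) = \<zero>"
proof -
  let ?n = "length cs" and ?f = "hr j (c # cs)"
  have eq: "ev p a (hr j (euler_coeffs K ?n (c # cs))) \<oplus> a j \<otimes> ev p a (pdiff K j ?f) = [?n] \<cdot> ev p a ?f"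
    using assms by (intro dev_euler) auto
  have "ev p a (hr j (euler_coeffs K ?n (c # cs))) = ev p a (hr j (euler_coeffs K ?n cs))"
    using assms dev_nscale[of c j p a 0] dev_closed[of c j p a]
    by (simp add: dev_horner_Cons del: horner.simps)
  moreover have "ev p a (pdiff K j ?f) = ev p a (hr j (pdiff_coeffs K (c # cs)))"
    using assms by (intro dev_pdiff_horner)
  moreover have "[?n] \<cdot> x = \<zero> \<longleftrightarrow> x = \<zero>" if "x \<in> carrier K" for x
  proof -
    have "[?n] \<cdot> x = ([?n] \<cdot> \<one>) \<otimes> x" using that by (simp add: add_pow_ldistr)
    then show ?thesis using that char_zero[of ?n] assms(2) by (simp add: integral_iff)
  qed
  moreover have "ev p a ?f \<in> carrier K" "ev p a (hr j (euler_coeffs K ?n cs)) \<in> carrier K"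
    using assms by (auto simp del: horner.simps intro!: dev_horner_closed)
  ultimately show ?thesis
    using eq range_in_carrier[OF assms(4), of j]
    by (metis add.r_cancel_one' r_null r_zero zero_closed)
qed

lemma elimination_lists:
  assumes "good j C" "good_sep j C" "\<Union>(set ` set css) \<subseteq> Pol j"
  shows "good j (\<lambda>p y. C p y \<and> zeros j css p y)"
  using assms
\<comment> \<open>Euler's relation trades one list of length \<open>m + 1\<close> for two of length
  \<open>m\<close>. The sum of the weights still drops because \<open>2 * 3^m < 3^(m+1)\<close>;
  base 2 would only give equality.\<close>
proof (induction "\<Sum>cs\<leftarrow>css. 3 ^ length cs :: nat" arbitrary: C css rule: less_induct)
  case less
  note IH = less.hyps and good = less.prems(1) and sep = less.prems(2) and sub = less.prems(3)
  show ?case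
  proof (cases "[] \<in> set css")
    case True
    then obtain as bs where css: "css = as @ [] # bs" by (meson split_list)
    \<comment> \<open>The empty list is the zero polynomial and imposes nothing; dropping it saves
      its weight \<open>3^0 = 1\<close>.\<close>
    have "good j (\<lambda>p y. C p y \<and> zeros j (as @ bs) p y)"
    proof (rule IH[OF _ good sep])
      show "(\<Sum>cs\<leftarrow>as @ bs. 3 ^ length cs :: nat) < (\<Sum>cs\<leftarrow>css. 3 ^ length cs)"
        by (simp add: css)
      show "\<Union> (set ` set (as @ bs)) \<subseteq> Pol j" using sub by (auto simp: css)
    qed
    then show ?thesis by (rule good_cong) (auto simp: css)
  next
    case nonempty: False
    \<comment> \<open>Two equations of order \<open>j\<close>: if the leading coefficient of the
      shorter list vanishes, that list loses its head; otherwise the longer one is replaced by its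
      pseudo-remainder. Fixing only the set and the weight of \<open>css\<close> permits either
      order of the two lists.\<close>
    have two: "good j (\<lambda>p y. C p y \<and> zeros j css p y)"
      if css: "set css = set ((c # cs) # (d # ds) # rest)"
        "(\<Sum>cs\<leftarrow>css. 3 ^ length cs :: nat) = (\<Sum>cs\<leftarrow>(c # cs) # (d # ds) # rest. 3 ^ length cs)"
        and le: "length cs \<le> length ds" for c cs d ds rest
    proof (rule good_split)
      have c: "c \<in> Pol j" "d \<in> Pol j" "set cs \<subseteq> Pol j" "set ds \<subseteq> Pol j"
        and rest: "\<Union>(set ` set rest) \<subseteq> Pol j"
        using sub unfolding css(1) by auto
      let ?red = "reduct_coeffs K c cs d ds"
      have "good j (\<lambda>p y. (C p y \<and> ev p (jets y) c = \<zero>) \<and> zeros j (cs # (d # ds) # rest) p y)"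
      proof (rule IH[OF _ good_zero[OF good c(1)] good_sep_zero[OF sep c(1)]])
        show "(\<Sum>cs\<leftarrow>cs # (d # ds) # rest. 3 ^ length cs :: nat) < (\<Sum>cs\<leftarrow>css. 3 ^ length cs)"
          unfolding css(2) by simp
        show "\<Union> (set ` set (cs # (d # ds) # rest)) \<subseteq> Pol j" using c rest by auto
      qed
      then show "good j (\<lambda>p y. (C p y \<and> ev p (jets y) c = \<zero>) \<and> zeros j css p y)"
      proof (rule good_cong)
        fix p y assume py: "p \<in> P" "y \<in> carrier K"
        have "ev p (jets y) (hr j (c # cs)) = ev p (jets y) (hr j cs)" if "ev p (jets y) c = \<zero>"
          using that c py by (simp add: dev_horner_Cons del: horner.simps)
        then show "(C p y \<and> ev p (jets y) c = \<zero>) \<and> zeros j css p y \<longleftrightarrow>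
            (C p y \<and> ev p (jets y) c = \<zero>) \<and> zeros j (cs # (d # ds) # rest) p y"
          unfolding css(1) by (auto simp del: horner.simps)
      qed
      have "good j (\<lambda>p y. (C p y \<and> ev p (jets y) c \<noteq> \<zero>) \<and> zeros j ((c # cs) # ?red # rest) p y)"
      proof (rule IH[OF _ good_nonzero[OF good c(1)] good_sep_nonzero[OF sep c(1)]])
        show "(\<Sum>cs\<leftarrow>(c # cs) # ?red # rest. 3 ^ length cs :: nat) < (\<Sum>cs\<leftarrow>css. 3 ^ length cs)"
          unfolding css(2) using le by simp
        show "\<Union> (set ` set ((c # cs) # ?red # rest)) \<subseteq> Pol j"
          using c rest reduct_coeffs_Pol[OF c] by auto
      qed
      then show "good j (\<lambda>p y. (C p y \<and> ev p (jets y) c \<noteq> \<zero>) \<and> zeros j css p y)"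
      proof (rule good_cong)
        fix p y assume py: "p \<in> P" "y \<in> carrier K"
        have "ev p (jets y) (hr j ?red) = \<zero> \<longleftrightarrow> ev p (jets y) (hr j (d # ds)) = \<zero>"
          if "ev p (jets y) (hr j (c # cs)) = \<zero>" "ev p (jets y) c \<noteq> \<zero>"
        proof -
          have "ev p (jets y) c \<in> carrier K" "ev p (jets y) (hr j (d # ds)) \<in> carrier K"
            using c py by (auto intro!: dev_horner_closed dev_closed[of c j] simp del: horner.simps)
          then show ?thesis
            using dev_reduct[OF c py(1) range_dseq[OF py(2)] le that(1)] that(2)
            by (simp add: integral_iff del: horner.simps)
        qed
        then show "(C p y \<and> ev p (jets y) c \<noteq> \<zero>) \<and> zeros j css p y \<longleftrightarrow>
           (C p y \<and> ev p (jets y) c \<noteq> \<zero>) \<and> zeros j ((c # cs) # ?red # rest) p y"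
          unfolding css(1) by (auto simp del: horner.simps)
      qed
    qed
    show ?thesis
    proof (cases css)
      case Nil then show ?thesis using good by simp
    next
      case css: (Cons a css')
      with nonempty obtain c cs where a: "a = c # cs" by (cases a) auto
      have c: "c \<in> Pol j" "set cs \<subseteq> Pol j" using sub css a by auto
      show ?thesis
      proof (cases css')
        case Nil
        let ?s = "pdiff K j (hr j (c # cs))" and ?f = "hr j (c # cs)"
        have zs: "zeros j css p y \<longleftrightarrow> ev p (jets y) ?f = \<zero>" for p y
          by (simp add: css a Nil del: horner.simps)
        show ?thesis
        \<comment> \<open>A single equation remains: \<open>good_sep\<close> covers a nonzero
          separant, and a vanishing separant leads to shorter lists.\<close>
        proof (rule good_split[of _ _ ?s])
          have "good j (\<lambda>p y. C p y \<and> ev p (jets y) ?f = \<zero> \<and> ev p (jets y) ?s \<noteq> \<zero>)"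
            by (rule sep[unfolded good_sep_def, rule_format]) (use c in simp)
          then show "good j (\<lambda>p y. (C p y \<and> ev p (jets y) ?s \<noteq> \<zero>) \<and> zeros j css p y)"
            unfolding zs by (rule good_cong) blast
          show "good j (\<lambda>p y. (C p y \<and> ev p (jets y) ?s = \<zero>) \<and> zeros j css p y)"
          proof (cases "cs = []")
            case True
            \<comment> \<open>The equation is free of \<open>Jv j\<close>, so its separant is zero
              and it is an admissible equation of lower order.\<close>
            have "good j (\<lambda>p y. C p y \<and> ev p (jets y) c = \<zero>)" by (rule good_zero[OF good c(1)])
            then show ?thesis unfolding zs
            proof (rule good_cong)
              fix p y assume py: "p \<in> P" "y \<in> carrier K"
              have "ev p (jets y) ?s = \<zero>"
                using dev_pdiff_horner[of "c # cs" j p "jets y"] py c True by (simp del: horner.simps pdiff.simps) simp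
              moreover have "ev p (jets y) ?f = ev p (jets y) c"
                using dev_closed[OF c(1) py(1) range_dseq[OF py(2)]] py True by simp
              ultimately show "(C p y \<and> ev p (jets y) ?s = \<zero>) \<and> ev p (jets y) ?f = \<zero> \<longleftrightarrow>
                  C p y \<and> ev p (jets y) c = \<zero>"
                by simp
            qed
          next
            case False
            let ?e = "euler_coeffs K (length cs) cs" and ?d = "pdiff_coeffs K (c # cs)"
            have "good j (\<lambda>p y. C p y \<and> zeros j [?e, ?d] p y)"
            proof (rule IH[OF _ good sep])
              show "(\<Sum>cs\<leftarrow>[?e, ?d]. 3 ^ length cs :: nat) < (\<Sum>cs\<leftarrow>css. 3 ^ length cs)"
                by (simp add: css a Nil del: pdiff_coeffs.simps)
              show "\<Union>(set ` set [?e, ?d]) \<subseteq> Pol j"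
                using c euler_coeffs_Pol[of cs j] pdiff_coeffs_Pol[of "c # cs" j] by auto
            qed
            then show ?thesis unfolding zs
            proof (rule good_cong)
              fix p y assume py: "p \<in> P" "y \<in> carrier K"
              have "ev p (jets y) ?f = \<zero> \<and> ev p (jets y) ?s = \<zero> \<longleftrightarrow>
                  ev p (jets y) (hr j ?e) = \<zero> \<and> ev p (jets y) (hr j ?d) = \<zero>"
                by (rule horner_separant_zero) (use c False py in auto)
              then show "(C p y \<and> ev p (jets y) ?s = \<zero>) \<and> ev p (jets y) ?f = \<zero> \<longleftrightarrow>
                  C p y \<and> zeros j [?e, ?d] p y"
                by (auto simp del: horner.simps pdiff_coeffs.simps pdiff.simps)
            qed
          qed
        qed
      next
        case css': (Cons b rest)
        with nonempty css obtain d ds where b: "b = d # ds" by (cases b) auto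
        show ?thesis
        proof (cases "length cs \<le> length ds")
          case True then show ?thesis by (intro two[of c cs d ds rest]) (auto simp: css css' a b)
        next
          case False then show ?thesis by (intro two[of d ds c cs rest]) (auto simp: css css' a b)
        qed
      qed
    qed
  qed
qed

lemma elimination:
  assumes "good j C" "good_sep j C"
  shows "good (Suc j) C"
  unfolding good_def
proof (intro allI impI)
  fix F assume F: "finite F \<and> F \<subseteq> Pol (Suc j)"
  define h where "h f = (SOME cs. set cs \<subseteq> Pol j \<and>
     (\<forall>p\<in>P. \<forall>a. range a \<subseteq> carrier K \<longrightarrow> ev p a (hr j cs) = ev p a f))" for f
  have h: "set (h f) \<subseteq> Pol j \<and>
     (\<forall>p\<in>P. \<forall>a. range a \<subseteq> carrier K \<longrightarrow> ev p a (hr j (h f)) = ev p a f)" if "f \<in> F" for f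
    unfolding h_def by (rule someI_ex) (use ex_horner that F in blast)
  obtain fs where fs: "set fs = F" using F finite_list by blast
  have "good j (\<lambda>p y. C p y \<and> zeros j (map h fs) p y)"
    by (rule elimination_lists[OF assms]) (use h fs in auto)
  then show "unif_bounded (\<lambda>p y. C p y \<and> (\<forall>f\<in>F. ev p (jets y) f = \<zero>))"
    by (rule unif_bounded_cong[OF good_unif_bounded]) (use h fs in auto)
qed

end

section \<open>Reduction modulo a polynomial and abundance of solutions\<close>

text \<open>Translates each coordinate by an entry of a fixed sequence \<open>b\<close> that need
  not be a jet. So this is not the substitution of \<open>X + u\<close> for an element
  \<open>u\<close>: at the jet of \<open>z\<close> it gives the value of \<open>f\<close> at a point
  that need not be a jet.\<close>

primrec dshift :: "('u, 'r, 'c) struct \<Rightarrow> (nat \<Rightarrow> 'u) \<Rightarrow> ('p, 'u) dpol \<Rightarrow> ('p, 'u) dpol" where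
  "dshift K b (Cst c) = Cst c"
| "dshift K b (Jv i) = Plus (Jv i) (Cst (\<lambda>_. b i))"
| "dshift K b (Plus f g) = Plus (dshift K b f) (dshift K b g)"
| "dshift K b (Times f g) = Times (dshift K b f) (dshift K b g)"

context diff_field
begin

text \<open>Reduction to order at most \<open>j\<close> up to a power of the separant. The identity
  is required at jets only, because it is obtained by differentiating \<open>g = 0\<close>, which
  has no consequence of this kind at arbitrary sequences.\<close>

definition reducible :: "nat \<Rightarrow> ('p, 'u) dpol \<Rightarrow> ('p, 'u) dpol \<Rightarrow> bool" where
  "reducible j g f \<longleftrightarrow> (\<exists>e. \<exists>r\<in>Pol (Suc j). \<forall>p\<in>P. \<forall>y\<in>carrier K.
     ev p (jets y) g = \<zero> \<and> ev p (jets y) (pdiff K j g) \<noteq> \<zero> \<longrightarrow>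
       ev p (jets y) (Powr K (pdiff K j g) e) \<otimes> ev p (jets y) f = ev p (jets y) r)"

lemma reducible_low: "f \<in> Pol (Suc j) \<Longrightarrow> reducible j g f"
  unfolding reducible_def by (rule exI[of _ 0], rule bexI[of _ f]) auto

context
  fixes j g assumes g: "g \<in> Pol (Suc j)"
begin

lemma Powr_add:
  assumes "p \<in> P" "y \<in> carrier K"
  shows "ev p (jets y) (Powr K (pdiff K j g) (m + n)) =
     ev p (jets y) (Powr K (pdiff K j g) m) \<otimes> ev p (jets y) (Powr K (pdiff K j g) n)"
  using dev_Powr[OF pdiff_Pol[OF g] assms(1) range_dseq[OF assms(2)]]
    dev_closed[OF pdiff_Pol[OF g] assms(1) range_dseq[OF assms(2)]] by (simp add: nat_pow_mult)

lemma reducible_Plus_Times: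
  assumes f: "f \<in> Pol m" and h: "h \<in> Pol n"
    and "reducible j g f" "reducible j g h"
  shows "reducible j g (Plus f h)" "reducible j g (Times f h)"
proof -
  let ?S = "Powr K (pdiff K j g)"
  obtain e r where r: "r \<in> Pol (Suc j)" "\<forall>p\<in>P. \<forall>y\<in>carrier K.
     ev p (jets y) g = \<zero> \<and> ev p (jets y) (pdiff K j g) \<noteq> \<zero> \<longrightarrow>
       ev p (jets y) (?S e) \<otimes> ev p (jets y) f = ev p (jets y) r"
    using assms(3) unfolding reducible_def by blast
  obtain e' r' where r': "r' \<in> Pol (Suc j)" "\<forall>p\<in>P. \<forall>y\<in>carrier K.
     ev p (jets y) g = \<zero> \<and> ev p (jets y) (pdiff K j g) \<noteq> \<zero> \<longrightarrow>
       ev p (jets y) (?S e') \<otimes> ev p (jets y) h = ev p (jets y) r'"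
    using assms(4) unfolding reducible_def by blast
  have S: "?S i \<in> Pol (Suc j)" for i using g by (intro Powr_Pol pdiff_Pol)
  have cl: "ev p (jets y) (?S i) \<in> carrier K" "ev p (jets y) f \<in> carrier K" "ev p (jets y) h \<in> carrier K"
    if "p \<in> P" "y \<in> carrier K" for p y i
    using that f h by (auto intro: dev_closed[OF S] dev_closed[OF f] dev_closed[OF h])
  show "reducible j g (Plus f h)"
    unfolding reducible_def
  \<comment> \<open>Each remainder is multiplied by the other power of the separant to obtain a
    common exponent.\<close>
  proof (rule exI[of _ "e + e'"], rule bexI[of _ "Plus (Times (?S e') r) (Times (?S e) r')"],
      intro ballI impI)
    fix p y assume py: "p \<in> P" "y \<in> carrier K"
      and z: "ev p (jets y) g = \<zero> \<and> ev p (jets y) (pdiff K j g) \<noteq> \<zero>"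
    have "ev p (jets y) r = ev p (jets y) (?S e) \<otimes> ev p (jets y) f"
      "ev p (jets y) r' = ev p (jets y) (?S e') \<otimes> ev p (jets y) h"
      using r(2) r'(2) py z by auto
    then show "ev p (jets y) (?S (e + e')) \<otimes> ev p (jets y) (Plus f h) =
       ev p (jets y) (Plus (Times (?S e') r) (Times (?S e) r'))"
      using cl[OF py] by (simp add: Powr_add[OF py] r_distr m_ac)
  qed (use S r r' in simp)
  show "reducible j g (Times f h)"
    unfolding reducible_def
  proof (rule exI[of _ "e + e'"], rule bexI[of _ "Times r r'"], intro ballI impI)
    fix p y assume py: "p \<in> P" "y \<in> carrier K"
      and z: "ev p (jets y) g = \<zero> \<and> ev p (jets y) (pdiff K j g) \<noteq> \<zero>"
    have "ev p (jets y) r = ev p (jets y) (?S e) \<otimes> ev p (jets y) f"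
      "ev p (jets y) r' = ev p (jets y) (?S e') \<otimes> ev p (jets y) h"
      using r(2) r'(2) py z by auto
    then show "ev p (jets y) (?S (e + e')) \<otimes> ev p (jets y) (Times f h) =
       ev p (jets y) (Times r r')"
      using cl[OF py] by (simp add: Powr_add[OF py] m_ac)
  qed (use r r' in simp)
qed

text \<open>Exponents add up, so it is enough to reduce the product of \<open>f\<close> with some
  power of the separant.\<close>

lemma reducible_cancel:
  assumes f: "f \<in> Pol m" and "u \<in> Pol n" "reducible j g u"
    and eq: "\<And>p y. p \<in> P \<Longrightarrow> y \<in> carrier K \<Longrightarrow> ev p (jets y) g = \<zero> \<Longrightarrow>
      ev p (jets y) (pdiff K j g) \<noteq> \<zero> \<Longrightarrow>
      ev p (jets y) (Powr K (pdiff K j g) e) \<otimes> ev p (jets y) f = ev p (jets y) u"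
  shows "reducible j g f"
proof -
  let ?S = "Powr K (pdiff K j g)"
  obtain e' r where r: "r \<in> Pol (Suc j)" "\<forall>p\<in>P. \<forall>y\<in>carrier K.
     ev p (jets y) g = \<zero> \<and> ev p (jets y) (pdiff K j g) \<noteq> \<zero> \<longrightarrow>
       ev p (jets y) (?S e') \<otimes> ev p (jets y) u = ev p (jets y) r"
    using assms(3) unfolding reducible_def by blast
  have S: "?S i \<in> Pol (Suc j)" for i using g by (intro Powr_Pol pdiff_Pol)
  show ?thesis
    unfolding reducible_def
  proof (rule exI[of _ "e' + e"], rule bexI[of _ r], intro ballI impI)
    fix p y assume py: "p \<in> P" "y \<in> carrier K"
      and z: "ev p (jets y) g = \<zero> \<and> ev p (jets y) (pdiff K j g) \<noteq> \<zero>"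
    have "ev p (jets y) (?S (e' + e)) \<otimes> ev p (jets y) f = ev p (jets y) (?S e') \<otimes> ev p (jets y) u"
      using eq[OF py] z dev_closed[OF S py(1) range_dseq[OF py(2)]]
        dev_closed[OF f py(1) range_dseq[OF py(2)]] by (simp add: Powr_add[OF py] m_assoc)
    then show "ev p (jets y) (?S (e' + e)) \<otimes> ev p (jets y) f = ev p (jets y) r"
      using r(2) py z by auto
  qed (rule r(1))
qed

lemma reducible_Pol:
  assumes "\<And>i. i < n \<Longrightarrow> reducible j g (Jv i)" "f \<in> Pol n"
  shows "reducible j g f"
  using assms(2)
proof (induction rule: dpols.induct)
  case (Cst c)
  then show ?case by (intro reducible_low) (auto intro: dpols.Cst)
next
  case (Plus f h) show ?case by (rule reducible_Plus_Times(1)) (fact Plus)+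
next
  case (Times f h) show ?case by (rule reducible_Plus_Times(2)) (fact Times)+
qed (use assms(1) in simp)

text \<open>Differentiating \<open>g = 0\<close> yields \<open>s y^(j+1) + h = 0\<close>, where
  \<open>s\<close> is the separant and \<open>h\<close> has order at most \<open>j\<close>.\<close>

lemma reducible_next: "reducible j g (Jv (Suc j))"
proof -
  obtain h where h: "h \<in> Pol (Suc j)" "\<And>p a. p \<in> P \<Longrightarrow> range a \<subseteq> carrier K \<Longrightarrow>
       ev p a (tdiff K g) = ev p a (pdiff K j g) \<otimes> a (Suc j) \<oplus> ev p a h"
    using tdiff_linear_in_top[OF g] by blast
  let ?u = "Times (Cst (\<lambda>_. \<ominus> \<one>)) h"
  show ?thesis
  proof (rule reducible_cancel[of "Jv (Suc j)" "Suc (Suc j)" ?u "Suc j" 1])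
    fix p y assume py: "p \<in> P" "y \<in> carrier K" and z: "ev p (jets y) g = \<zero>"
    let ?s = "ev p (jets y) (pdiff K j g)" and ?h = "ev p (jets y) h" and ?x = "jets y (Suc j)"
    have cl: "?s \<in> carrier K" "?h \<in> carrier K" "?x \<in> carrier K"
      using dev_closed[OF pdiff_Pol[OF g] py(1) range_dseq[OF py(2)]]
        dev_closed[OF h(1) py(1) range_dseq[OF py(2)]] dseq_closed[OF py(2)] by auto
    have "?s \<otimes> ?x \<oplus> ?h = der K (ev p (jets y) g)"
      using h(2)[OF py(1) range_dseq[OF py(2)]] der_dev[OF g py] by simp
    then have "?s \<otimes> ?x = \<ominus> ?h" using z cl by (simp add: minus_equality)
    then show "ev p (jets y) (Powr K (pdiff K j g) 1) \<otimes> ev p (jets y) (Jv (Suc j)) = ev p (jets y) ?u"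
      using cl by (simp add: l_minus)
  qed (use h(1) reducible_low[of ?u] in auto)
qed

text \<open>Differentiating \<open>s^e y^(i) = r\<close> gives
  \<open>s^e y^(i+1) = r' - (s^e)' y^(i)\<close>. Both \<open>r'\<close> and \<open>(s^e)'\<close>
  have order at most \<open>j + 1\<close>, so \<open>reducible_next\<close> reduces them, and
  \<open>y^(i)\<close> is reducible by induction.\<close>

lemma reducible_Jv: "reducible j g (Jv i)"
proof (induction i)
  case 0 then show ?case by (rule reducible_low) simp
next
  case (Suc i)
  show ?case
  proof (cases "i \<le> j")
    case True
    then show ?thesis using reducible_next reducible_low[of "Jv (Suc i)" j] by (cases "i = j") auto
  next
    case False
    let ?S = "Powr K (pdiff K j g)"
    obtain e r where r: "r \<in> Pol (Suc j)" "\<forall>p\<in>P. \<forall>y\<in>carrier K.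
       ev p (jets y) g = \<zero> \<and> ev p (jets y) (pdiff K j g) \<noteq> \<zero> \<longrightarrow>
         ev p (jets y) (?S e) \<otimes> ev p (jets y) (Jv i) = ev p (jets y) r"
      using Suc unfolding reducible_def by blast
    have S: "?S e \<in> Pol (Suc j)" using g by (intro Powr_Pol pdiff_Pol)
    let ?u = "Plus (tdiff K r) (Times (Cst (\<lambda>_. \<ominus> \<one>)) (Times (tdiff K (?S e)) (Jv i)))"
    have low: "reducible j g f" if "f \<in> Pol (Suc (Suc j))" for f
      by (rule reducible_Pol[OF _ that])
        (use reducible_next reducible_low[of _ j g] in \<open>auto simp: less_Suc_eq\<close>)
    have T: "tdiff K r \<in> Pol (Suc (Suc j))" "tdiff K (?S e) \<in> Pol (Suc (Suc j))"
      using tdiff_Pol[OF r(1)] tdiff_Pol[OF S] by auto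
    have i: "Jv i \<in> Pol (Suc i)" "Cst (\<lambda>_. \<ominus> \<one>) \<in> Pol (Suc i)" by auto
    have ii: "Times (tdiff K (?S e)) (Jv i) \<in> Pol (Suc i)"
      using False by (intro Times_Pol dpols_mono[OF T(2)] i) simp
    show ?thesis
    proof (rule reducible_cancel[of "Jv (Suc i)" "Suc (Suc i)" ?u "Suc i"])
      show "?u \<in> Pol (Suc i)"
        using False ii i by (intro Plus_Pol Times_Pol[OF i(2)] dpols_mono[OF T(1)]) auto
      show "reducible j g ?u"
      proof (rule reducible_Plus_Times(1)[OF T(1) Times_Pol[OF i(2) ii] low[OF T(1)]])
        show "reducible j g (Times (Cst (\<lambda>_. \<ominus> \<one>)) (Times (tdiff K (?S e)) (Jv i)))"
          by (intro reducible_Plus_Times(2)[OF i(2) ii] reducible_Plus_Times(2)[OF T(2) i(1)] low T Suc) simp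
      qed
      fix p y assume py: "p \<in> P" "y \<in> carrier K" and z: "ev p (jets y) g = \<zero>"
        "ev p (jets y) (pdiff K j g) \<noteq> \<zero>"
      let ?s = "ev p (jets y) (?S e)" and ?ds = "ev p (jets y) (tdiff K (?S e))"
      have cl: "?s \<in> carrier K" "?ds \<in> carrier K"
        "ev p (jets y) (tdiff K r) \<in> carrier K" "jets y i \<in> carrier K" "jets y (Suc i) \<in> carrier K"
        using py by (auto intro: dev_closed[OF S] dev_closed[OF T(1)] dev_closed[OF T(2)])
      have "?s \<otimes> jets y i = ev p (jets y) r" using r(2) py z by auto
      then have "der K (?s \<otimes> jets y i) = ev p (jets y) (tdiff K r)"
        using der_dev[OF r(1) py] by simp
      then have "ev p (jets y) (tdiff K r) = ?ds \<otimes> jets y i \<oplus> ?s \<otimes> jets y (Suc i)"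
        using cl der_dev[OF S py] by (simp add: der_mult dseq_Suc)
      moreover have "ev p (jets y) ?u = ev p (jets y) (tdiff K r) \<ominus> ?ds \<otimes> jets y i"
        using cl by (simp add: l_minus a_minus_def)
      moreover have "(b \<oplus> c) \<ominus> b = c" if "b \<in> carrier K" "c \<in> carrier K" for b c
        using that by (metis a_comm a_minus_def add.inv_solve_right' add.m_closed)
      ultimately show "?s \<otimes> ev p (jets y) (Jv (Suc i)) = ev p (jets y) ?u"
        using cl by simp
    qed auto
  qed
qed

lemma reducible_all: "f \<in> Pol n \<Longrightarrow> reducible j g f"
  by (rule reducible_Pol[OF reducible_Jv])

end

lemma dshift_Pol: "f \<in> Pol j \<Longrightarrow> range b \<subseteq> carrier K \<Longrightarrow> dshift K b f \<in> Pol j"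
  by (induction rule: dpols.induct) (auto intro: dpols.intros)

lemma dev_dshift: "ev p x (dshift K b f) = ev p (\<lambda>i. x i \<oplus> b i) f"
  by (induction f) auto

lemma dev_pdiff_dshift: "ev p x (pdiff K n (dshift K b f)) = ev p (\<lambda>i. x i \<oplus> b i) (pdiff K n f)"
  by (induction f) (auto simp: dev_dshift)

end

section \<open>Infinitely many solutions from (DL)\<close>

context diff_top_field
begin

lemma openin_Diff_finite:
  assumes "openin \<tau> V" "finite E"
  shows "openin \<tau> (V - E)"
  using assms(2)
proof induction
  case (insert e E)
  have "V - insert e E = (V - E) \<inter> (carrier K - {e})"
    using openin_subset[OF assms(1)] by auto
  then show ?case using insert openin_punctured by auto
qed (use assms in simp)

text \<open>Applied at \<open>a\<close> directly, (DL) might return a solution with the same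
  coordinate 0. The translation moves the target of the approximation to a point whose
  approximations cannot be the jet of zero. The translated sequence need not be a jet, so only an
  algebraic point results.\<close>

lemma DL_other_point:
  assumes "0 < n" "p \<in> P" "f \<in> Pol (Suc n)" "range a \<subseteq> carrier K" "ev p a f = \<zero>"
    "ev p a (pdiff K n f) \<noteq> \<zero>" "\<And>i. i \<le> n \<Longrightarrow> openin \<tau> (V i) \<and> a i \<in> V i"
  shows "\<exists>b. range b \<subseteq> carrier K \<and> ev p b f = \<zero> \<and> ev p b (pdiff K n f) \<noteq> \<zero> \<and>
    (\<forall>i\<le>n. b i \<in> V i) \<and> b 0 \<noteq> a 0"
proof -
  \<comment> \<open>\<open>\<beta> 0 = 0\<close> makes the new coordinate 0 equal to
    \<open>z\<close> plus \<open>a 0\<close>; the entry 1 sits at index 1, which (DL) controls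
    because \<open>0 < n\<close>.\<close>
  define \<beta> where "\<beta> i = (if i = 1 then \<one> else \<zero>)" for i :: nat
  define b where "b i = a i \<ominus> \<beta> i" for i
  \<comment> \<open>Zero is removed at index 1 to force the derivative of \<open>z\<close>, and with
    it \<open>z\<close>, to be nonzero.\<close>
  define V' where "V' i = {w \<in> carrier K. w \<oplus> b i \<in> V i} - (if i = 1 then {\<zero>} else {})" for i
  have \<beta>: "range \<beta> \<subseteq> carrier K" by (auto simp: \<beta>_def)
  have b: "range b \<subseteq> carrier K" using assms(4) \<beta> by (auto simp: b_def)
  have eqb: "\<beta> i \<oplus> b i = a i" for i
  proof -
    have "\<beta> i \<in> carrier K" "a i \<in> carrier K" using assms(4) by (auto simp: \<beta>_def)
    then have "\<beta> i \<oplus> b i = a i \<oplus> (\<beta> i \<oplus> \<ominus> \<beta> i)" by (simp add: b_def a_minus_def a_lcomm)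
    with \<open>\<beta> i \<in> carrier K\<close> \<open>a i \<in> carrier K\<close> show ?thesis by (simp add: r_neg)
  qed
  have op: "openin \<tau> (V' i) \<and> \<beta> i \<in> V' i" if "i \<le> n" for i
  proof
    have "continuous_map \<tau> \<tau> (\<lambda>w. w \<oplus> b i)"
      using range_in_carrier[OF b] by (intro continuous_add_mult) auto
    then have "openin \<tau> {w \<in> carrier K. w \<oplus> b i \<in> V i}"
      using openin_continuous_map_preimage[of \<tau> \<tau>] assms(7)[OF that] by fastforce
    then show "openin \<tau> (V' i)" unfolding V'_def by (rule openin_Diff_finite) auto
    show "\<beta> i \<in> V' i"
      using assms(7)[OF that] range_in_carrier[OF \<beta>] eqb by (auto simp: V'_def) (auto simp: \<beta>_def)
  qed
  have "\<exists>z\<in>carrier K. ev p (jets z) (dshift K b f) = \<zero> \<and>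
      ev p (jets z) (pdiff K n (dshift K b f)) \<noteq> \<zero> \<and> (\<forall>i\<le>n. jets z i \<in> V' i)"
    by (rule DL[of p _ n \<beta>]) (use assms \<beta> op in \<open>auto simp: dev_dshift dev_pdiff_dshift eqb dshift_Pol[OF _ b]\<close>)
  then obtain z where z: "z \<in> carrier K" "ev p (\<lambda>i. jets z i \<oplus> b i) f = \<zero>"
    "ev p (\<lambda>i. jets z i \<oplus> b i) (pdiff K n f) \<noteq> \<zero>" "\<And>i. i \<le> n \<Longrightarrow> jets z i \<in> V' i"
    by (auto simp: dev_dshift dev_pdiff_dshift)
  have "jets z 1 \<noteq> \<zero>" using z(4)[of 1] assms(1) by (auto simp: V'_def)
  then have "z \<noteq> \<zero>" by (auto simp: dseq_Suc)
  moreover have "b 0 = a 0" using assms(4) by (simp add: b_def \<beta>_def a_minus_def)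
  ultimately have "jets z 0 \<oplus> b 0 \<noteq> a 0" using z(1) range_in_carrier[OF assms(4), of 0] by simp
  moreover have "range (\<lambda>i. jets z i \<oplus> b i) \<subseteq> carrier K"
    using range_in_carrier[OF b] z(1) by auto
  moreover have "\<forall>i\<le>n. jets z i \<oplus> b i \<in> V i" using z(4) by (auto simp: V'_def)
  ultimately show ?thesis using z(2,3) by (intro exI[of _ "\<lambda>i. jets z i \<oplus> b i"]) simp
qed

text \<open>If the set \<open>E\<close> of solutions were finite, removing it from the neighbourhood
  of coordinate 0 would contradict (DL). But \<open>a 0\<close> may lie in \<open>E\<close>; so
  first only \<open>E - {a 0}\<close> is removed, and the other point found then has coordinate 0
  outside all of \<open>E\<close>. Here \<open>a\<close> need not be a jet.\<close>

lemma DL_infinite: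
  assumes "0 < n" "p \<in> P" "f \<in> Pol (Suc n)" "range a \<subseteq> carrier K" "ev p a f = \<zero>"
    "ev p a (pdiff K n f) \<noteq> \<zero>" "\<And>i. i \<le> n \<Longrightarrow> openin \<tau> (V i) \<and> a i \<in> V i"
  shows "infinite {z \<in> carrier K. ev p (jets z) f = \<zero> \<and> ev p (jets z) (pdiff K n f) \<noteq> \<zero> \<and>
     (\<forall>i\<le>n. jets z i \<in> V i)}" (is "infinite ?E")
proof
  assume fin: "finite ?E"
  have "\<exists>b. range b \<subseteq> carrier K \<and> ev p b f = \<zero> \<and> ev p b (pdiff K n f) \<noteq> \<zero> \<and>
    (\<forall>i\<le>n. b i \<in> (if i = 0 then V i - (?E - {a 0}) else V i)) \<and> b 0 \<noteq> a 0"
    by (rule DL_other_point[OF assms(1-6)])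
      (use assms(7) openin_Diff_finite[of _ "?E - {a 0}"] fin in auto)
  then obtain b where b: "range b \<subseteq> carrier K" "ev p b f = \<zero>" "ev p b (pdiff K n f) \<noteq> \<zero>"
    "\<And>i. i \<le> n \<Longrightarrow> b i \<in> (if i = 0 then V i - (?E - {a 0}) else V i)" "b 0 \<noteq> a 0"
    by blast
  have V: "openin \<tau> (if i = 0 then V i - ?E else V i) \<and> b i \<in> (if i = 0 then V i - ?E else V i)"
    if "i \<le> n" for i
    using assms(7)[OF that] b(4)[OF that] b(5) openin_Diff_finite[OF _ fin] by (cases "i = 0") auto
  obtain z where z: "z \<in> carrier K" "ev p (jets z) f = \<zero>" "ev p (jets z) (pdiff K n f) \<noteq> \<zero>"
    "\<forall>i\<le>n. jets z i \<in> (if i = 0 then V i - ?E else V i)"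
    using DL[OF assms(2,3) b(1-3) V] by blast
  have "z \<notin> ?E" using z(4)[rule_format, of 0] by simp
  moreover have "jets z i \<in> V i" if "i \<le> n" for i using z(4) that by (auto split: if_splits)
  ultimately show False using z(1-3) by blast
qed

end

section \<open>Uniform boundedness of systems of differential equations\<close>

context diff_top_field
begin

declare range_in_carrier [simp del]

abbreviation "sep_zero j f \<equiv> (\<lambda>p y. ev p (jets y) f = \<zero> \<and> ev p (jets y) (pdiff K j f) \<noteq> \<zero>)"

lemma openin_box:
  assumes "openin \<Omega> U" "a \<in> U"
  shows "\<exists>V N. (\<forall>i. openin \<tau> (V i) \<and> a i \<in> V i) \<and> (\<forall>i\<ge>N. V i = carrier K) \<and>
    {x. \<forall>i. x i \<in> V i} \<subseteq> U"
proof -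
  obtain V where V: "a \<in> (\<Pi>\<^sub>E i\<in>UNIV. V i)" "\<forall>i. openin \<tau> (V i)" "finite {i. V i \<noteq> topspace \<tau>}"
    "(\<Pi>\<^sub>E i\<in>UNIV. V i) \<subseteq> U"
    using product_topology_open_contains_basis[OF assms] by blast
  obtain N where "\<And>i. i \<in> {i. V i \<noteq> topspace \<tau>} \<Longrightarrow> i < N"
    using finite_nat_bounded[OF V(3)] by blast
  then have "\<forall>i\<ge>N. V i = carrier K" by (auto simp: not_less[symmetric])
  moreover have "\<forall>i. openin \<tau> (V i) \<and> a i \<in> V i" using V(1,2) by (auto simp: PiE_UNIV_domain)
  moreover have "{x. \<forall>i. x i \<in> V i} \<subseteq> U" using V(4) by (auto simp: PiE_UNIV_domain)
  ultimately show ?thesis by blast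
qed

text \<open>The open set \<open>U\<close> may restrict derivatives of order above \<open>k\<close>,
  beyond the reach of (DL). It is replaced by its preimage under a map that rebuilds a whole
  sequence from the coordinates up to \<open>k\<close> and fixes the jets of solutions.\<close>

lemma infinite_sep_zero:
  assumes "0 < k" "f \<in> Pol (Suc k)" "p \<in> P" "openin \<Omega> U" "y \<in> carrier K" "jets y \<in> U"
    "sep_zero k f p y"
  shows "infinite {z \<in> carrier K. jets z \<in> U \<and> sep_zero k f p z}"
proof -
  let ?s = "pdiff K k f"
  have "\<forall>i. \<exists>er. snd er \<in> Pol (Suc k) \<and> (\<forall>p\<in>P. \<forall>z\<in>carrier K. sep_zero k f p z \<longrightarrow>
      ev p (jets z) (Powr K ?s (fst er)) \<otimes> jets z i = ev p (jets z) (snd er))"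
  proof
    fix i
    obtain e r where "r \<in> Pol (Suc k)" "\<forall>p\<in>P. \<forall>z\<in>carrier K. sep_zero k f p z \<longrightarrow>
      ev p (jets z) (Powr K ?s e) \<otimes> jets z i = ev p (jets z) r"
      using reducible_Jv[OF assms(2), of i] unfolding reducible_def dev.simps by blast
    then show "\<exists>er. snd er \<in> Pol (Suc k) \<and> (\<forall>p\<in>P. \<forall>z\<in>carrier K. sep_zero k f p z \<longrightarrow>
      ev p (jets z) (Powr K ?s (fst er)) \<otimes> jets z i = ev p (jets z) (snd er))"
      by (intro exI[of _ "(e, r)"]) simp
  qed
  from choice[OF this] obtain er where er: "\<forall>i. snd (er i) \<in> Pol (Suc k) \<and>
      (\<forall>p\<in>P. \<forall>z\<in>carrier K. sep_zero k f p z \<longrightarrow>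
      ev p (jets z) (Powr K ?s (fst (er i))) \<otimes> jets z i = ev p (jets z) (snd (er i)))" ..
  define e r where "e i = fst (er i)" and "r i = snd (er i)" for i
  have r: "\<And>i. r i \<in> Pol (Suc k)"
    "\<And>i p z. p \<in> P \<Longrightarrow> z \<in> carrier K \<Longrightarrow> sep_zero k f p z \<Longrightarrow>
      ev p (jets z) (Powr K ?s (e i)) \<otimes> jets z i = ev p (jets z) (r i)"
    using er unfolding e_def r_def by blast+
  define D where "D = {x. range x \<subseteq> carrier K \<and> ev p x ?s \<noteq> \<zero>}"
  \<comment> \<open>By \<open>reducible_Jv\<close>, coordinate \<open>i\<close> at a solution is
    \<open>r i\<close> divided by a power of the separant. Both involve only coordinates up to
    \<open>k\<close>, and the quotient is continuous on \<open>D\<close>.\<close>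
  define \<Phi> where "\<Phi> x i = inv (ev p x (Powr K ?s (e i))) \<otimes> ev p x (r i)" for x i
  have S: "Powr K ?s n \<in> Pol (Suc k)" for n using assms(2) by (intro Powr_Pol pdiff_Pol)
  have openD: "openin \<Omega> D"
    unfolding D_def by (rule openin_nonzero[OF pdiff_Pol[OF assms(2)] assms(3)])
  have pow_nz: "ev p x (Powr K ?s n) \<in> Units K" if "x \<in> D" for x n
    using that dev_Powr[OF pdiff_Pol[OF assms(2)] assms(3), of x k n]
      dev_closed[OF pdiff_Pol[OF assms(2)] assms(3), of x k]
      Units_pow_closed[of "ev p x ?s" n] by (simp add: D_def field_Units)
  have cont: "continuous_map (subtopology \<Omega> D) \<Omega> \<Phi>"
    unfolding continuous_map_componentwise_UNIV \<Phi>_def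
  proof (intro allI continuous_add_mult continuous_inv)
    fix i
    show "continuous_map (subtopology \<Omega> D) \<tau> (\<lambda>x. ev p x (Powr K ?s (e i)))"
      "continuous_map (subtopology \<Omega> D) \<tau> (\<lambda>x. ev p x (r i))"
      by (intro continuous_map_from_subtopology continuous_dev[OF _ assms(3)], rule S r(1))+
    show "ev p x (Powr K ?s (e i)) \<noteq> \<zero>" if "x \<in> topspace (subtopology \<Omega> D)" for x
      using pow_nz[of x "e i"] that by (simp add: field_Units)
  qed
  define U' where "U' = {x \<in> topspace (subtopology \<Omega> D). \<Phi> x \<in> U}"
  have "openin (subtopology \<Omega> D) U'"
    unfolding U'_def by (rule openin_continuous_map_preimage[OF cont assms(4)])
  then have openU': "openin \<Omega> U'" using openin_open_subtopology[OF openD] by blast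
  have \<Phi>_jets: "jets z \<in> D \<and> \<Phi> (jets z) = jets z" if z: "z \<in> carrier K" "sep_zero k f p z" for z
  proof
    show zD: "jets z \<in> D" using z by (auto simp: D_def)
    show "\<Phi> (jets z) = jets z"
    proof
      fix i
      have "\<Phi> (jets z) i = inv (ev p (jets z) (Powr K ?s (e i))) \<otimes>
          (ev p (jets z) (Powr K ?s (e i)) \<otimes> jets z i)"
        unfolding \<Phi>_def r(2)[OF assms(3) z] ..
      also have "\<dots> = (inv (ev p (jets z) (Powr K ?s (e i))) \<otimes> ev p (jets z) (Powr K ?s (e i))) \<otimes> jets z i"
        using pow_nz[OF zD, of "e i"] dseq_closed[OF z(1), of i]
        by (intro m_assoc[symmetric]) (auto intro: Units_closed)
      also have "\<dots> = jets z i"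
        using pow_nz[OF zD, of "e i"] dseq_closed[OF z(1), of i] by simp
      finally show "\<Phi> (jets z) i = jets z i" .
    qed
  qed
  have "\<Phi> (jets y) \<in> U" using \<Phi>_jets[OF assms(5,7)] assms(6) by argo
  moreover have "jets y \<in> topspace \<Omega>"
    unfolding topspace_\<Omega> using range_dseq[OF assms(5)] by blast
  ultimately have "jets y \<in> U'"
    using \<Phi>_jets[OF assms(5,7)] unfolding U'_def topspace_subtopology by blast
  from openin_box[OF openU' this]
  obtain V N where V: "\<And>i. openin \<tau> (V i) \<and> jets y i \<in> V i" "\<And>i. (N::nat) \<le> i \<Longrightarrow> V i = carrier K"
    "{x. \<forall>i. x i \<in> V i} \<subseteq> U'"
    by blast
  have inf: "infinite {z \<in> carrier K. ev p (jets z) f = \<zero> \<and> ev p (jets z) ?s \<noteq> \<zero> \<and> (\<forall>i\<le>k. jets z i \<in> V i)}"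
    (is "infinite ?B")
  proof (rule DL_infinite[OF assms(1,3,2) range_dseq[OF assms(5)]])
    show "openin \<tau> (V i) \<and> jets y i \<in> V i" for i by (rule V(1))
  qed (use assms(7) in blast)+
  have "jets z \<in> U" if z: "z \<in> carrier K" "sep_zero k f p z" "\<forall>i\<le>k. jets z i \<in> V i" for z
  proof -
    \<comment> \<open>(DL) says nothing about the tail of \<open>jets z\<close>, so the tail of
      \<open>jets y\<close> is used to stay in the box; \<open>\<Phi>\<close> does not see the
      difference.\<close>
    define x where "x i = (if i \<le> k then jets z i else jets y i)" for i
    have "x i \<in> V i" for i using V(1)[of i] z(3) by (simp add: x_def)
    then have "x \<in> U'" using V(3) by blast
    moreover have "\<Phi> x = \<Phi> (jets z)"
    proof
      fix i
      have "ev p x h = ev p (jets z) h" if "h \<in> Pol (Suc k)" for h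
        by (rule dev_cong[OF that]) (auto simp: x_def)
      then show "\<Phi> x i = \<Phi> (jets z) i" using S r(1) by (simp add: \<Phi>_def)
    qed
    ultimately have "\<Phi> (jets z) \<in> U" unfolding U'_def by simp
    then show ?thesis using \<Phi>_jets[OF z(1,2)] by argo
  qed
  then have "?B \<subseteq> {z \<in> carrier K. jets z \<in> U \<and> sep_zero k f p z}" by blast
  from infinite_super[OF this inf] show ?thesis .
qed

text \<open>The auxiliary equation \<open>X^(N+1) = 0\<close> makes (DL) applicable: its separant is
  one, its order is positive, and the box leaves coordinate \<open>N + 1\<close> free, so that entry
  may be set to zero.\<close>

lemma infinite_open:
  assumes "p \<in> P" "openin \<Omega> U" "y \<in> carrier K" "jets y \<in> U"
  shows "infinite {z \<in> carrier K. jets z \<in> U}"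
proof -
  obtain V N where V: "\<And>i. openin \<tau> (V i) \<and> jets y i \<in> V i" "\<And>i. N \<le> i \<Longrightarrow> V i = carrier K"
    "{x. \<forall>i. x i \<in> V i} \<subseteq> U"
    using openin_box[OF assms(2,4)] by blast
  let ?a = "(jets y)(Suc N := \<zero>)" and ?f = "Jv (Suc N)"
  have a: "range ?a \<subseteq> carrier K" using dseq_closed[OF assms(3)] by (simp add: image_subset_iff)
  have "openin \<tau> (V i) \<and> ?a i \<in> V i" for i
    using V(1)[of i] V(2)[of "Suc N"] by (cases "i = Suc N") simp_all
  then have inf: "infinite {z \<in> carrier K. ev p (jets z) ?f = \<zero> \<and> ev p (jets z) (pdiff K (Suc N) ?f) \<noteq> \<zero> \<and>
     (\<forall>i\<le>Suc N. jets z i \<in> V i)}" (is "infinite ?B")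
    by (intro DL_infinite[OF _ assms(1) _ a]) auto
  have "jets z \<in> U" if "z \<in> carrier K" "\<forall>i\<le>Suc N. jets z i \<in> V i" for z
  proof -
    have "jets z i \<in> V i" for i
      using that V(2)[of i] dseq_closed[OF that(1), of i] by (cases "i \<le> Suc N") simp_all
    then show ?thesis using V(3) by blast
  qed
  then have "?B \<subseteq> {z \<in> carrier K. jets z \<in> U}" by blast
  from infinite_super[OF this inf] show ?thesis .
qed

section \<open>The base of the induction on the order\<close>

lemma root_bound:
  assumes cs: "set cs \<subseteq> Pol 0" and p: "p \<in> P"
  shows "finite {y \<in> carrier K. sep_zero 0 (hr 0 cs) p y} \<and>
    card {y \<in> carrier K. sep_zero 0 (hr 0 cs) p y} \<le> length cs"
proof -
  let ?A = "{y \<in> carrier K. sep_zero 0 (hr 0 cs) p y}"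
  define vs where "vs = map (\<lambda>c. ev p (\<lambda>_. \<zero>) c) cs"
  have z: "range (\<lambda>_::nat. \<zero>) \<subseteq> carrier K" by auto
  have const: "ev p x c = ev p (\<lambda>_. \<zero>) c" if "c \<in> Pol 0" for x c
    by (rule dev_cong[OF that]) simp
  have vs: "set vs \<subseteq> carrier K" using cs p z by (auto simp: vs_def intro!: dev_closed[of _ 0])
  have ev_vs: "ev p (jets y) (hr 0 cs) = ring.eval K vs y" if "y \<in> carrier K" for y
    using cs unfolding vs_def
  proof (induction cs)
    case (Cons c cs)
    then show ?case using const[of c "jets y"] dev_horner_Cons[OF p range_dseq[OF that], of 0 c cs]
      by (simp del: horner.simps)
  qed simp
  show ?thesis
  proof (cases "normalize vs = []")
    \<comment> \<open>All coefficients vanish at this parameter; then so does the separant, and no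
      \<open>y\<close> qualifies.\<close>
    case True
    have "normalize us = [] \<Longrightarrow> set us \<subseteq> {\<zero>}" for us
      by (induction us) (auto split: if_splits)
    from this[OF True] have "set vs \<subseteq> {\<zero>}" .
    then have zero: "ev p x c = \<zero>" if "c \<in> set cs" for x c
      using that cs const[of c x] by (auto simp: vs_def)
    have "ev p (jets y) (pdiff K 0 (hr 0 cs)) = \<zero>" if y: "y \<in> carrier K" for y
    proof -
      have "ev p (jets y) (hr 0 (pdiff_coeffs K ds)) = \<zero>" if "set ds \<subseteq> set cs" for ds
        using that
      proof (induction ds)
        case (Cons d ds)
        then show ?case
          using zero[of d "jets y"] dev_horner_Cons[OF p range_dseq[OF y]] dev_nscale[of d 0 p "jets y"] p y cs
          by (auto simp del: horner.simps(2))
      qed simp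
      then show ?thesis using dev_pdiff_horner[OF cs p range_dseq[OF y]] by simp
    qed
    then have e: "?A = {}" by blast
    show ?thesis unfolding e by simp
  next
    case False
    have car: "normalize vs \<in> carrier (poly_ring K)"
      using normalize_gives_polynomial[OF vs] univ_poly_carrier by blast
    have sub: "?A \<subseteq> set_mset (roots (normalize vs))"
    proof
      fix y assume "y \<in> ?A"
      then have "is_root (normalize vs) y"
        using ev_vs[of y] eval_normalize[OF vs, of y] False by (auto simp: is_root_def)
      then show "y \<in> set_mset (roots (normalize vs))" using roots_mem_iff_is_root[OF car] by blast
    qed
    have "card (set_mset A) \<le> size A" for A :: "'u multiset"
      by (induction A) (auto simp: card_insert_if)
    then have "card (set_mset (roots (normalize vs))) \<le> size (roots (normalize vs))" .
    also have "\<dots> \<le> length vs"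
      using size_roots_le_degree[OF car] normalize_length_le[of vs] by linarith
    finally show ?thesis
      using sub card_mono[OF finite_set_mset sub] finite_subset[OF sub] by (simp add: vs_def)
  qed
qed

text \<open>Equations in \<open>Pol 0\<close> do not involve \<open>y\<close>: they hold for every
  \<open>y\<close> or for none. For \<open>k = 0\<close> the roots are counted; for
  \<open>k > 0\<close> one solution already entails infinitely many.\<close>

lemma good_sep_zero_base:
  assumes cs: "set cs \<subseteq> Pol k"
  shows "good 0 (sep_zero k (hr k cs))"
  unfolding good_def unif_bounded_def
proof (intro allI impI exI ballI)
  fix F p U assume F: "finite F \<and> F \<subseteq> Pol 0" and p: "p \<in> P" and U: "openin \<Omega> U"
  let ?A = "{y \<in> carrier K. jets y \<in> U \<and> sep_zero k (hr k cs) p y \<and> (\<forall>f\<in>F. ev p (jets y) f = \<zero>)}"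
  show "infinite ?A \<or> card ?A \<le> length cs"
  proof (cases "?A = {}")
    case True
    show ?thesis unfolding True by simp
  next
    case False
    then obtain y where y: "y \<in> ?A" by blast
    show ?thesis
    proof (cases "k = 0")
      case True
      have "?A \<subseteq> {y \<in> carrier K. sep_zero 0 (hr 0 cs) p y}" using True by auto
      then show ?thesis using root_bound[of cs p] p cs True by (meson card_mono le_trans)
    next
      case False
      have "ev p (jets z) f = \<zero>" if "f \<in> F" for f z
        using dev_cong[of f K P 0 "jets z" "jets y" p] F y that by auto
      then have "?A = {z \<in> carrier K. jets z \<in> U \<and> sep_zero k (hr k cs) p z}" by auto
      then show ?thesis
        using infinite_sep_zero[OF _ horner_Pol[OF cs] p U, of y] False y by auto
    qed
  qed
qed

lemma good_True_base: "good 0 (\<lambda>p y. True)"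
  unfolding good_def unif_bounded_def
proof (intro allI impI exI ballI)
  fix F p U assume F: "finite F \<and> F \<subseteq> Pol 0" and p: "p \<in> P" and U: "openin \<Omega> U"
  let ?A = "{y \<in> carrier K. jets y \<in> U \<and> True \<and> (\<forall>f\<in>F. ev p (jets y) f = \<zero>)}"
  show "infinite ?A \<or> card ?A \<le> 0"
  proof (cases "?A = {}")
    case True
    show ?thesis unfolding True by simp
  next
    case False
    then obtain y where y: "y \<in> ?A" by blast
    have "ev p (jets z) f = \<zero>" if "f \<in> F" for f z
      using dev_cong[of f K P 0 "jets z" "jets y" p] F y that by auto
    then have "?A = {z \<in> carrier K. jets z \<in> U}" by auto
    then show ?thesis using infinite_open[OF p U, of y] y by auto
  qed
qed

section \<open>The induction on the order\<close>

lemma good_sep_lower: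
  assumes "good (Suc j) (\<lambda>p y. True)" "f \<in> Pol n"
  shows "good_sep j (sep_zero k f)"
  unfolding good_sep_def
proof (intro allI impI)
  fix cs assume cs: "set cs \<subseteq> Pol j"
  let ?g = "hr j cs" and ?s = "pdiff K k f"
  have g: "?g \<in> Pol (Suc j)" by (rule horner_Pol[OF cs])
  have red: "\<exists>e. \<exists>r\<in>Pol (Suc j). \<forall>p\<in>P. \<forall>y\<in>carrier K. sep_zero j ?g p y \<longrightarrow>
       ev p (jets y) (Powr K (pdiff K j ?g) e) \<otimes> ev p (jets y) h = ev p (jets y) r"
    if "h \<in> Pol n" for h
    using reducible_all[OF g that] unfolding reducible_def .
  have zero_iff: "ev p (jets y) r = \<zero> \<longleftrightarrow> ev p (jets y) h = \<zero>"
    if "h \<in> Pol n" "p \<in> P" "y \<in> carrier K" "sep_zero j ?g p y"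
      "ev p (jets y) (Powr K (pdiff K j ?g) e) \<otimes> ev p (jets y) h = ev p (jets y) r" for h r e p y
  proof -
    have "ev p (jets y) (Powr K (pdiff K j ?g) e) \<noteq> \<zero>"
      using that(4) dev_Powr[OF pdiff_Pol[OF g] that(2) range_dseq[OF that(3)], of j e]
        dev_closed[OF pdiff_Pol[OF g] that(2) range_dseq[OF that(3)], of j]
        Units_pow_closed[of "ev p (jets y) (pdiff K j ?g)" e] by (simp add: field_Units)
    moreover have "ev p (jets y) (Powr K (pdiff K j ?g) e) \<in> carrier K"
      by (rule dev_closed[OF Powr_Pol[OF pdiff_Pol[OF g]] that(2) range_dseq[OF that(3)]])
    ultimately show ?thesis
      using that(5) dev_closed[OF that(1,2) range_dseq[OF that(3)]] by (metis integral_iff)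
  qed
  obtain e r where r: "r \<in> Pol (Suc j)" "\<forall>p\<in>P. \<forall>y\<in>carrier K. sep_zero j ?g p y \<longrightarrow>
       ev p (jets y) (Powr K (pdiff K j ?g) e) \<otimes> ev p (jets y) f = ev p (jets y) r"
    using red[OF assms(2)] by blast
  obtain e' r' where r': "r' \<in> Pol (Suc j)" "\<forall>p\<in>P. \<forall>y\<in>carrier K. sep_zero j ?g p y \<longrightarrow>
       ev p (jets y) (Powr K (pdiff K j ?g) e') \<otimes> ev p (jets y) ?s = ev p (jets y) r'"
    using red[OF pdiff_Pol[OF assms(2)]] by blast
  \<comment> \<open>Modulo \<open>g\<close>, the equation \<open>f = 0\<close> and its separant
    condition become \<open>r = 0\<close> and \<open>r' \<noteq> 0\<close>, both of order at most
    \<open>j\<close>. The whole system then has order at most \<open>j\<close> and the first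
    assumption covers it.\<close>
  have "good (Suc j) (\<lambda>p y. (((True \<and> ev p (jets y) ?g = \<zero>) \<and> ev p (jets y) (pdiff K j ?g) \<noteq> \<zero>) \<and>
      ev p (jets y) r = \<zero>) \<and> ev p (jets y) r' \<noteq> \<zero>)"
    by (intro good_zero good_nonzero[OF _ pdiff_Pol[OF g]] good_nonzero[OF _ r'(1)] assms(1) g r(1))
  then have "good (Suc j) (\<lambda>p y. sep_zero k f p y \<and> ev p (jets y) ?g = \<zero> \<and> ev p (jets y) (pdiff K j ?g) \<noteq> \<zero>)"
  proof (rule good_cong)
    fix p y assume py: "p \<in> P" "y \<in> carrier K"
    have "ev p (jets y) r = \<zero> \<longleftrightarrow> ev p (jets y) f = \<zero>" "ev p (jets y) r' = \<zero> \<longleftrightarrow> ev p (jets y) ?s = \<zero>"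
      if "sep_zero j ?g p y"
      using zero_iff[OF assms(2) py that] zero_iff[OF pdiff_Pol[OF assms(2)] py that] r(2) r'(2) py that
      by blast+
    then show "sep_zero k f p y \<and> ev p (jets y) ?g = \<zero> \<and> ev p (jets y) (pdiff K j ?g) \<noteq> \<zero> \<longleftrightarrow>
      (((True \<and> ev p (jets y) ?g = \<zero>) \<and> ev p (jets y) (pdiff K j ?g) \<noteq> \<zero>) \<and>
      ev p (jets y) r = \<zero>) \<and> ev p (jets y) r' \<noteq> \<zero>" by blast
  qed
  then show "good j (\<lambda>p y. sep_zero k f p y \<and> ev p (jets y) ?g = \<zero> \<and> ev p (jets y) (pdiff K j ?g) \<noteq> \<zero>)"
    by (rule good_mono) simp
qed

theorem good_True: "good k (\<lambda>p y. True)"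
proof (induction k rule: less_induct)
  case (less k)
  show ?case
  proof (cases k)
    case 0 then show ?thesis using good_True_base by simp
  next
    case (Suc n)
    have "good_sep n (\<lambda>p y. True)"
      unfolding good_sep_def
    proof (intro allI impI)
      fix cs assume cs: "set cs \<subseteq> Pol n"
      have "good j (sep_zero n (hr n cs))" if "j \<le> n" for j
        using that
      proof (induction j)
        case 0 show ?case by (rule good_sep_zero_base[OF cs])
      next
        case (Suc j)
        then have "good (Suc j) (\<lambda>p y. True)" using less \<open>k = Suc n\<close> by simp
        moreover have "good j (sep_zero n (hr n cs))" using Suc by simp
        ultimately show ?case by (rule elimination[OF _ good_sep_lower[OF _ horner_Pol[OF cs]], rotated])
      qed
      then show "good n (\<lambda>p y. True \<and> sep_zero n (hr n cs) p y)" by simp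
    qed
    then show ?thesis using elimination[of n] less Suc by simp
  qed
qed

end

section \<open>Locally closed conditions and piecewise rational functions\<close>

context diff_top_field
begin

text \<open>Finite unions of locally closed conditions on jets. Complements are not built in, as the
  complement of an arbitrary open set need not be of this form; negations have to be treated by
  hand.\<close>

inductive lc :: "('p \<Rightarrow> 'u \<Rightarrow> bool) \<Rightarrow> bool" where
  opn: "(\<And>p. p \<in> P \<Longrightarrow> openin \<Omega> (U p)) \<Longrightarrow> lc (\<lambda>p y. jets y \<in> U p)"
| zero: "f \<in> Pol k \<Longrightarrow> lc (\<lambda>p y. ev p (jets y) f = \<zero>)"
| conj: "lc Q \<Longrightarrow> lc R \<Longrightarrow> lc (\<lambda>p y. Q p y \<and> R p y)"
| disj: "lc Q \<Longrightarrow> lc R \<Longrightarrow> lc (\<lambda>p y. Q p y \<or> R p y)"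
| equiv: "lc Q \<Longrightarrow> (\<And>p y. p \<in> P \<Longrightarrow> y \<in> carrier K \<Longrightarrow> R p y \<longleftrightarrow> Q p y) \<Longrightarrow> lc R"

text \<open>The condition \<open>C\<close> is arbitrary so that in a conjunction the first part can
  be absorbed into it. It must be good at every order because an equation in \<open>Q\<close> may
  have order above \<open>k\<close>.\<close>

lemma good_lc: "lc Q \<Longrightarrow> (\<And>k. good k C) \<Longrightarrow> good k (\<lambda>p y. C p y \<and> Q p y)"
proof (induction arbitrary: C k rule: lc.induct)
  case (opn U) then show ?case by (intro good_open)
next
  case (zero f m)
  have "good (max k m) (\<lambda>p y. C p y \<and> ev p (jets y) f = \<zero>)"
    using zero by (intro good_zero dpols_mono[OF zero.hyps]) auto
  then show ?case by (rule good_mono) simp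
next
  case (conj Q R)
  have "good k (\<lambda>p y. (C p y \<and> Q p y) \<and> R p y)" by (intro conj.IH conj.prems)
  then show ?case by (rule good_cong) blast
next
  case (disj Q R)
  have "good k (\<lambda>p y. (C p y \<and> Q p y) \<or> (C p y \<and> R p y))"
    by (intro good_disj disj.IH disj.prems)
  then show ?case by (rule good_cong) blast
next
  case (equiv Q R)
  have "good k (\<lambda>p y. C p y \<and> Q p y)" by (intro equiv.IH equiv.prems)
  then show ?case by (rule good_cong) (simp add: equiv.hyps)
qed

lemma lc_bounded:
  assumes "lc Q"
  shows "\<exists>N. \<forall>p\<in>P. infinite {y \<in> carrier K. Q p y} \<or> card {y \<in> carrier K. Q p y} \<le> N"
proof -
  have "unif_bounded (\<lambda>p y. True \<and> Q p y)"
    by (rule good_unif_bounded[of 0, OF good_lc[OF assms good_True]])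
  then obtain N where N: "\<And>p. p \<in> P \<Longrightarrow>
     infinite {y \<in> carrier K. jets y \<in> topspace \<Omega> \<and> True \<and> Q p y} \<or>
     card {y \<in> carrier K. jets y \<in> topspace \<Omega> \<and> True \<and> Q p y} \<le> N"
    unfolding unif_bounded_def using openin_topspace by blast
  have "{y \<in> carrier K. jets y \<in> topspace \<Omega> \<and> True \<and> Q p y} = {y \<in> carrier K. Q p y}" for p
    unfolding topspace_\<Omega> using range_dseq by blast
  with N show ?thesis by auto
qed

lemma dseq_topspace: "y \<in> carrier K \<Longrightarrow> jets y \<in> topspace \<Omega>"
  unfolding topspace_\<Omega> using range_dseq by blast

lemma lc_True: "lc (\<lambda>p y. True)"
  by (rule lc.equiv[OF lc.opn[of "\<lambda>_. topspace \<Omega>", OF openin_topspace]]) (use dseq_topspace in blast)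

lemma lc_False: "lc (\<lambda>p y. False)"
  using lc.opn[of "\<lambda>_. {}"] by (rule lc.equiv) auto

lemma lc_nonzero:
  assumes "f \<in> Pol k"
  shows "lc (\<lambda>p y. ev p (jets y) f \<noteq> \<zero>)"
  using lc.opn[OF openin_nonzero[OF assms]] by (rule lc.equiv) auto

lemma lc_Bex: "finite J \<Longrightarrow> (\<And>j. j \<in> J \<Longrightarrow> lc (Q j)) \<Longrightarrow> lc (\<lambda>p y. \<exists>j\<in>J. Q j p y)"
proof (induction rule: finite_induct)
  case (insert j J)
  then have "lc (\<lambda>p y. Q j p y \<or> (\<exists>j\<in>J. Q j p y))" by (intro lc.disj) auto
  then show ?case by (rule lc.equiv) auto
qed (simp add: lc_False)

lemma lc_Ball: "finite J \<Longrightarrow> (\<And>j. j \<in> J \<Longrightarrow> lc (Q j)) \<Longrightarrow> lc (\<lambda>p y. \<forall>j\<in>J. Q j p y)"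
proof (induction rule: finite_induct)
  case (insert j J)
  then have "lc (\<lambda>p y. Q j p y \<and> (\<forall>j\<in>J. Q j p y))" by (intro lc.conj) auto
  then show ?case by (rule lc.equiv) auto
qed (simp add: lc_True)

section \<open>Finite covers by locally closed pieces, possibly overlapping\<close>

definition piecewise :: "(('p \<Rightarrow> 'u \<Rightarrow> bool) \<Rightarrow> bool) \<Rightarrow> bool" where
  "piecewise \<Phi> \<longleftrightarrow> (\<exists>J. finite J \<and> (\<forall>Q\<in>J. lc Q \<and> \<Phi> Q) \<and> (\<forall>p\<in>P. \<forall>y\<in>carrier K. \<exists>Q\<in>J. Q p y))"

lemma piecewise_single: "\<Phi> (\<lambda>p y. True) \<Longrightarrow> piecewise \<Phi>"
  unfolding piecewise_def by (intro exI[of _ "{\<lambda>p y. True}"]) (simp add: lc_True)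

lemma piecewise_combine:
  assumes "piecewise \<Phi>" "piecewise \<Psi>"
    and "\<And>Q R. \<Phi> Q \<Longrightarrow> \<Psi> R \<Longrightarrow> \<Theta> (\<lambda>p y. Q p y \<and> R p y)"
  shows "piecewise \<Theta>"
proof -
  obtain J where J: "finite J" "\<forall>Q\<in>J. lc Q \<and> \<Phi> Q" "\<forall>p\<in>P. \<forall>y\<in>carrier K. \<exists>Q\<in>J. Q p y"
    using assms(1) unfolding piecewise_def by blast
  obtain I where I: "finite I" "\<forall>Q\<in>I. lc Q \<and> \<Psi> Q" "\<forall>p\<in>P. \<forall>y\<in>carrier K. \<exists>Q\<in>I. Q p y"
    using assms(2) unfolding piecewise_def by blast
  let ?H = "(\<lambda>(Q, R) p y. Q p y \<and> R p y) ` (J \<times> I)"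
  show ?thesis
    unfolding piecewise_def
  proof (intro exI[of _ ?H] conjI ballI)
    show "finite ?H" using J I by blast
    fix Q assume "Q \<in> ?H"
    then obtain Q1 Q2 where Q: "Q1 \<in> J" "Q2 \<in> I" "Q = (\<lambda>p y. Q1 p y \<and> Q2 p y)" by auto
    show "lc Q" unfolding Q(3) using Q J I by (intro lc.conj) auto
    show "\<Theta> Q" unfolding Q(3) using Q J I assms(3) by blast
  next
    fix p y assume py: "p \<in> P" "y \<in> carrier K"
    obtain Q1 Q2 where "Q1 \<in> J" "Q2 \<in> I" "Q1 p y" "Q2 p y" using J(3) I(3) py by blast
    then show "\<exists>Q\<in>?H. Q p y" by (intro bexI[of _ "\<lambda>p y. Q1 p y \<and> Q2 p y"]) auto
  qed
qed

lemma piecewise_mono: "piecewise \<Phi> \<Longrightarrow> (\<And>Q. \<Phi> Q \<Longrightarrow> \<Psi> Q) \<Longrightarrow> piecewise \<Psi>"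
  unfolding piecewise_def by blast

lemma lc_piecewise:
  assumes "piecewise (\<lambda>Q. lc Q \<longrightarrow> lc (\<lambda>p y. Q p y \<and> R p y))"
  shows "lc R"
proof -
  obtain J where J: "finite J" "\<forall>Q\<in>J. lc Q \<and> (lc Q \<longrightarrow> lc (\<lambda>p y. Q p y \<and> R p y))"
    "\<forall>p\<in>P. \<forall>y\<in>carrier K. \<exists>Q\<in>J. Q p y"
    using assms unfolding piecewise_def by blast
  have "lc (\<lambda>p y. \<exists>Q\<in>J. Q p y \<and> R p y)" using J by (intro lc_Bex) auto
  then show ?thesis
  proof (rule lc.equiv)
    fix p y assume "p \<in> P" "y \<in> carrier K"
    then obtain Q where "Q \<in> J" "Q p y" using J(3) by blast
    then show "R p y \<longleftrightarrow> (\<exists>Q\<in>J. Q p y \<and> R p y)" by blast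
  qed
qed

section \<open>Piecewise rational functions of the jet\<close>

definition frac_on :: "('p \<Rightarrow> 'u \<Rightarrow> bool) \<Rightarrow> ('p \<Rightarrow> 'u \<Rightarrow> 'u) \<Rightarrow> ('p, 'u) dpol \<Rightarrow> ('p, 'u) dpol \<Rightarrow> bool" where
  "frac_on Q t f g \<longleftrightarrow> (\<exists>k. f \<in> Pol k \<and> g \<in> Pol k) \<and>
     (\<forall>p\<in>P. \<forall>y\<in>carrier K. Q p y \<longrightarrow>
        t p y \<in> carrier K \<and> ev p (jets y) g \<noteq> \<zero> \<and> t p y \<otimes> ev p (jets y) g = ev p (jets y) f)"

definition pw_rational :: "('p \<Rightarrow> 'u \<Rightarrow> 'u) \<Rightarrow> bool" where
  "pw_rational t \<longleftrightarrow> piecewise (\<lambda>Q. \<exists>f g. frac_on Q t f g)"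

lemma frac_onI:
  assumes "f \<in> Pol k" "g \<in> Pol k"
    and "\<And>p y. p \<in> P \<Longrightarrow> y \<in> carrier K \<Longrightarrow> Q p y \<Longrightarrow>
      t p y \<in> carrier K \<and> ev p (jets y) g \<noteq> \<zero> \<and> t p y \<otimes> ev p (jets y) g = ev p (jets y) f"
  shows "frac_on Q t f g"
  using assms unfolding frac_on_def by blast

lemma frac_onD:
  assumes "frac_on Q t f g"
  shows "\<exists>k. f \<in> Pol k \<and> g \<in> Pol k \<and> (\<forall>p\<in>P. \<forall>y\<in>carrier K. Q p y \<longrightarrow>
      t p y \<in> carrier K \<and> ev p (jets y) g \<noteq> \<zero> \<and> t p y \<otimes> ev p (jets y) g = ev p (jets y) f \<and>
      ev p (jets y) g \<in> carrier K \<and> ev p (jets y) f \<in> carrier K)"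
proof -
  obtain k where k: "f \<in> Pol k" "g \<in> Pol k" using assms unfolding frac_on_def by blast
  show ?thesis
    by (rule exI[of _ k])
      (use k assms dev_closed[OF k(1)] dev_closed[OF k(2)] in \<open>simp add: frac_on_def\<close>)
qed

lemma frac_on_mono: "frac_on Q t f g \<Longrightarrow> (\<And>p y. R p y \<Longrightarrow> Q p y) \<Longrightarrow> frac_on R t f g"
  unfolding frac_on_def by blast

lemma pw_rational_pol:
  assumes "f \<in> Pol k" "\<And>p y. p \<in> P \<Longrightarrow> y \<in> carrier K \<Longrightarrow> t p y = ev p (jets y) f"
  shows "pw_rational t"
  unfolding pw_rational_def
proof (intro piecewise_single exI)
  show "frac_on (\<lambda>p y. True) t f (Cst (\<lambda>_. \<one>))"
    by (rule frac_onI[OF assms(1)]) (use assms dev_closed[OF assms(1)] in auto)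
qed

lemma pw_rational_const: "c \<in> P \<rightarrow> carrier K \<Longrightarrow> pw_rational (\<lambda>p y. c p)"
  by (rule pw_rational_pol[of "Cst c" 0]) (auto intro: dpols.Cst)

lemma pw_rational_id: "pw_rational (\<lambda>p y. y)"
  by (rule pw_rational_pol[of "Jv 0" 1]) auto

lemma pw_rational_add_mult:
  assumes "pw_rational s" "pw_rational t"
  shows "pw_rational (\<lambda>p y. s p y \<oplus> t p y)" "pw_rational (\<lambda>p y. s p y \<otimes> t p y)"
proof -
  have "(\<exists>f g. frac_on (\<lambda>p y. Q p y \<and> R p y) (\<lambda>p y. s p y \<oplus> t p y) f g) \<and>
      (\<exists>f g. frac_on (\<lambda>p y. Q p y \<and> R p y) (\<lambda>p y. s p y \<otimes> t p y) f g)"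
    if Q: "\<exists>f g. frac_on Q s f g" and R: "\<exists>f g. frac_on R t f g" for Q R
  proof -
    obtain f g where fg: "frac_on Q s f g" using Q by blast
    obtain f' g' where fg': "frac_on R t f' g'" using R by blast
    obtain k where k: "f \<in> Pol k" "g \<in> Pol k" "\<And>p y. p \<in> P \<Longrightarrow> y \<in> carrier K \<Longrightarrow> Q p y \<Longrightarrow>
      s p y \<in> carrier K \<and> ev p (jets y) g \<noteq> \<zero> \<and> s p y \<otimes> ev p (jets y) g = ev p (jets y) f \<and>
      ev p (jets y) g \<in> carrier K \<and> ev p (jets y) f \<in> carrier K"
      using frac_onD[OF fg] by blast
    obtain k' where k': "f' \<in> Pol k'" "g' \<in> Pol k'" "\<And>p y. p \<in> P \<Longrightarrow> y \<in> carrier K \<Longrightarrow> R p y \<Longrightarrow>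
      t p y \<in> carrier K \<and> ev p (jets y) g' \<noteq> \<zero> \<and> t p y \<otimes> ev p (jets y) g' = ev p (jets y) f' \<and>
      ev p (jets y) g' \<in> carrier K \<and> ev p (jets y) f' \<in> carrier K"
      using frac_onD[OF fg'] by blast
    let ?k = "max k k'"
    have Pol: "f \<in> Pol ?k" "g \<in> Pol ?k" "f' \<in> Pol ?k" "g' \<in> Pol ?k"
      using k k' by (auto intro: dpols_mono)
    have "frac_on (\<lambda>p y. Q p y \<and> R p y) (\<lambda>p y. s p y \<oplus> t p y)
       (Plus (Times f g') (Times f' g)) (Times g g')"
    proof (rule frac_onI[of _ ?k])
      fix p y assume py: "p \<in> P" "y \<in> carrier K" and "Q p y \<and> R p y"
      then have 1: "s p y \<in> carrier K" "ev p (jets y) g \<noteq> \<zero>" "ev p (jets y) f = s p y \<otimes> ev p (jets y) g"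
        "ev p (jets y) g \<in> carrier K" "t p y \<in> carrier K" "ev p (jets y) g' \<noteq> \<zero>"
        "ev p (jets y) f' = t p y \<otimes> ev p (jets y) g'" "ev p (jets y) g' \<in> carrier K"
        using k(3)[OF py] k'(3)[OF py] by simp_all
      then show "s p y \<oplus> t p y \<in> carrier K \<and> ev p (jets y) (Times g g') \<noteq> \<zero> \<and>
         (s p y \<oplus> t p y) \<otimes> ev p (jets y) (Times g g') =
         ev p (jets y) (Plus (Times f g') (Times f' g))"
        by (simp add: integral_iff l_distr r_distr m_ac)
    qed (use Pol in simp_all)
    moreover have "frac_on (\<lambda>p y. Q p y \<and> R p y) (\<lambda>p y. s p y \<otimes> t p y) (Times f f') (Times g g')"
    proof (rule frac_onI[of _ ?k])
      fix p y assume py: "p \<in> P" "y \<in> carrier K" and "Q p y \<and> R p y"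
      then have 1: "s p y \<in> carrier K" "ev p (jets y) g \<noteq> \<zero>" "ev p (jets y) f = s p y \<otimes> ev p (jets y) g"
        "ev p (jets y) g \<in> carrier K" "t p y \<in> carrier K" "ev p (jets y) g' \<noteq> \<zero>"
        "ev p (jets y) f' = t p y \<otimes> ev p (jets y) g'" "ev p (jets y) g' \<in> carrier K"
        using k(3)[OF py] k'(3)[OF py] by simp_all
      then show "s p y \<otimes> t p y \<in> carrier K \<and> ev p (jets y) (Times g g') \<noteq> \<zero> \<and>
         (s p y \<otimes> t p y) \<otimes> ev p (jets y) (Times g g') = ev p (jets y) (Times f f')"
        by (simp add: integral_iff m_ac)
    qed (use Pol in simp_all)
    ultimately show ?thesis by blast
  qed
  then show "pw_rational (\<lambda>p y. s p y \<oplus> t p y)" "pw_rational (\<lambda>p y. s p y \<otimes> t p y)"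
    using assms unfolding pw_rational_def
    by (blast intro: piecewise_combine)+
qed

lemma pw_rational_cong:
  assumes "pw_rational s" "\<And>p y. p \<in> P \<Longrightarrow> y \<in> carrier K \<Longrightarrow> t p y = s p y"
  shows "pw_rational t"
  using assms(1) unfolding pw_rational_def
proof (rule piecewise_mono)
  fix Q assume "\<exists>f g. frac_on Q s f g"
  then obtain f g where "frac_on Q s f g" by blast
  then have "frac_on Q t f g" using assms(2) unfolding frac_on_def by simp
  then show "\<exists>f g. frac_on Q t f g" by blast
qed

lemma pw_rational_closed:
  assumes "pw_rational t" "p \<in> P" "y \<in> carrier K"
  shows "t p y \<in> carrier K"
proof -
  obtain Q where "Q p y" "\<exists>f g. frac_on Q t f g"
    using assms unfolding pw_rational_def piecewise_def by blast
  then show ?thesis using assms(2,3) unfolding frac_on_def by blast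
qed

lemma pw_rational_minus:
  assumes "pw_rational t"
  shows "pw_rational (\<lambda>p y. \<ominus> t p y)"
  by (rule pw_rational_cong[OF pw_rational_add_mult(2)[OF pw_rational_const[of "\<lambda>_. \<ominus> \<one>"] assms]])
    (use pw_rational_closed[OF assms] in \<open>auto simp: l_minus\<close>)

text \<open>The quotient rule without division: differentiating \<open>t g = f\<close> and
  multiplying by \<open>g\<close> gives \<open>t' g^2 = f' g - f g'\<close>.\<close>

lemma pw_rational_der:
  assumes "pw_rational t"
  shows "pw_rational (\<lambda>p y. der K (t p y))"
  using assms unfolding pw_rational_def
proof (rule piecewise_mono)
  fix Q assume "\<exists>f g. frac_on Q t f g"
  then obtain f g where fg: "frac_on Q t f g" by blast
  obtain k where k: "f \<in> Pol k" "g \<in> Pol k" "\<And>p y. p \<in> P \<Longrightarrow> y \<in> carrier K \<Longrightarrow> Q p y \<Longrightarrow>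
      t p y \<in> carrier K \<and> ev p (jets y) g \<noteq> \<zero> \<and> t p y \<otimes> ev p (jets y) g = ev p (jets y) f \<and>
      ev p (jets y) g \<in> carrier K \<and> ev p (jets y) f \<in> carrier K"
    using frac_onD[OF fg] by blast
  let ?f = "Plus (Times (tdiff K f) g) (Times (Cst (\<lambda>_. \<ominus> \<one>)) (Times f (tdiff K g)))"
  have Pol: "f \<in> Pol (Suc k)" "g \<in> Pol (Suc k)" "tdiff K f \<in> Pol (Suc k)" "tdiff K g \<in> Pol (Suc k)"
    using k(1,2) by (auto intro: dpols_mono tdiff_Pol)
  have "frac_on Q (\<lambda>p y. der K (t p y)) ?f (Times g g)"
  proof (rule frac_onI[of _ "Suc k"])
    fix p y assume py: "p \<in> P" "y \<in> carrier K" and Q: "Q p y"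
    let ?t = "t p y" and ?F = "ev p (jets y) f" and ?G = "ev p (jets y) g"
    let ?F' = "ev p (jets y) (tdiff K f)" and ?G' = "ev p (jets y) (tdiff K g)"
    have 1: "?t \<in> carrier K" "?G \<noteq> \<zero>" "?F = ?t \<otimes> ?G" "?G \<in> carrier K" "?F \<in> carrier K"
      using k(3)[OF py Q] by simp_all
    have 2: "?F' \<in> carrier K" "?G' \<in> carrier K" "der K ?t \<in> carrier K"
      using py 1 Pol by (auto intro: dev_closed)
    have "?F' = der K (?t \<otimes> ?G)" using der_dev[OF k(1) py] 1(3) by simp
    then have F': "?F' = der K ?t \<otimes> ?G \<oplus> ?t \<otimes> ?G'" using 1 der_dev[OF k(2) py] by (simp add: der_mult)
    have "ev p (jets y) ?f = (der K ?t \<otimes> (?G \<otimes> ?G) \<oplus> ?t \<otimes> ?G' \<otimes> ?G) \<oplus> \<ominus> (?t \<otimes> ?G' \<otimes> ?G)"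
      unfolding dev.simps F' 1(3) using 1(1,4) 2 by (simp add: l_distr r_distr l_minus r_minus m_ac)
    also have "\<dots> = der K ?t \<otimes> (?G \<otimes> ?G)" using 1(1,4) 2 by (simp add: a_assoc r_neg)
    finally show "der K ?t \<in> carrier K \<and> ev p (jets y) (Times g g) \<noteq> \<zero> \<and>
        der K ?t \<otimes> ev p (jets y) (Times g g) = ev p (jets y) ?f"
      using 1 2 by (simp add: integral_iff)
  qed (use Pol in simp_all)
  then show "\<exists>f g. frac_on Q (\<lambda>p y. der K (t p y)) f g" by blast
qed

text \<open>Each piece is split by the vanishing of the numerator. Where it vanishes,
  \<open>t\<close> is zero and the result is the constant \<open>r \<zero>\<close>, whatever its
  value; elsewhere numerator and denominator change places.\<close>

lemma pw_rational_recip: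
  assumes "pw_rational t" "r \<zero> \<in> carrier K"
    and "\<And>x. x \<in> carrier K - {\<zero>} \<Longrightarrow> r x = inv x"
  shows "pw_rational (\<lambda>p y. r (t p y))"
proof -
  have "piecewise (\<lambda>Q. \<exists>f g. frac_on Q t f g \<and> ((\<forall>p\<in>P. \<forall>y\<in>carrier K. Q p y \<longrightarrow> ev p (jets y) f = \<zero>) \<or>
     (\<forall>p\<in>P. \<forall>y\<in>carrier K. Q p y \<longrightarrow> ev p (jets y) f \<noteq> \<zero>)))"
  proof -
    obtain J where J: "finite J" "\<forall>Q\<in>J. lc Q \<and> (\<exists>f g. frac_on Q t f g)"
      "\<forall>p\<in>P. \<forall>y\<in>carrier K. \<exists>Q\<in>J. Q p y"
      using assms(1) unfolding pw_rational_def piecewise_def by blast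
    \<comment> \<open>Both halves of a piece refer to the same numerator, so one is fixed for each
      piece beforehand.\<close>
    from bchoice[of J "\<lambda>Q f. \<exists>g. frac_on Q t f g"] J(2)
    obtain f where "\<forall>Q\<in>J. \<exists>g. frac_on Q t (f Q) g" by blast
    then have f: "\<forall>Q\<in>J. (\<exists>g. frac_on Q t (f Q) g) \<and> (\<exists>k. f Q \<in> Pol k)"
      unfolding frac_on_def by blast
    let ?A = "\<lambda>Q p y. Q p y \<and> ev p (jets y) (f Q) = \<zero>"
    let ?B = "\<lambda>Q p y. Q p y \<and> ev p (jets y) (f Q) \<noteq> \<zero>"
    show ?thesis
      unfolding piecewise_def
    proof (intro exI[of _ "?A ` J \<union> ?B ` J"] conjI ballI)
      show "finite (?A ` J \<union> ?B ` J)" using J(1) by blast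
      fix R assume "R \<in> ?A ` J \<union> ?B ` J"
      then obtain Q where Q: "Q \<in> J" "R = ?A Q \<or> R = ?B Q" by blast
      obtain k g where k: "f Q \<in> Pol k" and g: "frac_on Q t (f Q) g" using f Q(1) by blast
      have "lc Q" using J(2) Q(1) by blast
      then have AB: "lc (?A Q)" "lc (?B Q)"
        by (rule lc.conj[OF _ lc.zero[OF k]], rule lc.conj[OF _ lc_nonzero[OF k]])
      from Q(2) show "lc R" by (elim disjE) (simp_all only: AB)
      have "frac_on R t (f Q) g" using g by (rule frac_on_mono) (use Q(2) in \<open>elim disjE; simp\<close>)
      then show "\<exists>f g. frac_on R t f g \<and> ((\<forall>p\<in>P. \<forall>y\<in>carrier K. R p y \<longrightarrow> ev p (jets y) f = \<zero>) \<or>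
        (\<forall>p\<in>P. \<forall>y\<in>carrier K. R p y \<longrightarrow> ev p (jets y) f \<noteq> \<zero>))"
      proof (intro exI[of _ "f Q"] exI[of _ g] conjI, assumption)
        show "(\<forall>p\<in>P. \<forall>y\<in>carrier K. R p y \<longrightarrow> ev p (jets y) (f Q) = \<zero>) \<or>
          (\<forall>p\<in>P. \<forall>y\<in>carrier K. R p y \<longrightarrow> ev p (jets y) (f Q) \<noteq> \<zero>)"
          using Q(2) by (elim disjE) simp_all
      qed
    next
      fix p y assume "p \<in> P" "y \<in> carrier K"
      then obtain Q where Q: "Q \<in> J" "Q p y" using J(3) by blast
      show "\<exists>R\<in>?A ` J \<union> ?B ` J. R p y"
      proof (cases "ev p (jets y) (f Q) = \<zero>")
        case True then show ?thesis using Q by (intro bexI[of _ "?A Q"] UnI1 imageI) simp_all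
      next
        case False then show ?thesis using Q by (intro bexI[of _ "?B Q"] UnI2 imageI) simp_all
      qed
    qed
  qed
  then show ?thesis
    unfolding pw_rational_def
  proof (rule piecewise_mono)
    fix Q assume "\<exists>f g. frac_on Q t f g \<and> ((\<forall>p\<in>P. \<forall>y\<in>carrier K. Q p y \<longrightarrow> ev p (jets y) f = \<zero>) \<or>
      (\<forall>p\<in>P. \<forall>y\<in>carrier K. Q p y \<longrightarrow> ev p (jets y) f \<noteq> \<zero>))"
    then obtain f g where fg: "frac_on Q t f g"
      "(\<forall>p\<in>P. \<forall>y\<in>carrier K. Q p y \<longrightarrow> ev p (jets y) f = \<zero>) \<or>
       (\<forall>p\<in>P. \<forall>y\<in>carrier K. Q p y \<longrightarrow> ev p (jets y) f \<noteq> \<zero>)" by blast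
    obtain k where k: "f \<in> Pol k" "g \<in> Pol k" "\<And>p y. p \<in> P \<Longrightarrow> y \<in> carrier K \<Longrightarrow> Q p y \<Longrightarrow>
      t p y \<in> carrier K \<and> ev p (jets y) g \<noteq> \<zero> \<and> t p y \<otimes> ev p (jets y) g = ev p (jets y) f \<and>
      ev p (jets y) g \<in> carrier K \<and> ev p (jets y) f \<in> carrier K"
      using frac_onD[OF fg(1)] by blast
    from fg(2) show "\<exists>f g. frac_on Q (\<lambda>p y. r (t p y)) f g"
    proof
      assume z: "\<forall>p\<in>P. \<forall>y\<in>carrier K. Q p y \<longrightarrow> ev p (jets y) f = \<zero>"
      have "frac_on Q (\<lambda>p y. r (t p y)) (Cst (\<lambda>_. r \<zero>)) (Cst (\<lambda>_. \<one>))"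
      proof (rule frac_onI[of _ 0])
        fix p y assume py: "p \<in> P" "y \<in> carrier K" "Q p y"
        have "t p y \<otimes> ev p (jets y) g = \<zero>" using k(3)[OF py] z py by simp
        then have "t p y = \<zero>" using k(3)[OF py] integral by blast
        then show "r (t p y) \<in> carrier K \<and> ev p (jets y) (Cst (\<lambda>_. \<one>)) \<noteq> \<zero> \<and>
          r (t p y) \<otimes> ev p (jets y) (Cst (\<lambda>_. \<one>)) = ev p (jets y) (Cst (\<lambda>_. r \<zero>))"
          using assms(2) by simp
      qed (use assms(2) in simp_all)
      then show ?thesis by blast
    next
      assume z: "\<forall>p\<in>P. \<forall>y\<in>carrier K. Q p y \<longrightarrow> ev p (jets y) f \<noteq> \<zero>"
      have "frac_on Q (\<lambda>p y. r (t p y)) g f"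
      proof (rule frac_onI[OF k(2,1)])
        fix p y assume py: "p \<in> P" "y \<in> carrier K" "Q p y"
        let ?G = "ev p (jets y) g"
        have nz: "t p y \<otimes> ?G \<noteq> \<zero>" using k(3)[OF py] z py by simp
        then have t: "t p y \<in> carrier K - {\<zero>}" using k(3)[OF py] by (auto simp: integral_iff)
        then have u: "t p y \<in> Units K" by (simp add: field_Units)
        have "inv (t p y) \<otimes> ev p (jets y) f = (inv (t p y) \<otimes> t p y) \<otimes> ?G"
          using k(3)[OF py] u by (metis Units_inv_closed m_assoc)
        then show "r (t p y) \<in> carrier K \<and> ev p (jets y) f \<noteq> \<zero> \<and> r (t p y) \<otimes> ev p (jets y) f = ?G"
          using assms(3)[OF t] u k(3)[OF py] z py by simp
      qed
      then show ?thesis by blast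
    qed
  qed
qed

lemma lc_pw_rational_zero:
  assumes "pw_rational t"
  shows "lc (\<lambda>p y. t p y = \<zero>)" "lc (\<lambda>p y. t p y \<noteq> \<zero>)"
proof -
  have "lc (\<lambda>p y. Q p y \<and> t p y = \<zero>) \<and> lc (\<lambda>p y. Q p y \<and> t p y \<noteq> \<zero>)"
    if Q: "\<exists>f g. frac_on Q t f g" "lc Q" for Q
  proof -
    obtain f g where fg: "frac_on Q t f g" using Q(1) by blast
    obtain k where k: "f \<in> Pol k" "g \<in> Pol k" "\<And>p y. p \<in> P \<Longrightarrow> y \<in> carrier K \<Longrightarrow> Q p y \<Longrightarrow>
      t p y \<in> carrier K \<and> ev p (jets y) g \<noteq> \<zero> \<and> t p y \<otimes> ev p (jets y) g = ev p (jets y) f \<and>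
      ev p (jets y) g \<in> carrier K \<and> ev p (jets y) f \<in> carrier K"
      using frac_onD[OF fg] by blast
    have eq: "t p y = \<zero> \<longleftrightarrow> ev p (jets y) f = \<zero>" if "p \<in> P" "y \<in> carrier K" "Q p y" for p y
      using k(3)[OF that] by (metis integral_iff)
    show ?thesis
      using lc.equiv[OF lc.conj[OF Q(2) lc.zero[OF k(1)]], of "\<lambda>p y. Q p y \<and> t p y = \<zero>"]
        lc.equiv[OF lc.conj[OF Q(2) lc_nonzero[OF k(1)]], of "\<lambda>p y. Q p y \<and> t p y \<noteq> \<zero>"] eq
      by blast
  qed
  then show "lc (\<lambda>p y. t p y = \<zero>)" "lc (\<lambda>p y. t p y \<noteq> \<zero>)"
    using assms unfolding pw_rational_def by (blast intro: lc_piecewise piecewise_mono)+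
qed

lemma piecewise_tuple:
  "(\<And>i. i < (n::nat) \<Longrightarrow> pw_rational (t i)) \<Longrightarrow> piecewise (\<lambda>Q. \<forall>i<n. \<exists>f g. frac_on Q (t i) f g)"
proof (induction n)
  case 0 then show ?case by (intro piecewise_single) simp
next
  case (Suc n)
  have "piecewise (\<lambda>Q. \<forall>i<n. \<exists>f g. frac_on Q (t i) f g)" using Suc by simp
  moreover have "piecewise (\<lambda>Q. \<exists>f g. frac_on Q (t n) f g)" using Suc.prems[of n] unfolding pw_rational_def by simp
  ultimately show ?case
  proof (rule piecewise_combine)
    fix Q R assume Q: "\<forall>i<n. \<exists>f g. frac_on Q (t i) f g" and R: "\<exists>f g. frac_on R (t n) f g"
    show "\<forall>i<Suc n. \<exists>f g. frac_on (\<lambda>p y. Q p y \<and> R p y) (t i) f g"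
    proof (intro allI impI)
      fix i assume "i < Suc n"
      then consider "i < n" | "i = n" by linarith
      then show "\<exists>f g. frac_on (\<lambda>p y. Q p y \<and> R p y) (t i) f g"
      proof cases
        case 1
        then obtain f g where "frac_on Q (t i) f g" using Q by blast
        then have "frac_on (\<lambda>p y. Q p y \<and> R p y) (t i) f g" by (rule frac_on_mono) simp
        then show ?thesis by blast
      next
        case 2
        then obtain f g where "frac_on R (t i) f g" using R by blast
        then have "frac_on (\<lambda>p y. Q p y \<and> R p y) (t i) f g" by (rule frac_on_mono) simp
        then show ?thesis by blast
      qed
    qed
  qed
qed

text \<open>On a piece the tuple is a quotient of polynomials, hence continuous where the
  denominators do not vanish, and the preimage of \<open>U\<close> is open in the space of
  sequences.\<close>

lemma lc_open_tuple:
  assumes "\<And>i. i < n \<Longrightarrow> pw_rational (t i)" "openin (power_top \<tau> n) U"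
  shows "lc (\<lambda>p y. (\<lambda>i\<in>{..<n}. t i p y) \<in> U)"
proof (rule lc_piecewise, rule piecewise_mono[OF piecewise_tuple[OF assms(1)]], assumption, intro impI)
  fix Q assume Q: "\<forall>i<n. \<exists>f g. frac_on Q (t i) f g" "lc Q"
  from Q(1) have "\<forall>i\<in>{..<n}. \<exists>fg. frac_on Q (t i) (fst fg) (snd fg)" by auto
  from bchoice[OF this] obtain fg where fg: "\<forall>i\<in>{..<n}. frac_on Q (t i) (fst (fg i)) (snd (fg i))" ..
  define f g where "f i = fst (fg i)" and "g i = snd (fg i)" for i
  have fr: "frac_on Q (t i) (f i) (g i)" if "i < n" for i using fg that by (simp add: f_def g_def)
  have "\<forall>i\<in>{..<n}. \<exists>k. f i \<in> Pol k \<and> g i \<in> Pol k" using fr unfolding frac_on_def by blast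
  from bchoice[OF this] obtain k where k: "\<And>i. i < n \<Longrightarrow> f i \<in> Pol (k i) \<and> g i \<in> Pol (k i)" by auto
  \<comment> \<open>For \<open>n = 0\<close> the indexed intersection is the whole type;
    intersecting with \<open>topspace \<Omega>\<close> keeps \<open>D p\<close> open.\<close>
  define D where "D p = (\<Inter>i\<in>{..<n}. {a. range a \<subseteq> carrier K \<and> ev p a (g i) \<noteq> \<zero>}) \<inter> topspace \<Omega>" for p
  define \<Phi> where "\<Phi> p a = (\<lambda>i\<in>{..<n}. inv (ev p a (g i)) \<otimes> ev p a (f i))" for p a
  define V where "V p = {a \<in> topspace (subtopology \<Omega> (D p)). \<Phi> p a \<in> U}" for p
  have openD: "openin \<Omega> (D p)" if "p \<in> P" for p
  proof (cases "n = 0")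
    case False
    have "openin \<Omega> (\<Inter>i\<in>{..<n}. {a. range a \<subseteq> carrier K \<and> ev p a (g i) \<noteq> \<zero>})"
    proof (rule openin_Inter)
      show "openin \<Omega> Z" if "Z \<in> (\<lambda>i. {a. range a \<subseteq> carrier K \<and> ev p a (g i) \<noteq> \<zero>}) ` {..<n}" for Z
        using that openin_nonzero[OF _ \<open>p \<in> P\<close>] k by blast
    qed (use False in auto)
    then show ?thesis unfolding D_def using openin_topspace by (rule openin_Int)
  next
    case True then show ?thesis unfolding D_def by (simp del: topspace_\<Omega> topspace_product_topology)
  qed
  have "openin \<Omega> (V p)" if p: "p \<in> P" for p
  proof -
    have "continuous_map (subtopology \<Omega> (D p)) (power_top \<tau> n) (\<Phi> p)"
      unfolding continuous_map_componentwise
    proof (intro conjI ballI)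
      show "\<Phi> p ` topspace (subtopology \<Omega> (D p)) \<subseteq> extensional {..<n}" by (auto simp: \<Phi>_def)
      fix i assume i: "i \<in> {..<n}"
      have "continuous_map (subtopology \<Omega> (D p)) \<tau> (\<lambda>a. inv (ev p a (g i)) \<otimes> ev p a (f i))"
      proof (intro continuous_add_mult(2) continuous_inv)
        show "continuous_map (subtopology \<Omega> (D p)) \<tau> (\<lambda>a. ev p a (g i))"
          "continuous_map (subtopology \<Omega> (D p)) \<tau> (\<lambda>a. ev p a (f i))"
          using k[of i] i p by (auto intro: continuous_map_from_subtopology continuous_dev)
        show "ev p a (g i) \<noteq> \<zero>" if "a \<in> topspace (subtopology \<Omega> (D p))" for a
          using that i unfolding topspace_subtopology D_def by blast
      qed
      then show "continuous_map (subtopology \<Omega> (D p)) \<tau> (\<lambda>x. \<Phi> p x i)" using i by (simp add: \<Phi>_def)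
    qed
    from openin_continuous_map_preimage[OF this assms(2)]
    have "openin (subtopology \<Omega> (D p)) (V p)" unfolding V_def .
    then show ?thesis using openin_open_subtopology[OF openD[OF p]] by blast
  qed
  then have "lc (\<lambda>p y. Q p y \<and> jets y \<in> V p)" by (intro lc.conj Q(2) lc.opn)
  then show "lc (\<lambda>p y. Q p y \<and> (\<lambda>i\<in>{..<n}. t i p y) \<in> U)"
  proof (rule lc.equiv)
    fix p y assume py: "p \<in> P" "y \<in> carrier K"
    have "jets y \<in> V p \<longleftrightarrow> (\<lambda>i\<in>{..<n}. t i p y) \<in> U" if "Q p y"
    proof -
      have *: "t i p y \<in> carrier K \<and> ev p (jets y) (g i) \<noteq> \<zero> \<and>
          t i p y \<otimes> ev p (jets y) (g i) = ev p (jets y) (f i)" if "i < n" for i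
        using fr[OF that] py \<open>Q p y\<close> unfolding frac_on_def by blast
      have top: "jets y \<in> topspace \<Omega>" unfolding topspace_\<Omega> using range_dseq[OF py(2)] by blast
      then have D: "jets y \<in> D p" unfolding D_def using * range_dseq[OF py(2)] by blast
      have "inv (ev p (jets y) (g i)) \<otimes> ev p (jets y) (f i) = t i p y" if "i < n" for i
      proof -
        have "ev p (jets y) (g i) \<in> carrier K" using k[OF that] py by (auto intro: dev_closed)
        then have u: "ev p (jets y) (g i) \<in> Units K" using *[OF that] by (simp add: field_Units)
        have "inv (ev p (jets y) (g i)) \<otimes> (ev p (jets y) (g i) \<otimes> t i p y) = t i p y"
          using u *[OF that] by (metis Units_closed Units_inv_closed Units_l_inv l_one m_assoc)
        then show ?thesis using *[OF that] u by (metis Units_closed m_comm)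
      qed
      then have "\<Phi> p (jets y) = (\<lambda>i\<in>{..<n}. t i p y)" by (auto simp: \<Phi>_def)
      with top D show ?thesis unfolding V_def topspace_subtopology by simp
    qed
    then show "Q p y \<and> (\<lambda>i\<in>{..<n}. t i p y) \<in> U \<longleftrightarrow> Q p y \<and> jets y \<in> V p" by blast
  qed
qed

end

section \<open>Indexed polynomials\<close>

context field
begin

text \<open>The product runs over all variables, not over the support of \<open>m\<close>, so that
  all monomials share one index set.\<close>

definition monom_val :: "nat \<Rightarrow> (nat \<Rightarrow> 'a) \<Rightarrow> nat multiset \<Rightarrow> 'a" where
  "monom_val n x m = (\<Otimes>i\<in>{..<n}. x i [^] count m i)"

lemma monom_val_closed [simp]: "x \<in> {..<n} \<rightarrow> carrier R \<Longrightarrow> monom_val n x m \<in> carrier R"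
  unfolding monom_val_def by (intro finprod_closed) auto

lemma monom_val_eq:
  assumes "x \<in> {..<n} \<rightarrow> carrier R" "set_mset m \<subseteq> {..<n}"
  shows "(\<Otimes>i\<in>set_mset m. x i [^] count m i) = monom_val n x m"
  unfolding monom_val_def
proof (rule finprod_mono_neutral_cong_left)
  show "x i [^] count m i = \<one>" if "i \<in> {..<n} - set_mset m" for i
    using that by (simp add: not_in_iff)
qed (use assms in auto)

lemma monom_val_add_mset:
  assumes "x \<in> {..<n} \<rightarrow> carrier R" "i < n"
  shows "monom_val n x (add_mset i m) = monom_val n x m \<otimes> x i"
proof -
  have "monom_val n x (add_mset i m) =
      (\<Otimes>j\<in>{..<n}. x j [^] count m j \<otimes> (if i = j then x j else \<one>))"
    unfolding monom_val_def using assms(1) by (intro finprod_cong') (auto simp: Pi_iff)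
  also have "\<dots> = monom_val n x m \<otimes> (\<Otimes>j\<in>{..<n}. if i = j then x j else \<one>)"
    unfolding monom_val_def using assms(1) by (intro finprod_multf) (auto simp: Pi_iff)
  also have "(\<Otimes>j\<in>{..<n}. if i = j then x j else \<one>) = x i"
    using assms by (intro finprod_singleton) auto
  finally show ?thesis .
qed

lemma monom_val_empty [simp]: "monom_val n x {#} = \<one>"
  unfolding monom_val_def by simp

lemma indexed_pset_finite:
  "q \<in> indexed_pset I (carrier R) \<Longrightarrow>
    finite {m. q m \<noteq> \<zero>} \<and> (\<forall>m. q m \<in> carrier R) \<and> (\<forall>m. q m \<noteq> \<zero> \<longrightarrow> set_mset m \<subseteq> I)"
proof (induction rule: indexed_pset.induct)
  case (indexed_const k)
  have "{m. indexed_const k m \<noteq> \<zero>} \<subseteq> {{#}}" by (auto simp: indexed_const_def)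
  then show ?case using indexed_const finite_subset by (auto simp: indexed_const_def)
next
  case (indexed_padd P Q)
  then have "{m. indexed_padd P Q m \<noteq> \<zero>} \<subseteq> {m. P m \<noteq> \<zero>} \<union> {m. Q m \<noteq> \<zero>}"
    by (auto simp: indexed_padd_def)
  moreover have "finite ({m. P m \<noteq> \<zero>} \<union> {m. Q m \<noteq> \<zero>})" using indexed_padd by simp
  ultimately have "finite {m. indexed_padd P Q m \<noteq> \<zero>}" by (rule finite_subset)
  moreover have "set_mset m \<subseteq> I" if "indexed_padd P Q m \<noteq> \<zero>" for m
  proof -
    have "P m \<noteq> \<zero> \<or> Q m \<noteq> \<zero>" using that by (auto simp: indexed_padd_def)
    then show ?thesis using indexed_padd by blast
  qed
  ultimately show ?case using indexed_padd by (simp add: indexed_padd_def)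
next
  case (indexed_pmult P i)
  have "{m. indexed_pmult P i m \<noteq> \<zero>} \<subseteq> add_mset i ` {m. P m \<noteq> \<zero>}"
  proof
    fix m assume "m \<in> {m. indexed_pmult P i m \<noteq> \<zero>}"
    then have "i \<in># m" "P (m - {#i#}) \<noteq> \<zero>" by (auto simp: indexed_pmult_def split: if_splits)
    then show "m \<in> add_mset i ` {m. P m \<noteq> \<zero>}" by (intro image_eqI[of _ _ "m - {#i#}"]) auto
  qed
  note sub = this
  show ?case
  proof (intro conjI allI impI)
    show "finite {m. indexed_pmult P i m \<noteq> \<zero>}"
      by (rule finite_subset[OF sub finite_imageI]) (use indexed_pmult in blast)
    show "indexed_pmult P i m \<in> carrier R" for m
      using indexed_pmult by (simp add: indexed_pmult_def)
    show "set_mset m \<subseteq> I" if "indexed_pmult P i m \<noteq> \<zero>" for m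
      using that sub indexed_pmult by fastforce
  qed
qed

end

section \<open>Evaluation and partial derivatives of indexed polynomials\<close>

context diff_field
begin

abbreviation "PS n \<equiv> indexed_pset {..<n} (carrier K)"

text \<open>\<open>poly_eval\<close> sums over the support, which changes under the ring operations;
  over a common finite superset the sums can be combined.\<close>

lemma poly_eval_superset:
  assumes "q \<in> PS n" "x \<in> {..<n} \<rightarrow> carrier K" "finite S" "{m. q m \<noteq> \<zero>} \<subseteq> S"
  shows "poly_eval K q x = (\<Oplus>m\<in>S. q m \<otimes> monom_val n x m)"
proof -
  note q = indexed_pset_finite[OF assms(1)]
  have "poly_eval K q x = (\<Oplus>m\<in>{m. q m \<noteq> \<zero>}. q m \<otimes> monom_val n x m)"
    unfolding poly_eval_def using assms(2) q
    by (intro finsum_cong') (auto simp: monom_val_eq)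
  also have "\<dots> = (\<Oplus>m\<in>S. q m \<otimes> monom_val n x m)"
    using assms q by (intro add.finprod_mono_neutral_cong_left) auto
  finally show ?thesis .
qed

lemma poly_eval_closed [simp]:
  assumes "q \<in> PS n" "x \<in> {..<n} \<rightarrow> carrier K"
  shows "poly_eval K q x \<in> carrier K"
  using poly_eval_superset[OF assms, of "{m. q m \<noteq> \<zero>}"] indexed_pset_finite[OF assms(1)] assms(2)
  by (auto intro!: finsum_closed)

lemma poly_eval_const:
  assumes "k \<in> carrier K" "x \<in> {..<n} \<rightarrow> carrier K"
  shows "poly_eval K (indexed_const k) x = k"
proof -
  have "poly_eval K (indexed_const k) x = (\<Oplus>m\<in>{{#}}. indexed_const k m \<otimes> monom_val n x m)"
    by (intro poly_eval_superset indexed_pset.indexed_const assms) (auto simp: indexed_const_def)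
  also have "\<dots> = k" using assms(1) by (simp add: indexed_const_def)
  finally show ?thesis .
qed

lemma poly_eval_padd:
  assumes "q \<in> PS n" "r \<in> PS n" "x \<in> {..<n} \<rightarrow> carrier K"
  shows "poly_eval K (indexed_padd q r) x = poly_eval K q x \<oplus> poly_eval K r x"
proof -
  let ?S = "{m. q m \<noteq> \<zero>} \<union> {m. r m \<noteq> \<zero>}"
  note q = indexed_pset_finite[OF assms(1)] and r = indexed_pset_finite[OF assms(2)]
  have fin: "finite ?S" using q r by simp
  have "poly_eval K (indexed_padd q r) x = (\<Oplus>m\<in>?S. indexed_padd q r m \<otimes> monom_val n x m)"
    using q r by (intro poly_eval_superset indexed_pset.indexed_padd assms fin) (auto simp: indexed_padd_def)
  also have "\<dots> = (\<Oplus>m\<in>?S. q m \<otimes> monom_val n x m \<oplus> r m \<otimes> monom_val n x m)"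
    using q r assms(3) by (intro finsum_cong') (auto simp: indexed_padd_def l_distr)
  also have "\<dots> = (\<Oplus>m\<in>?S. q m \<otimes> monom_val n x m) \<oplus> (\<Oplus>m\<in>?S. r m \<otimes> monom_val n x m)"
    using q r assms(3) by (intro finsum_addf) auto
  finally show ?thesis
    using poly_eval_superset[OF assms(1,3) fin] poly_eval_superset[OF assms(2,3) fin] by simp
qed

lemma poly_eval_pmult:
  assumes "q \<in> PS n" "i < n" "x \<in> {..<n} \<rightarrow> carrier K"
  shows "poly_eval K (indexed_pmult q i) x = poly_eval K q x \<otimes> x i"
proof -
  let ?S = "{m. q m \<noteq> \<zero>}"
  note q = indexed_pset_finite[OF assms(1)]
  have xi: "x i \<in> carrier K" using assms by auto
  have val: "indexed_pmult q i (add_mset i m) = q m" for m by (simp add: indexed_pmult_def)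
  have "{m. indexed_pmult q i m \<noteq> \<zero>} \<subseteq> add_mset i ` ?S"
  proof
    fix m assume "m \<in> {m. indexed_pmult q i m \<noteq> \<zero>}"
    then have "i \<in># m" "q (m - {#i#}) \<noteq> \<zero>" by (auto simp: indexed_pmult_def split: if_splits)
    then show "m \<in> add_mset i ` ?S" by (intro image_eqI[of _ _ "m - {#i#}"]) auto
  qed
  then have "poly_eval K (indexed_pmult q i) x =
      (\<Oplus>m\<in>add_mset i ` ?S. indexed_pmult q i m \<otimes> monom_val n x m)"
    using q assms by (intro poly_eval_superset indexed_pset.indexed_pmult) auto
  also have "\<dots> = (\<Oplus>m\<in>?S. indexed_pmult q i (add_mset i m) \<otimes> monom_val n x (add_mset i m))"
    using q assms(3) by (intro add.finprod_reindex) (auto simp: val inj_on_def)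
  also have "\<dots> = (\<Oplus>m\<in>?S. (q m \<otimes> monom_val n x m) \<otimes> x i)"
    using q assms xi by (intro finsum_cong') (auto simp: val monom_val_add_mset m_assoc)
  also have "\<dots> = (\<Oplus>m\<in>?S. q m \<otimes> monom_val n x m) \<otimes> x i"
    using q assms xi by (intro finsum_ldistr[symmetric]) auto
  finally show ?thesis using poly_eval_superset[OF assms(1,3), of ?S] q by simp
qed

lemma poly_deriv_const: "poly_deriv K j (indexed_const k) = indexed_const \<zero>"
  by (auto simp: poly_deriv_def indexed_const_def)

lemma poly_deriv_padd:
  assumes "q \<in> PS n" "r \<in> PS n"
  shows "poly_deriv K j (indexed_padd q r) = indexed_padd (poly_deriv K j q) (poly_deriv K j r)"
  using indexed_pset_finite[OF assms(1)] indexed_pset_finite[OF assms(2)]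
  by (auto simp: poly_deriv_def indexed_padd_def add.nat_pow_distrib a_ac)

text \<open>The product rule. For \<open>i = j\<close> the multiplier \<open>Suc (count m j)\<close>
  exceeds by one the multiplier left after removing a copy of \<open>j\<close>; this extra unit is
  the summand \<open>q\<close>.\<close>

lemma poly_deriv_pmult:
  assumes "q \<in> PS n"
  shows "poly_deriv K j (indexed_pmult q i) =
    (if i = j then indexed_padd (indexed_pmult (poly_deriv K j q) i) q
     else indexed_pmult (poly_deriv K j q) i)"
proof -
  have q: "q m \<in> carrier K" for m using indexed_pset_finite[OF assms] by blast
  show ?thesis
  proof (cases "i = j")
    case True
    have "poly_deriv K j (indexed_pmult q j) m = indexed_padd (indexed_pmult (poly_deriv K j q) j) q m" for m
    proof (cases "j \<in># m")
      case True
      then have "count m j = Suc (count (m - {#j#}) j)" by simp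
      with True q show ?thesis
        by (simp add: poly_deriv_def indexed_pmult_def indexed_padd_def del: count_diff)
    next
      case False
      moreover have "count m j = 0" using False by (simp add: not_in_iff)
      ultimately show ?thesis
        using q by (simp add: poly_deriv_def indexed_pmult_def indexed_padd_def)
    qed
    then show ?thesis using True by auto
  next
    case False
    then show ?thesis
      by (auto simp: poly_deriv_def indexed_pmult_def fun_eq_iff)
  qed
qed

lemma poly_deriv_PS [simp]: "q \<in> PS n \<Longrightarrow> poly_deriv K j q \<in> PS n"
proof (induction rule: indexed_pset.induct)
  case (indexed_const k) then show ?case
    by (simp add: poly_deriv_const indexed_pset.indexed_const)
next
  case (indexed_padd P Q) then show ?case
    by (simp add: poly_deriv_padd indexed_pset.indexed_padd)
next
  case (indexed_pmult P i) then show ?case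
    by (auto simp: poly_deriv_pmult intro!: indexed_pset.indexed_padd indexed_pset.indexed_pmult)
qed

lemma poly_eval_deriv:
  assumes "q \<in> PS n" "x \<in> {..<n} \<rightarrow> carrier K"
  shows "poly_eval K (poly_deriv K j q) x \<in> carrier K"
    and "r \<in> PS n \<Longrightarrow> poly_eval K (indexed_padd (poly_deriv K j q) (poly_deriv K j r)) x =
      poly_eval K (poly_deriv K j q) x \<oplus> poly_eval K (poly_deriv K j r) x"
  using poly_eval_closed[OF poly_deriv_PS[OF assms(1)] assms(2)]
    poly_eval_padd[OF poly_deriv_PS[OF assms(1)] poly_deriv_PS assms(2)] by blast+

lemma poly_eval_deriv_pmult:
  assumes "q \<in> PS n" "i < n" "x \<in> {..<n} \<rightarrow> carrier K"
  shows "poly_eval K (poly_deriv K j (indexed_pmult q i)) x =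
    poly_eval K (poly_deriv K j q) x \<otimes> x i \<oplus> (if i = j then poly_eval K q x else \<zero>)"
proof -
  have "indexed_pmult (poly_deriv K j q) i \<in> PS n"
    using assms by (intro indexed_pset.indexed_pmult) auto
  moreover have "x i \<in> carrier K" using assms by auto
  ultimately show ?thesis
    using assms poly_eval_padd[of "indexed_pmult (poly_deriv K j q) i" n q x]
      poly_eval_pmult[OF poly_deriv_PS[OF assms(1)] assms(2,3)] poly_eval_deriv(1)[OF assms(1,3)]
    by (cases "i = j") (simp_all add: poly_deriv_pmult)
qed

lemma PS_scale:
  assumes "k \<in> carrier K" "q \<in> PS n"
  shows "\<exists>r\<in>PS n. \<forall>x\<in>{..<n} \<rightarrow> carrier K. poly_eval K r x = k \<otimes> poly_eval K q x \<and>
    (\<forall>j. poly_eval K (poly_deriv K j r) x = k \<otimes> poly_eval K (poly_deriv K j q) x)"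
  using assms(2)
proof (induction rule: indexed_pset.induct)
  case (indexed_const c)
  then show ?case
    using assms(1)
    by (intro bexI[of _ "indexed_const (k \<otimes> c)"])
      (auto simp: poly_eval_const poly_deriv_const intro: indexed_pset.indexed_const)
next
  case (indexed_padd P Q)
  then obtain P' Q' where "P' \<in> PS n" "Q' \<in> PS n"
    "\<forall>x\<in>{..<n} \<rightarrow> carrier K. poly_eval K P' x = k \<otimes> poly_eval K P x \<and>
       (\<forall>j. poly_eval K (poly_deriv K j P') x = k \<otimes> poly_eval K (poly_deriv K j P) x)"
    "\<forall>x\<in>{..<n} \<rightarrow> carrier K. poly_eval K Q' x = k \<otimes> poly_eval K Q x \<and>
       (\<forall>j. poly_eval K (poly_deriv K j Q') x = k \<otimes> poly_eval K (poly_deriv K j Q) x)" by blast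
  with indexed_padd.hyps assms(1) show ?case
    by (intro bexI[of _ "indexed_padd P' Q'"])
      (simp_all add: poly_eval_padd poly_deriv_padd poly_eval_deriv r_distr indexed_pset.indexed_padd)
next
  case (indexed_pmult P i)
  then obtain P' where "P' \<in> PS n"
    "\<forall>x\<in>{..<n} \<rightarrow> carrier K. poly_eval K P' x = k \<otimes> poly_eval K P x \<and>
       (\<forall>j. poly_eval K (poly_deriv K j P') x = k \<otimes> poly_eval K (poly_deriv K j P) x)" by blast
  moreover have "x i \<in> carrier K" if "x \<in> {..<n} \<rightarrow> carrier K" for x using that indexed_pmult.hyps by auto
  ultimately show ?case using indexed_pmult.hyps assms(1)
    by (intro bexI[of _ "indexed_pmult P' i"])
      (simp_all add: poly_eval_pmult poly_eval_deriv poly_eval_deriv_pmult r_distr indexed_pset.indexed_pmult m_assoc)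
qed

text \<open>\<open>indexed_pset\<close> is generated by constants, sums and multiplication by
  variables, so general products have to be constructed. The derivatives are carried along to keep
  separants comparable.\<close>

lemma PS_times:
  assumes "q \<in> PS n" "r \<in> PS n"
  shows "\<exists>s\<in>PS n. \<forall>x\<in>{..<n} \<rightarrow> carrier K. poly_eval K s x = poly_eval K q x \<otimes> poly_eval K r x \<and>
    (\<forall>j. poly_eval K (poly_deriv K j s) x =
       poly_eval K (poly_deriv K j q) x \<otimes> poly_eval K r x \<oplus> poly_eval K q x \<otimes> poly_eval K (poly_deriv K j r) x)"
  using assms(1)
proof (induction rule: indexed_pset.induct)
  case (indexed_const c)
  then obtain s where "s \<in> PS n"
    "\<forall>x\<in>{..<n} \<rightarrow> carrier K. poly_eval K s x = c \<otimes> poly_eval K r x \<and>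
       (\<forall>j. poly_eval K (poly_deriv K j s) x = c \<otimes> poly_eval K (poly_deriv K j r) x)"
    using PS_scale[OF _ assms(2)] by blast
  moreover have "poly_eval K (poly_deriv K j r) x \<in> carrier K" if "x \<in> {..<n} \<rightarrow> carrier K" for j x
    by (rule poly_eval_closed[OF poly_deriv_PS[OF assms(2)] that])
  ultimately show ?case
    using indexed_const assms(2) by (intro bexI[of _ s]) (simp_all add: poly_eval_const poly_deriv_const)
next
  case (indexed_padd P Q)
  then obtain P' Q' where "P' \<in> PS n" "Q' \<in> PS n"
    "\<forall>x\<in>{..<n} \<rightarrow> carrier K. poly_eval K P' x = poly_eval K P x \<otimes> poly_eval K r x \<and>
      (\<forall>j. poly_eval K (poly_deriv K j P') x =
       poly_eval K (poly_deriv K j P) x \<otimes> poly_eval K r x \<oplus> poly_eval K P x \<otimes> poly_eval K (poly_deriv K j r) x)"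
    "\<forall>x\<in>{..<n} \<rightarrow> carrier K. poly_eval K Q' x = poly_eval K Q x \<otimes> poly_eval K r x \<and>
      (\<forall>j. poly_eval K (poly_deriv K j Q') x =
       poly_eval K (poly_deriv K j Q) x \<otimes> poly_eval K r x \<oplus> poly_eval K Q x \<otimes> poly_eval K (poly_deriv K j r) x)"
    by blast
  with indexed_padd.hyps assms(2) show ?case
    by (intro bexI[of _ "indexed_padd P' Q'"])
      (simp_all add: poly_eval_padd poly_deriv_padd poly_eval_deriv l_distr r_distr a_ac indexed_pset.indexed_padd)
next
  case (indexed_pmult P i)
  then obtain P' where "P' \<in> PS n"
    "\<forall>x\<in>{..<n} \<rightarrow> carrier K. poly_eval K P' x = poly_eval K P x \<otimes> poly_eval K r x \<and>
      (\<forall>j. poly_eval K (poly_deriv K j P') x =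
       poly_eval K (poly_deriv K j P) x \<otimes> poly_eval K r x \<oplus> poly_eval K P x \<otimes> poly_eval K (poly_deriv K j r) x)"
    by blast
  moreover have "x i \<in> carrier K" if "x \<in> {..<n} \<rightarrow> carrier K" for x using that indexed_pmult.hyps by auto
  ultimately show ?case using indexed_pmult.hyps assms(2)
    by (intro bexI[of _ "indexed_pmult P' i"])
      (simp_all add: poly_eval_pmult poly_eval_deriv poly_eval_deriv_pmult l_distr r_distr indexed_pset.indexed_pmult m_ac a_ac)
qed

text \<open>The bridge to \<open>scheme_DL\<close>: once \<open>p\<close> is fixed, the coefficient
  functions become constants. All partial derivatives must agree as well, since (DL) speaks of the
  separant.\<close>

lemma ex_indexed_poly:
  assumes "f \<in> Pol n" "p \<in> P"
  shows "\<exists>q\<in>PS n. \<forall>x\<in>{..<n} \<rightarrow> carrier K. poly_eval K q x = ev p x f \<and>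
    (\<forall>j. poly_eval K (poly_deriv K j q) x = ev p x (pdiff K j f))"
  using assms(1)
proof (induction rule: dpols.induct)
  case (Cst c)
  then have "c p \<in> carrier K" using assms(2) by auto
  then show ?case
    by (intro bexI[of _ "indexed_const (c p)"])
      (auto simp: poly_eval_const poly_deriv_const intro: indexed_pset.indexed_const)
next
  case (Jv i)
  have one: "indexed_const \<one> \<in> PS n" by (rule indexed_pset.indexed_const) simp
  have "x i \<in> carrier K" if "x \<in> {..<n} \<rightarrow> carrier K" for x using that Jv by auto
  then show ?case
    using Jv one
    by (intro bexI[of _ "indexed_pmult (indexed_const \<one>) i"])
      (simp_all add: poly_eval_const poly_deriv_const poly_eval_pmult poly_deriv_pmult indexed_padd_const
        indexed_pset.indexed_pmult)
next
  case (Plus f g)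
  then obtain q r where "q \<in> PS n" "r \<in> PS n"
    "\<forall>x\<in>{..<n} \<rightarrow> carrier K. poly_eval K q x = ev p x f \<and>
       (\<forall>j. poly_eval K (poly_deriv K j q) x = ev p x (pdiff K j f))"
    "\<forall>x\<in>{..<n} \<rightarrow> carrier K. poly_eval K r x = ev p x g \<and>
       (\<forall>j. poly_eval K (poly_deriv K j r) x = ev p x (pdiff K j g))" by blast
  then show ?case
    by (intro bexI[of _ "indexed_padd q r"])
      (simp_all add: poly_eval_padd poly_deriv_padd poly_eval_deriv indexed_pset.indexed_padd)
next
  case (Times f g)
  then obtain q r where qr: "q \<in> PS n" "r \<in> PS n"
    "\<forall>x\<in>{..<n} \<rightarrow> carrier K. poly_eval K q x = ev p x f \<and>
       (\<forall>j. poly_eval K (poly_deriv K j q) x = ev p x (pdiff K j f))"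
    "\<forall>x\<in>{..<n} \<rightarrow> carrier K. poly_eval K r x = ev p x g \<and>
       (\<forall>j. poly_eval K (poly_deriv K j r) x = ev p x (pdiff K j g))" by blast
  obtain s where "s \<in> PS n" "\<forall>x\<in>{..<n} \<rightarrow> carrier K. poly_eval K s x = poly_eval K q x \<otimes> poly_eval K r x \<and>
    (\<forall>j. poly_eval K (poly_deriv K j s) x =
       poly_eval K (poly_deriv K j q) x \<otimes> poly_eval K r x \<oplus> poly_eval K q x \<otimes> poly_eval K (poly_deriv K j r) x)"
    using PS_times[OF qr(1,2)] by blast
  then show ?case using qr(3,4) by (intro bexI[of _ s]) simp_all
qed

end

section \<open>Formulas and uniform finiteness\<close>

context diff_top_field
begin

lemma pw_rational_tuple_closed:
  assumes "\<And>i. i < n \<Longrightarrow> pw_rational (t i)" "p \<in> P" "y \<in> carrier K"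
  shows "(\<lambda>i\<in>{..<n}. t i p y) \<in> tuples K n"
  using assms by (auto intro: pw_rational_closed)

lemma pw_rational_poly_eval:
  assumes t: "\<And>i. i < n \<Longrightarrow> pw_rational (t i)" and "q \<in> PS n"
  shows "pw_rational (\<lambda>p y. poly_eval K q (\<lambda>i\<in>{..<n}. t i p y))"
  using assms(2)
proof (induction rule: indexed_pset.induct)
  have x: "(\<lambda>i\<in>{..<n}. t i p y) \<in> {..<n} \<rightarrow> carrier K" if "p \<in> P" "y \<in> carrier K" for p y
    using pw_rational_tuple_closed[of n t, OF t that] by (simp add: PiE_def)
  {
    case (indexed_const k)
    show ?case
      by (rule pw_rational_cong[OF pw_rational_const[of "\<lambda>_. k"]])
        (use indexed_const x in \<open>auto intro: poly_eval_const\<close>)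
  next
    case (indexed_padd Q R)
    show ?case
      by (rule pw_rational_cong[OF pw_rational_add_mult(1)[OF indexed_padd.IH]])
        (rule poly_eval_padd[OF indexed_padd.hyps x])
  next
    case (indexed_pmult Q i)
    then have i: "i < n" by simp
    show ?case
    proof (rule pw_rational_cong[OF pw_rational_add_mult(2)[OF indexed_pmult.IH t[OF i]]])
      fix p y assume "p \<in> P" "y \<in> carrier K"
      from poly_eval_pmult[OF indexed_pmult.hyps(1) i x[OF this]]
      show "poly_eval K (indexed_pmult Q i) (\<lambda>i\<in>{..<n}. t i p y) =
          poly_eval K Q (\<lambda>i\<in>{..<n}. t i p y) \<otimes> t i p y"
        using i by simp
    qed
  }
qed

lemma lc_open_union_zero_set:
  assumes t: "\<And>i. i < n \<Longrightarrow> pw_rational (t i)" and "open_union_zero_set K \<tau> n R"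
  shows "lc (\<lambda>p y. (\<lambda>i\<in>{..<n}. t i p y) \<in> R)"
proof -
  obtain U F where UF: "openin (power_top \<tau> n) U" "finite F" "F \<subseteq> PS n" "R = U \<union> zero_set K n F"
    using assms(2) unfolding open_union_zero_set_def by blast
  have "lc (\<lambda>p y. (\<lambda>i\<in>{..<n}. t i p y) \<in> U \<or>
      (\<forall>q\<in>F. poly_eval K q (\<lambda>i\<in>{..<n}. t i p y) = \<zero>))"
    using UF by (intro lc.disj lc_Ball lc_open_tuple lc_pw_rational_zero(1) pw_rational_poly_eval t) auto
  then show ?thesis
  proof (rule lc.equiv)
    fix p y assume "p \<in> P" "y \<in> carrier K"
    from pw_rational_tuple_closed[of n t, OF t this]
    show "(\<lambda>i\<in>{..<n}. t i p y) \<in> R \<longleftrightarrow> (\<lambda>i\<in>{..<n}. t i p y) \<in> U \<or>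
      (\<forall>q\<in>F. poly_eval K q (\<lambda>i\<in>{..<n}. t i p y) = \<zero>)"
      unfolding UF(4) zero_set_def by blast
  qed
qed

end

section \<open>Terms and quantifier-free formulas\<close>

context
  fixes L :: "('r, 'c) language" and M :: "('u, 'r, 'c) struct" and \<tau> :: "'u topology"
  assumes M: "diff_top_field M (assignments M) \<tau>" and top: "topological_field L M \<tau>"
begin

interpretation diff_top_field M "assignments M" \<tau> by (rule M)

text \<open>The parameter is an entire assignment: variable \<open>k\<close> is the unknown, and
  every other variable is a coefficient \<open>e i\<close> depending on the parameter.\<close>

lemma pw_rational_eval:
  "tm_in L {Inverse, Deriv} t \<Longrightarrow> pw_rational (\<lambda>e y. Defs.eval M (e(k := y)) t)"
proof (induction t)
  case (TVar i)
  show ?case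
  proof (cases "i = k")
    case True then show ?thesis using pw_rational_id by simp
  next
    case False then show ?thesis using pw_rational_const[of "\<lambda>e. e i"] by auto
  qed
next
  case (TConst c)
  then have "cst M c \<in> carrier M" using top by (auto simp: topological_field_def is_struct_def)
  then show ?case using pw_rational_const[of "\<lambda>_. cst M c"] by simp
next
  case TZero show ?case using pw_rational_const[of "\<lambda>_. \<zero>\<^bsub>M\<^esub>"] by simp
next
  case TOne show ?case using pw_rational_const[of "\<lambda>_. \<one>\<^bsub>M\<^esub>"] by simp
next
  case (TOpp t)
  then have "tm_in L {Inverse, Deriv} t" by simp
  note t = TOpp.IH[OF this]
  show ?case
    by (rule pw_rational_cong[OF pw_rational_minus[OF t]])
      (use top pw_rational_closed[OF t] in \<open>simp add: topological_field_def\<close>)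
next
  case (TAdd s t) then show ?case by (simp add: pw_rational_add_mult)
next
  case (TMul s t) then show ?case by (simp add: pw_rational_add_mult)
next
  case (TInv t)
  then have "tm_in L {Inverse, Deriv} t" by simp
  note t = TInv.IH[OF this]
  have "pw_rational (\<lambda>e y. recip M (Defs.eval M (e(k := y)) t))"
    by (rule pw_rational_recip[OF t]) (use top in \<open>auto simp: topological_field_def is_struct_def\<close>)
  then show ?case by (simp only: Defs.eval.simps)
next
  case (TDer t)
  from TDer.prems have "tm_in L {Inverse, Deriv} t" by simp
  from pw_rational_der[OF TDer.IH[OF this]] show ?case by simp
qed

text \<open>The negation is proved along with the formula because \<open>lc\<close> has no
  complement rule. For relation symbols this uses that the complement, too, is an open set united
  with a zero set.\<close>

lemma lc_sat:
  "qfree \<phi> \<Longrightarrow> fm_in L {Inverse, Deriv} \<phi> \<Longrightarrow>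
    lc (\<lambda>e y. sat M (e(k := y)) \<phi>) \<and> lc (\<lambda>e y. \<not> sat M (e(k := y)) \<phi>)"
proof (induction \<phi>)
  case (FEq s t)
  then have st: "pw_rational (\<lambda>e y. Defs.eval M (e(k := y)) s)" "pw_rational (\<lambda>e y. Defs.eval M (e(k := y)) t)"
    by (auto intro: pw_rational_eval)
  have "pw_rational (\<lambda>e y. Defs.eval M (e(k := y)) s \<oplus>\<^bsub>M\<^esub> (\<ominus>\<^bsub>M\<^esub> Defs.eval M (e(k := y)) t))"
    by (intro pw_rational_add_mult pw_rational_minus st)
  note l = lc_pw_rational_zero[OF this]
  have eq: "Defs.eval M (e(k := y)) s = Defs.eval M (e(k := y)) t \<longleftrightarrow>
      Defs.eval M (e(k := y)) s \<oplus>\<^bsub>M\<^esub> (\<ominus>\<^bsub>M\<^esub> Defs.eval M (e(k := y)) t) = \<zero>\<^bsub>M\<^esub>"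
    if "e \<in> assignments M" "y \<in> carrier M" for e y
    using pw_rational_closed[OF st(1) that] pw_rational_closed[OF st(2) that]
    by (metis a_minus_def r_right_minus_eq)
  show ?case
    by (intro conjI lc.equiv[OF l(1)] lc.equiv[OF l(2)]) (simp_all only: sat.simps eq not_not simp_thms)
next
  case (FRel r ts)
  let ?t = "\<lambda>i e y. Defs.eval M (e(k := y)) (ts ! i)"
  have r: "r \<in> rsyms L" and len: "length ts = arity L r" using FRel by auto
  have t: "pw_rational (?t i)" if "i < length ts" for i
    using FRel that by (auto intro!: pw_rational_eval)
  have o: "open_union_zero_set M \<tau> (length ts) (rel M r)"
    "open_union_zero_set M \<tau> (length ts) (tuples M (length ts) - rel M r)"
    using top r unfolding topological_field_def len by blast+
  show ?case
  proof
    show "lc (\<lambda>e y. sat M (e(k := y)) (FRel r ts))"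
      using lc_open_union_zero_set[of "length ts" ?t, OF t o(1)] by simp
    show "lc (\<lambda>e y. \<not> sat M (e(k := y)) (FRel r ts))"
    proof (rule lc.equiv[OF lc_open_union_zero_set[of "length ts" ?t, OF t o(2)]])
      fix e y assume "e \<in> assignments M" "y \<in> carrier M"
      from pw_rational_tuple_closed[of "length ts" ?t, OF t this]
      show "\<not> sat M (e(k := y)) (FRel r ts) \<longleftrightarrow>
          (\<lambda>i\<in>{..<length ts}. ?t i e y) \<in> tuples M (length ts) - rel M r"
        unfolding sat.simps by blast
    qed
  qed
next
  case (FNot \<phi>) then show ?case by simp
next
  case (FAnd \<phi> \<psi>)
  from FAnd.prems have "qfree \<phi>" "fm_in L {Inverse, Deriv} \<phi>" "qfree \<psi>" "fm_in L {Inverse, Deriv} \<psi>"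
    by simp_all
  note \<phi> = FAnd.IH(1)[OF this(1,2)] and \<psi> = FAnd.IH(2)[OF this(3,4)]
  show ?case
    unfolding sat.simps de_Morgan_conj
    by (intro conjI lc.conj lc.disj conjunct1[OF \<phi>] conjunct2[OF \<phi>] conjunct1[OF \<psi>] conjunct2[OF \<psi>])
qed auto

lemma qfree_solutions_bounded:
  assumes "qfree \<phi>" "fm_in L {Inverse, Deriv} \<phi>"
  shows "\<exists>N. \<forall>e\<in>assignments M. infinite (solutions M \<phi> k e) \<or> card (solutions M \<phi> k e) \<le> N"
  using lc_bounded[OF conjunct1[OF lc_sat[OF assms, of k]]] unfolding solutions_def .

end

section \<open>From the axiom scheme to the abstract setting\<close>

lemma diff_top_fieldI:
  fixes M :: "('u, 'r, 'c) struct" and P :: "'p set"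
  assumes via: "topological_field_via L \<rho> M \<tau>" and der: "is_derivation M" and DL: "scheme_DL \<rho> M"
  shows "diff_top_field M P \<tau>"
proof -
  have top: "topological_field L M \<tau>" using via by (simp add: topological_field_via_def)
  then have fld: "field M" and ft: "field_topology M \<tau>" by (auto simp: topological_field_def)
  have char0: "[n] \<cdot>\<^bsub>M\<^esub> \<one>\<^bsub>M\<^esub> \<noteq> \<zero>\<^bsub>M\<^esub>" if "0 < n" for n :: nat
    using top that unfolding topological_field_def by blast
  interpret field M by (rule fld)
  have "diff_field M"
    by (intro diff_field.intro fld diff_field_axioms.intro der char0)
  interpret diff_field M P by fact
  have carr: "topspace \<tau> = carrier M" using ft by (simp add: field_topology_def)
  show ?thesis
  proof (intro diff_top_field.intro \<open>diff_field M\<close> diff_top_field_axioms.intro ft)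
    fix p :: 'p and f n a and V :: "nat \<Rightarrow> 'u set"
    assume p: "p \<in> P" and f: "f \<in> Pol (Suc n)" and a: "range a \<subseteq> carrier M"
      and zero: "ev p a f = \<zero>\<^bsub>M\<^esub>" and sep: "ev p a (pdiff M n f) \<noteq> \<zero>\<^bsub>M\<^esub>"
      and V: "\<And>i. i \<le> n \<Longrightarrow> openin \<tau> (V i) \<and> a i \<in> V i"
    \<comment> \<open>The scheme offers one neighbourhood \<open>W\<close> of zero for all
      coordinates; it is chosen inside the intersection of the finitely many translated open
      sets.\<close>
    define B where "B = (\<Inter>i\<in>{..n}. {w \<in> carrier M. w \<oplus>\<^bsub>M\<^esub> a i \<in> V i})"
    have ai: "a i \<in> carrier M" for i using a by blast
    have "openin \<tau> {w \<in> carrier M. w \<oplus>\<^bsub>M\<^esub> a i \<in> V i}" if "i \<le> n" for i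
    proof -
      have "continuous_map \<tau> (prod_topology \<tau> \<tau>) (\<lambda>w. (w, a i))"
        using ai[of i] carr by (simp add: continuous_map_pairwise o_def)
      then have "continuous_map \<tau> \<tau> (\<lambda>w. w \<oplus>\<^bsub>M\<^esub> a i)"
        using continuous_map_compose[of \<tau> _ "\<lambda>w. (w, a i)" \<tau> "\<lambda>(x, y). x \<oplus>\<^bsub>M\<^esub> y"] ft
        by (simp add: field_topology_def o_def)
      then show ?thesis
        using openin_continuous_map_preimage[of \<tau> \<tau> _ "V i"] V[OF that] carr by fastforce
    qed
    then have "openin \<tau> B" unfolding B_def by (intro openin_Inter) auto
    moreover have "\<zero>\<^bsub>M\<^esub> \<in> B" using V ai by (auto simp: B_def)
    ultimately obtain W where W: "W \<in> basic_nbhds M \<rho>" "W \<subseteq> B"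
      using via unfolding topological_field_via_def neighbourhood_base_at_def by blast
    obtain q where q: "q \<in> PS (Suc n)" "\<forall>x\<in>{..<Suc n} \<rightarrow> carrier M. poly_eval M q x = ev p x f \<and>
        (\<forall>j. poly_eval M (poly_deriv M j q) x = ev p x (pdiff M j f))"
      using ex_indexed_poly[OF f p] by blast
    \<comment> \<open>Indexed polynomials are evaluated at tuples and \<open>ev\<close> at
      sequences; truncation is harmless as no coordinate above \<open>n\<close> occurs.\<close>
    have res: "poly_eval M q (restrict b {..<Suc n}) = ev p b f \<and>
        poly_eval M (poly_deriv M n q) (restrict b {..<Suc n}) = ev p b (pdiff M n f)"
      if "range b \<subseteq> carrier M" for b
    proof -
      have "restrict b {..<Suc n} \<in> {..<Suc n} \<rightarrow> carrier M" using that by auto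
      moreover have "ev p (restrict b {..<Suc n}) h = ev p b h" if "h \<in> Pol (Suc n)" for h
        by (rule dev_cong[OF that]) simp
      ultimately show ?thesis using q(2) f by simp
    qed
    let ?\<alpha> = "restrict a {..<Suc n}"
    have \<alpha>: "?\<alpha> \<in> tuples M (Suc n)" using ai by auto
    have "poly_eval M q ?\<alpha> = \<zero>\<^bsub>M\<^esub> \<and> poly_eval M (poly_deriv M n q) ?\<alpha> \<noteq> \<zero>\<^bsub>M\<^esub>"
      using res[OF a] zero sep by simp
    from DL[unfolded scheme_DL_def, rule_format, OF q(1) W(1) \<alpha> this]
    obtain z where z: "z \<in> carrier M" "poly_eval M q (jet M n z) = \<zero>\<^bsub>M\<^esub>"
      "poly_eval M (poly_deriv M n q) (jet M n z) \<noteq> \<zero>\<^bsub>M\<^esub>"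
      "\<forall>i\<le>n. (der M ^^ i) z \<ominus>\<^bsub>M\<^esub> ?\<alpha> i \<in> W"
      by blast
    have jet: "jet M n z = restrict (dseq M z) {..<Suc n}" by (auto simp: jet_def dseq_def fun_eq_iff)
    have "dseq M z i \<in> V i" if "i \<le> n" for i
    proof -
      have "dseq M z i \<ominus>\<^bsub>M\<^esub> a i \<in> B" using z(4) that W(2) by (auto simp: dseq_def)
      then have "(dseq M z i \<ominus>\<^bsub>M\<^esub> a i) \<oplus>\<^bsub>M\<^esub> a i \<in> V i" using that by (auto simp: B_def)
      moreover have "(dseq M z i \<ominus>\<^bsub>M\<^esub> a i) \<oplus>\<^bsub>M\<^esub> a i = dseq M z i"
        using ai[of i] z(1) by (simp add: a_minus_def a_assoc l_neg)
      ultimately show ?thesis by simp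
    qed
    then show "\<exists>z\<in>carrier M. ev p (dseq M z) f = \<zero>\<^bsub>M\<^esub> \<and> ev p (dseq M z) (pdiff M n f) \<noteq> \<zero>\<^bsub>M\<^esub> \<and>
         (\<forall>i\<le>n. dseq M z i \<in> V i)"
      using z(1-3) res[OF range_dseq[OF z(1)]] unfolding jet by (intro bexI[of _ z]) auto
  qed
qed

section \<open>From definable sets of tuples to solution sets in one variable\<close>

lemma sat_FEx_list:
  "sat A e (foldr FEx vs \<phi>) \<longleftrightarrow>
    (\<exists>e'. (\<forall>j. j \<notin> set vs \<longrightarrow> e' j = e j) \<and> (\<forall>j\<in>set vs. e' j \<in> carrier A) \<and> sat A e' \<phi>)"
proof (induction vs arbitrary: e)
  case Nil
  have "(\<forall>j. e' j = e j) \<longleftrightarrow> e' = e" for e' :: "nat \<Rightarrow> 'a" by auto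
  then show ?case by simp
next
  case (Cons v vs)
  show ?case
  proof
    assume "sat A e (foldr FEx (v # vs) \<phi>)"
    then obtain b e' where "b \<in> carrier A" "\<forall>j. j \<notin> set vs \<longrightarrow> e' j = (e(v := b)) j"
      "\<forall>j\<in>set vs. e' j \<in> carrier A" "sat A e' \<phi>" using Cons by auto
    then show "\<exists>e'. (\<forall>j. j \<notin> set (v # vs) \<longrightarrow> e' j = e j) \<and> (\<forall>j\<in>set (v # vs). e' j \<in> carrier A) \<and> sat A e' \<phi>"
      by (intro exI[of _ e']) auto
  next
    assume "\<exists>e'. (\<forall>j. j \<notin> set (v # vs) \<longrightarrow> e' j = e j) \<and> (\<forall>j\<in>set (v # vs). e' j \<in> carrier A) \<and> sat A e' \<phi>"
    then obtain e' where e': "\<forall>j. j \<notin> set (v # vs) \<longrightarrow> e' j = e j" "\<forall>j\<in>set (v # vs). e' j \<in> carrier A"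
      "sat A e' \<phi>" by blast
    have "sat A (e(v := e' v)) (foldr FEx vs \<phi>)"
      unfolding Cons by (rule exI[of _ e']) (use e' in auto)
    then show "sat A e (foldr FEx (v # vs) \<phi>)" using e'(2) by auto
  qed
qed

lemma fm_in_FEx_list: "fm_in L Ops (foldr FEx vs \<phi>) \<longleftrightarrow> fm_in L Ops \<phi>"
  by (induction vs) auto

lemma append_tuple_inject:
  assumes "x \<in> tuples M m" "y \<in> tuples M n" "x' \<in> tuples M m" "y' \<in> tuples M n"
    and "append_tuple m n (x, y) = append_tuple m n (x', y')"
  shows "x = x' \<and> y = y'"
proof
  show "x = x'"
  proof (rule PiE_ext[OF assms(1,3)])
    fix i assume "i \<in> {..<m}"
    then show "x i = x' i" using fun_cong[OF assms(5), of i] by (simp add: append_tuple_def)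
  qed
  show "y = y'"
  proof (rule PiE_ext[OF assms(2,4)])
    fix i assume "i \<in> {..<n}"
    then show "y i = y' i" using fun_cong[OF assms(5), of "m + i"] by (simp add: append_tuple_def)
  qed
qed

text \<open>A finite fibre lies in the product of its coordinate projections. These are finite too
  and are defined in one variable by quantifying over the other coordinates, so the product of their
  bounds is a bound for the fibre.\<close>

lemma uniform_finiteness_if_bounded:
  fixes M :: "('u, 'r, 'c) struct"
  assumes ne: "d \<in> carrier M"
    and bounded: "\<And>\<phi> k. fm_in L Ops \<phi> \<Longrightarrow>
      \<exists>N. \<forall>e\<in>assignments M. infinite (solutions M \<phi> k e) \<or> card (solutions M \<phi> k e) \<le> N"
  shows "uniform_finiteness L Ops M"
  unfolding uniform_finiteness_def
proof (intro allI impI)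
  fix m n S
  assume "m \<ge> 1 \<and> n \<ge> 1 \<and> S \<subseteq> tuples M m \<times> tuples M n \<and>
    definable L Ops M (m + n) (append_tuple m n ` S)"
  then have S: "S \<subseteq> tuples M m \<times> tuples M n" and "definable L Ops M (m + n) (append_tuple m n ` S)"
    by auto
  then obtain \<phi> e0 where e0: "e0 \<in> assignments M" and \<phi>: "fm_in L Ops \<phi>"
    and def: "append_tuple m n ` S =
      {x \<in> tuples M (m + n). sat M (\<lambda>k. if k < m + n then x k else e0 k) \<phi>}"
    unfolding definable_def by blast
  define \<psi> where "\<psi> i = foldr FEx (filter (\<lambda>j. j \<noteq> m + i) [m..<m + n]) \<phi>" for i
  have "\<forall>i. \<exists>N. \<forall>e\<in>assignments M. infinite (solutions M (\<psi> i) (m + i) e) \<or>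
      card (solutions M (\<psi> i) (m + i) e) \<le> N"
    using bounded \<phi> by (simp add: \<psi>_def fm_in_FEx_list)
  from choice[OF this] obtain N where N: "\<And>i e. e \<in> assignments M \<Longrightarrow>
      infinite (solutions M (\<psi> i) (m + i) e) \<or> card (solutions M (\<psi> i) (m + i) e) \<le> N i"
    by blast
  have S_iff: "(x, y) \<in> S \<longleftrightarrow>
      sat M (\<lambda>k. if k < m + n then append_tuple m n (x, y) k else e0 k) \<phi>"
    if x: "x \<in> tuples M m" and y: "y \<in> tuples M n" for x y
  proof -
    have "append_tuple m n (x, y) \<in> tuples M (m + n)"
      using x y by (auto simp: append_tuple_def PiE_iff)
    moreover have "(x, y) \<in> S \<longleftrightarrow> append_tuple m n (x, y) \<in> append_tuple m n ` S"
    proof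
      assume "append_tuple m n (x, y) \<in> append_tuple m n ` S"
      then obtain x' y' where xy: "(x', y') \<in> S" "append_tuple m n (x, y) = append_tuple m n (x', y')"
        by auto
      then have "x = x' \<and> y = y'" using append_tuple_inject[OF x y] S by blast
      then show "(x, y) \<in> S" using xy by simp
    qed simp
    ultimately show ?thesis unfolding def by blast
  qed
  show "\<exists>N. \<forall>x\<in>tuples M m. infinite {y \<in> tuples M n. (x, y) \<in> S} \<or>
      finite {y \<in> tuples M n. (x, y) \<in> S} \<and> card {y \<in> tuples M n. (x, y) \<in> S} \<le> N"
  proof (intro exI ballI)
    fix x assume x: "x \<in> tuples M m"
    let ?Y = "{y \<in> tuples M n. (x, y) \<in> S}"
    \<comment> \<open>\<open>d\<close> is a mere placeholder: in \<open>\<psi> i\<close> the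
      variables from \<open>m\<close> to \<open>m + n - 1\<close> are quantified, except
      \<open>m + i\<close>, which receives the candidate value.\<close>
    define ex where "ex k = (if k < m then x k else if k < m + n then d else e0 k)" for k
    have ex: "ex \<in> assignments M" using x e0 ne by (auto simp: ex_def)
    have proj: "solutions M (\<psi> i) (m + i) ex = (\<lambda>y. y i) ` ?Y" if i: "i < n" for i
    proof (intro equalityI subsetI)
      fix b assume "b \<in> solutions M (\<psi> i) (m + i) ex"
      then have b: "b \<in> carrier M" "sat M (ex(m + i := b)) (\<psi> i)" by (auto simp: solutions_def)
      from b(2) obtain e' where e': "\<And>j. j \<notin> {m..<m + n} - {m + i} \<Longrightarrow> e' j = (ex(m + i := b)) j"
        "\<And>j. j \<in> {m..<m + n} - {m + i} \<Longrightarrow> e' j \<in> carrier M" "sat M e' \<phi>"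
        unfolding \<psi>_def sat_FEx_list by auto
      define y where "y = (\<lambda>j\<in>{..<n}. e' (m + j))"
      have "e' (m + j) \<in> carrier M" if "j < n" for j
        using e'(1)[of "m + j"] e'(2)[of "m + j"] b(1) that by (cases "j = i") auto
      then have y: "y \<in> tuples M n" by (auto simp: y_def)
      have "(\<lambda>k. if k < m + n then append_tuple m n (x, y) k else e0 k) = e'"
      proof
        fix k
        show "(if k < m + n then append_tuple m n (x, y) k else e0 k) = e' k"
          using e'(1)[of k] i by (auto simp: append_tuple_def y_def ex_def)
      qed
      then have "(x, y) \<in> S" using S_iff[OF x y] e'(3) by simp
      moreover have "y i = b" using e'(1)[of "m + i"] i by (simp add: y_def)
      ultimately show "b \<in> (\<lambda>y. y i) ` ?Y" using y by blast
    next
      fix b assume "b \<in> (\<lambda>y. y i) ` ?Y"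
      then obtain y where y: "y \<in> tuples M n" "(x, y) \<in> S" "b = y i" by blast
      let ?e = "\<lambda>k. if k < m + n then append_tuple m n (x, y) k else e0 k"
      have b: "b \<in> carrier M" using y(1,3) i by auto
      have "sat M (ex(m + i := b)) (\<psi> i)"
        unfolding \<psi>_def sat_FEx_list
      proof (intro exI[of _ ?e] conjI allI impI ballI)
        show "?e j = (ex(m + i := b)) j" if "j \<notin> set (filter (\<lambda>j. j \<noteq> m + i) [m..<m + n])" for j
        proof -
          have "j < m \<or> m + n \<le> j \<or> j = m + i" using that by (simp add: not_less) linarith
          then show ?thesis using i y(3) by (elim disjE) (simp_all add: append_tuple_def ex_def)
        qed
        show "?e j \<in> carrier M" if "j \<in> set (filter (\<lambda>j. j \<noteq> m + i) [m..<m + n])" for j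
          using that y(1) by (auto simp: append_tuple_def PiE_iff)
        show "sat M ?e \<phi>" using S_iff[OF x y(1)] y(2) by simp
      qed
      then show "b \<in> solutions M (\<psi> i) (m + i) ex" using b by (simp add: solutions_def)
    qed
    show "infinite ?Y \<or> finite ?Y \<and> card ?Y \<le> (\<Prod>i<n. N i)"
    proof (cases "finite ?Y")
      case True
      have fin: "finite ((\<lambda>y. y i) ` ?Y)" for i using True by simp
      have card: "card ((\<lambda>y. y i) ` ?Y) \<le> N i" if "i < n" for i
        using N[OF ex, of i] fin[of i] proj[OF that] by simp
      have "?Y \<subseteq> (\<Pi>\<^sub>E i\<in>{..<n}. (\<lambda>y. y i) ` ?Y)"
        by (auto simp: PiE_iff extensional_def)
      moreover have "finite (\<Pi>\<^sub>E i\<in>{..<n}. (\<lambda>y. y i) ` ?Y)" using fin by (intro finite_PiE) auto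
      ultimately have "card ?Y \<le> card (\<Pi>\<^sub>E i\<in>{..<n}. (\<lambda>y. y i) ` ?Y)" by (intro card_mono)
      also have "\<dots> = (\<Prod>i<n. card ((\<lambda>y. y i) ` ?Y))" by (simp add: card_PiE)
      also have "\<dots> \<le> (\<Prod>i<n. N i)" using card by (intro prod_mono) auto
      finally show ?thesis using True by blast
    qed blast
  qed
qed

theorem corollary3p8:
  fixes L :: "('r, 'c) language"
    and T Tc :: "('r, 'c) fm set"
    and \<rho> :: "('r, 'c) fm"
    and M :: "('u, 'r, 'c) struct"
  assumes T_universal: "is_universal_theory L {Inverse} T"
    and rho_formula: "fm_in L {Inverse} \<rho>"
    and T_topological: "\<forall>A\<in>(Models L {Inverse} T :: ('u, 'r, 'c) struct set). \<exists>\<tau>. topological_field_via L \<rho> A \<tau>"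
    and Tc_theory: "is_theory L {Inverse} Tc"
    and Tc_model_completion: "model_completion L {Inverse}
           (Models L {Inverse} T) (Models L {Inverse} Tc :: ('u, 'r, 'c) struct set)"
    and TcD_star_model_completion: "model_completion L {Inverse, Deriv}
           (Models_D L T) (Models_D_star L \<rho> Tc :: ('u, 'r, 'c) struct set)"
    and TcD_star_QE: "quantifier_elimination L {Inverse, Deriv}
           (Models_D_star L \<rho> Tc :: ('u, 'r, 'c) struct set)"
    and Tc_skolem: "finite_skolem_functions L (Models L {Inverse} Tc :: ('u, 'r, 'c) struct set)"
    and Tc_continuity: "local_continuity L \<rho> (Models L {Inverse} Tc :: ('u, 'r, 'c) struct set)"
    and Tc_exchange: "acl_exchange L (Models L {Inverse} Tc :: ('u, 'r, 'c) struct set)"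
    and M_model: "M \<in> Models_D_star L \<rho> Tc"
  shows "uniform_finiteness L {Inverse, Deriv} M"
proof (rule uniform_finiteness_if_bounded)
  have M: "M \<in> Models L {Inverse} Tc" "is_derivation M" "scheme_DL \<rho> M"
    using M_model by (auto simp: Models_D_star_def Models_D_def)
  \<comment> \<open>A model completion is a subclass of the original class, so \<open>M\<close>
    inherits the topology defined by \<open>\<rho>\<close>.\<close>
  then have "M \<in> Models L {Inverse} T"
    using Tc_model_completion unfolding model_completion_def by blast
  then obtain \<tau> where via: "topological_field_via L \<rho> M \<tau>" using T_topological by blast
  then have top: "topological_field L M \<tau>" by (simp add: topological_field_via_def)
  have dtf: "diff_top_field M (assignments M) \<tau>" by (rule diff_top_fieldI[OF via M(2,3)])
  show "\<zero>\<^bsub>M\<^esub> \<in> carrier M" using top by (simp add: topological_field_def is_struct_def)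
  fix \<phi> :: "('r, 'c) fm" and k
  assume "fm_in L {Inverse, Deriv} \<phi>"
  then obtain \<psi> where \<psi>: "fm_in L {Inverse, Deriv} \<psi>" "qfree \<psi>"
    "\<forall>A\<in>(Models_D_star L \<rho> Tc :: ('u, 'r, 'c) struct set). \<forall>e\<in>assignments A. sat A e \<phi> \<longleftrightarrow> sat A e \<psi>"
    using TcD_star_QE unfolding quantifier_elimination_def by blast
  have "solutions M \<phi> k e = solutions M \<psi> k e" if "e \<in> assignments M" for e
  proof -
    have "e(k := b) \<in> assignments M" if "b \<in> carrier M" for b
      using that \<open>e \<in> assignments M\<close> by auto
    then show ?thesis using \<psi>(3) M_model unfolding solutions_def by blast
  qed
  then show "\<exists>N. \<forall>e\<in>assignments M. infinite (solutions M \<phi> k e) \<or> card (solutions M \<phi> k e) \<le> N"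
    using qfree_solutions_bounded[OF dtf top \<psi>(2,1), of k] by simp
qed

end
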